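(* Let $a\in L^\infty_{\mathrm{loc}}([0,\infty))$ with $a(x)\ge 0$ for almost all $x>0$, let $b:(0,\infty)^2\to[0,\infty)$ be measurable with $b(x,y)=0$ for almost all $x,y$ with $x>y$, and let $\omega:[0,\infty)\to[0,\infty)$ be measurable. Assume that there exist $\kappa_1>0$, $\kappa_2\in(0,1)$ and $\eta_0>0$ such that $$\int_0^y b(x,y)\omega(x)\,\mathrm{d}x\le\kappa_1\omega(y)\quad\text{for all } y\in(0,\eta_0],\qquad \int_0^y b(x,y)\omega(x)\,\mathrm{d}x\le\kappa_2\omega(y)\quad\text{for all } y\ge\eta_0.$$ Then the operator $G^{(\omega)}=A^{(\omega)}+B^{(\omega)}$ with domain $\mathcal{D}(A^{(\omega)})$ is the generator of an analytic, positive $C_0$-semigroup $(S^{(\omega)}(t))_{t\ge0}$ on $X_\omega$. If $\kappa_1\le1$, then $(S^{(\omega)}(t))_{t\ge0}$ is also substochastic.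
   Context: For a non-negative measurable function $\omega$ on $[0,\infty)$, $X_\omega = L^1((0,\infty),\omega(x)\,\mathrm{d}x)$ is the real Banach space with norm $\|f\|_\omega=\int_0^\infty|f(x)|\omega(x)\,\mathrm{d}x$, ordered by the pointwise almost-everywhere order. The operators in $X_\omega$ are $A^{(\omega)}f=-af$ with domain $\mathcal{D}(A^{(\omega)})=\{f\in X_\omega: af\in X_\omega\}$, and $(B^{(\omega)}f)(x)=\int_x^\infty a(y)b(x,y)f(y)\,\mathrm{d}y$ for $x>0$, with domain $\mathcal{D}(B^{(\omega)})=\{f\in X_\omega: B^{(\omega)}f\in X_\omega\}$. A $C_0$-semigroup $(S(t))_{t\ge0}$ is positive if $S(t)f\ge0$ for all $f\ge0$ and $t\ge0$; a positive semigroup is substochastic if $\|S(t)\|\le1$ for all $t\ge0$. Analyticity of a semigroup on $X_\omega$ is understood on the complexification of $X_\omega$, which is the corresponding weighted $L^1$ space of complex-valued functions. *)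

theory Defs
  imports "HOL-Analysis.Analysis"
begin

text \<open>
  The Lebesgue space of a measure is represented by its integrable functions, two of which stand
  for the same element iff they agree almost everywhere. Hence operators act on representatives,
  and all identities between elements of the space are stated almost everywhere. An operator that is
  linear and bounded in the sense below sends a.e. equal functions to a.e. equal functions, so it
  induces an operator on the quotient space; conversely, every bounded operator on the quotient
  is induced in this way. The scalar field \<open>'k\<close> will be \<open>real\<close> or \<open>complex\<close>.
\<close>

definition L1 :: "'a measure \<Rightarrow> ('a \<Rightarrow> 'k::{real_normed_field, banach, second_countable_topology}) set" where
  "L1 M = {f. integrable M f}"

definition L1_norm :: "'a measure \<Rightarrow> ('a \<Rightarrow> 'k::{real_normed_field, banach, second_countable_topology}) \<Rightarrow> real" where
  "L1_norm M f = (LINT x|M. norm (f x))"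

definition ae_eq :: "'a measure \<Rightarrow> ('a \<Rightarrow> 'k) \<Rightarrow> ('a \<Rightarrow> 'k) \<Rightarrow> bool" where
  "ae_eq M f g \<longleftrightarrow> (AE x in M. f x = g x)"


definition bounded_operator ::
  "'a measure \<Rightarrow> (('a \<Rightarrow> 'k) \<Rightarrow> ('a \<Rightarrow> 'k::{real_normed_field, banach, second_countable_topology})) \<Rightarrow> bool" where
  "bounded_operator M T \<longleftrightarrow>
     (\<forall>f\<in>L1 M. T f \<in> L1 M) \<and>
     (\<forall>f\<in>L1 M. \<forall>g\<in>L1 M. ae_eq M (T (\<lambda>x. f x + g x)) (\<lambda>x. T f x + T g x)) \<and>
     (\<forall>c. \<forall>f\<in>L1 M. ae_eq M (T (\<lambda>x. c * f x)) (\<lambda>x. c * T f x)) \<and>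
     (\<exists>K. \<forall>f\<in>L1 M. L1_norm M (T f) \<le> K * L1_norm M f)"

text \<open>As for \<^const>\<open>onorm\<close>, null vectors contribute \<open>0 / 0 = 0\<close>; the supremum is meaningful for
  bounded operators only.\<close>

definition op_norm ::
  "'a measure \<Rightarrow> (('a \<Rightarrow> 'k) \<Rightarrow> ('a \<Rightarrow> 'k::{real_normed_field, banach, second_countable_topology})) \<Rightarrow> real" where
  "op_norm M T = (SUP f\<in>L1 M. L1_norm M (T f) / L1_norm M f)"

definition C0_semigroup ::
  "'a measure \<Rightarrow> (real \<Rightarrow> ('a \<Rightarrow> 'k) \<Rightarrow> ('a \<Rightarrow> 'k::{real_normed_field, banach, second_countable_topology})) \<Rightarrow> bool" where
  "C0_semigroup M S \<longleftrightarrow>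
     (\<forall>t\<ge>0. bounded_operator M (S t)) \<and>
     (\<forall>f\<in>L1 M. ae_eq M (S 0 f) f) \<and>
     (\<forall>s\<ge>0. \<forall>t\<ge>0. \<forall>f\<in>L1 M. ae_eq M (S (s + t) f) (S s (S t f))) \<and>
     (\<forall>f\<in>L1 M. ((\<lambda>t. L1_norm M (\<lambda>x. S t f x - f x)) \<longlongrightarrow> 0) (at_right 0))"

definition has_generator_value ::
  "'a measure \<Rightarrow> (real \<Rightarrow> ('a \<Rightarrow> 'k) \<Rightarrow> ('a \<Rightarrow> 'k::{real_normed_field, banach, second_countable_topology}))
    \<Rightarrow> ('a \<Rightarrow> 'k) \<Rightarrow> ('a \<Rightarrow> 'k) \<Rightarrow> bool" where
  "has_generator_value M S f g \<longleftrightarrow> f \<in> L1 M \<and> g \<in> L1 M \<and>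
     ((\<lambda>t. L1_norm M (\<lambda>x. (S t f x - f x) / of_real t - g x)) \<longlongrightarrow> 0) (at_right 0)"

text \<open>The operator \<open>G\<close> with domain \<open>D\<close> is the generator of \<open>S\<close>: the domain consists
  of exactly those elements at which the difference quotients converge.\<close>

definition is_generator ::
  "'a measure \<Rightarrow> (real \<Rightarrow> ('a \<Rightarrow> 'k) \<Rightarrow> ('a \<Rightarrow> 'k::{real_normed_field, banach, second_countable_topology}))
    \<Rightarrow> ('a \<Rightarrow> 'k) set \<Rightarrow> (('a \<Rightarrow> 'k) \<Rightarrow> ('a \<Rightarrow> 'k)) \<Rightarrow> bool" where
  "is_generator M S D G \<longleftrightarrow>
     D = {f. \<exists>g. has_generator_value M S f g} \<and> (\<forall>f\<in>D. has_generator_value M S f (G f))"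

definition positive_semigroup :: "'a measure \<Rightarrow> (real \<Rightarrow> ('a \<Rightarrow> real) \<Rightarrow> ('a \<Rightarrow> real)) \<Rightarrow> bool" where
  "positive_semigroup M S \<longleftrightarrow>
     (\<forall>t\<ge>0. \<forall>f\<in>L1 M. (AE x in M. 0 \<le> f x) \<longrightarrow> (AE x in M. 0 \<le> S t f x))"

definition substochastic_semigroup :: "'a measure \<Rightarrow> (real \<Rightarrow> ('a \<Rightarrow> real) \<Rightarrow> ('a \<Rightarrow> real)) \<Rightarrow> bool" where
  "substochastic_semigroup M S \<longleftrightarrow> positive_semigroup M S \<and> (\<forall>t\<ge>0. op_norm M (S t) \<le> 1)"

definition sector :: "real \<Rightarrow> complex set" where
  "sector \<theta> = {z. z \<noteq> 0 \<and> \<bar>Arg z\<bar> < \<theta>}"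

definition operator_analytic_on ::
  "'a measure \<Rightarrow> (complex \<Rightarrow> ('a \<Rightarrow> complex) \<Rightarrow> ('a \<Rightarrow> complex)) \<Rightarrow> complex set \<Rightarrow> bool" where
  "operator_analytic_on M T U \<longleftrightarrow>
     (\<forall>z\<in>U. \<exists>D. bounded_operator M D \<and>
        ((\<lambda>h. op_norm M (\<lambda>f x. (T (z + h) f x - T z f x) / h - D f x)) \<longlongrightarrow> 0) (at 0))"

definition complexification ::
  "(('a \<Rightarrow> real) \<Rightarrow> ('a \<Rightarrow> real)) \<Rightarrow> ('a \<Rightarrow> complex) \<Rightarrow> ('a \<Rightarrow> complex)" where
  "complexification T f = (\<lambda>x. Complex (T (\<lambda>y. Re (f y)) x) (T (\<lambda>y. Im (f y)) x))"

text \<open>A semigroup on the real space is analytic if its complexification extends to an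
  analytic semigroup (not necessarily bounded) on some sector.\<close>

definition analytic_semigroup :: "'a measure \<Rightarrow> (real \<Rightarrow> ('a \<Rightarrow> real) \<Rightarrow> ('a \<Rightarrow> real)) \<Rightarrow> bool" where
  "analytic_semigroup M S \<longleftrightarrow>
     (\<exists>\<theta> T. 0 < \<theta> \<and> \<theta> \<le> pi / 2 \<and>
        (\<forall>z\<in>insert 0 (sector \<theta>). bounded_operator M (T z)) \<and>
        (\<forall>t\<ge>0. \<forall>f\<in>L1 M. ae_eq M (T (of_real t) f) (complexification (S t) f)) \<and>
        (\<forall>f\<in>L1 M. ae_eq M (T 0 f) f) \<and>
        (\<forall>z\<in>sector \<theta>. \<forall>w\<in>sector \<theta>. \<forall>f\<in>L1 M. ae_eq M (T (z + w) f) (T z (T w f))) \<and>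
        operator_analytic_on M T (sector \<theta>) \<and>
        (\<forall>\<theta>'. 0 < \<theta>' \<and> \<theta>' < \<theta> \<longrightarrow>
           (\<forall>f\<in>L1 M. ((\<lambda>z. L1_norm M (\<lambda>x. T z f x - f x)) \<longlongrightarrow> 0) (at 0 within sector \<theta>'))))"

definition weighted :: "(real \<Rightarrow> real) \<Rightarrow> real measure" where
  "weighted \<omega> = density (lebesgue_on {0<..}) (\<lambda>x. ennreal (\<omega> x))"

definition Linf_loc :: "(real \<Rightarrow> real) \<Rightarrow> bool" where
  "Linf_loc a \<longleftrightarrow> a \<in> borel_measurable (lebesgue_on {0..}) \<and>
     (\<forall>K. compact K \<and> K \<subseteq> {0..} \<longrightarrow> (\<exists>C. AE x in lebesgue_on K. \<bar>a x\<bar> \<le> C))"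

definition A_op :: "(real \<Rightarrow> real) \<Rightarrow> (real \<Rightarrow> real) \<Rightarrow> (real \<Rightarrow> real)" where
  "A_op a f = (\<lambda>x. - a x * f x)"

definition A_dom :: "(real \<Rightarrow> real) \<Rightarrow> (real \<Rightarrow> real) \<Rightarrow> (real \<Rightarrow> real) set" where
  "A_dom \<omega> a = {f \<in> L1 (weighted \<omega>). (\<lambda>x. a x * f x) \<in> L1 (weighted \<omega>)}"

definition B_op :: "(real \<Rightarrow> real) \<Rightarrow> (real \<Rightarrow> real \<Rightarrow> real) \<Rightarrow> (real \<Rightarrow> real) \<Rightarrow> (real \<Rightarrow> real)" where
  "B_op a b f = (\<lambda>x. LINT y:{x<..}|lebesgue. a y * b x y * f y)"

text \<open>The integrability clause makes explicit that the integral defining \<^const>\<open>B_op\<close> exists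
  at almost every point: the library assigns the value \<open>0\<close> to a divergent integral.\<close>

definition B_dom :: "(real \<Rightarrow> real) \<Rightarrow> (real \<Rightarrow> real) \<Rightarrow> (real \<Rightarrow> real \<Rightarrow> real) \<Rightarrow> (real \<Rightarrow> real) set" where
  "B_dom \<omega> a b = {f \<in> L1 (weighted \<omega>).
     (AE x in weighted \<omega>. set_integrable lebesgue {x<..} (\<lambda>y. a y * b x y * f y)) \<and>
     B_op a b f \<in> L1 (weighted \<omega>)}"

end

theory Submission
  imports Defs "HOL-Complex_Analysis.Complex_Analysis"
begin

text \<open>
  On functions supported in \<open>(0, n]\<close> the operator \<open>G = A + B\<close> is bounded and leaves the support
  condition invariant, because \<open>a\<close> is locally bounded and fragmentation only decreases sizes.
  There \<open>exp(zG)\<close> is a norm-convergent series for every complex \<open>z\<close>, and all that is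
  needed is a bound uniform in \<open>n\<close>. Since \<open>|1 - w| \<le> 1 - Re w + |w|\<^sup>2/2\<close> and
  \<open>\<parallel>Bf\<parallel> \<le> k \<parallel>af\<parallel> + C \<parallel>f\<parallel>\<close> with \<open>k = \<kappa>\<^sub>2 < 1\<close>, one Euler step satisfies
  \<open>\<parallel>1 + zG/N\<parallel> \<le> 1 + C|z|/N + O(1/N\<^sup>2)\<close> as soon as \<open>k|z| \<le> Re z\<close>, whence
  \<open>\<parallel>exp(zG)\<parallel> \<le> exp(C|z|)\<close> on this sector, with a constant independent of \<open>n\<close>. The semigroup is
  the strong limit; Cauchy estimates, reduced to scalar functions by norming functionals, carry
  differentiability in \<open>z\<close> over to the limit. If \<open>\<kappa>\<^sub>1 \<le> 1\<close>, the Euler step bound holds for real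
  \<open>z\<close> with \<open>C = 0\<close>. The generator is identified through the Neumann series of \<open>B(\<mu> - A)\<^sup>-\<^sup>1\<close>,
  whose norm is below \<open>1\<close> for \<open>\<mu> = C + 1\<close>.
\<close>

text \<open>On small sizes \<open>\<kappa>\<^sub>1\<close> may exceed 1, so there the gain need not
  be dominated by the loss with a constant below 1. Local boundedness of \<open>a\<close> repairs
  this: if \<open>a \<le> B\<close> on (0, \<open>\<eta>\<^sub>0\<close>], the gain from these sizes
  is a bounded operator of norm at most \<open>\<kappa>\<^sub>1 * B\<close>, and this number is the
  constant \<open>C\<close>. Hence \<open>k = \<kappa>\<^sub>2\<close> alone fixes the half-angle
  \<open>arccos k\<close> of the sector, and \<open>\<kappa>\<^sub>1\<close> affects only the growth
  rate.

  The norms of the truncated generators may grow without bound, so no estimate that is passed to the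
  limit may contain them. In the Euler step the bound of \<open>a\<close> on the truncation occurs
  only in the term of order 1/N^2, which disappears as N grows; the Cauchy estimates use only bounds
  of the exponential itself.

  The substitution u = w f moves the weighted space to the unweighted line and turns the moment
  conditions into bounds on the column masses of the conjugated kernel w(x) b(x,y) a(y) / w(y). The
  zeros of the weight need separate care, since the substitution cannot be inverted there.\<close>

section \<open>The Banach algebra of bounded endomorphisms\<close>

text \<open>The type of bounded linear functions has no multiplication, hence no \<^const>\<open>exp\<close>.\<close>

typedef (overloaded) 'a endo = "UNIV :: ('a::real_normed_vector \<Rightarrow>\<^sub>L 'a) set"
  morphisms blin Endo ..

setup_lifting type_definition_endo

instantiation endo :: (real_normed_vector) real_normed_vector
begin

lift_definition zero_endo :: "'a endo" is 0 .
lift_definition plus_endo :: "'a endo \<Rightarrow> 'a endo \<Rightarrow> 'a endo" is "(+)" .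
lift_definition minus_endo :: "'a endo \<Rightarrow> 'a endo \<Rightarrow> 'a endo" is "(-)" .
lift_definition uminus_endo :: "'a endo \<Rightarrow> 'a endo" is uminus .
lift_definition scaleR_endo :: "real \<Rightarrow> 'a endo \<Rightarrow> 'a endo" is scaleR .
lift_definition norm_endo :: "'a endo \<Rightarrow> real" is norm .
definition dist_endo :: "'a endo \<Rightarrow> 'a endo \<Rightarrow> real" where "dist_endo S T = norm (S - T)"
definition sgn_endo :: "'a endo \<Rightarrow> 'a endo" where "sgn_endo S = inverse (norm S) *\<^sub>R S"
definition [code del]: "(uniformity :: ('a endo \<times> 'a endo) filter)
  = (INF e\<in>{0 <..}. principal {(x, y). dist x y < e})"
definition "open_endo (U :: 'a endo set)
  \<longleftrightarrow> (\<forall>x\<in>U. eventually (\<lambda>(x', y). x' = x \<longrightarrow> y \<in> U) uniformity)"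

instance
proof
  fix S T U :: "'a endo" and r s :: real and V :: "'a endo set"
  show "norm (S + T) \<le> norm S + norm T"
    by transfer (rule norm_triangle_ineq)
  show "(norm S = 0) = (S = 0)" by transfer simp
  show "norm (r *\<^sub>R S) = \<bar>r\<bar> * norm S" by transfer simp
qed (simp_all add: dist_endo_def sgn_endo_def uniformity_endo_def open_endo_def,
     (transfer, simp add: algebra_simps)+)

end

lift_definition app :: "'a::real_normed_vector endo \<Rightarrow> 'a \<Rightarrow> 'a" (infixr "$$" 75) is blinfun_apply .

lemma endo_eqI: "(\<And>u. S $$ u = T $$ u) \<Longrightarrow> S = T"
  by transfer (rule blinfun_eqI)

lemma app_bilinear: "bounded_bilinear app"
proof
  fix S S' :: "'a endo" and u u' :: 'a and r :: real
  show "(S + S') $$ u = S $$ u + S' $$ u" "(r *\<^sub>R S) $$ u = r *\<^sub>R (S $$ u)"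
    "S $$ (u + u') = S $$ u + S $$ u'" "S $$ (r *\<^sub>R u) = r *\<^sub>R (S $$ u)"
    by (transfer, simp add: blinfun.bilinear_simps)+
  show "\<exists>K. \<forall>S u::'a. norm (S $$ u) \<le> norm S * norm u * K"
    by (rule exI[of _ 1], transfer) (simp add: norm_blinfun)
qed

interpretation app: bounded_bilinear app by (rule app_bilinear)

lemmas app_simps = app.add_left app.add_right app.diff_left app.diff_right app.minus_left
  app.minus_right app.zero_left app.zero_right app.scaleR_left app.scaleR_right

lemma norm_app: "norm (T $$ u) \<le> norm T * norm u"
  by transfer (rule norm_blinfun)

lemma norm_endo_le:
  assumes "0 \<le> K" "\<And>u. norm (T $$ u) \<le> K * norm u"
  shows "norm T \<le> K"
  using assms by transfer (rule norm_blinfun_bound)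

lift_definition endo :: "('a::real_normed_vector \<Rightarrow> 'a) \<Rightarrow> 'a endo" is Blinfun .

lemma app_endo: "bounded_linear f \<Longrightarrow> endo f $$ u = f u"
  by transfer (simp add: bounded_linear_Blinfun_apply)

instance endo :: (banach) banach
proof
  fix X :: "nat \<Rightarrow> 'a endo" assume "Cauchy X"
  then have "Cauchy (\<lambda>n. blin (X n))"
    by (simp add: Cauchy_def dist_norm norm_endo.rep_eq minus_endo.rep_eq)
  then obtain L where "(\<lambda>n. blin (X n)) \<longlonglongrightarrow> L"
    by (auto simp: Cauchy_convergent_iff convergent_def)
  then have "X \<longlonglongrightarrow> Endo L"
    by (simp add: LIMSEQ_iff norm_endo.rep_eq minus_endo.rep_eq Endo_inverse)
  then show "convergent X" by (auto simp: convergent_def)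
qed

text \<open>The axioms 0 \<noteq> 1 and \<open>norm 1 = 1\<close> fail on the trivial space;
  \<open>perfect_space\<close> excludes it.\<close>

instantiation endo :: ("{real_normed_vector, perfect_space}") real_normed_algebra_1
begin

lift_definition one_endo :: "'a endo" is id_blinfun .
lift_definition times_endo :: "'a endo \<Rightarrow> 'a endo \<Rightarrow> 'a endo" is blinfun_compose .

instance
proof
  fix S T U :: "'a endo" and r :: real
  show "S * T * U = S * (T * U)" "1 * S = S" "S * 1 = S"
    by (transfer, auto intro!: blinfun_eqI)+
  show "(S + T) * U = S * U + T * U" "S * (T + U) = S * T + S * U"
    "r *\<^sub>R S * T = r *\<^sub>R (S * T)" "S * r *\<^sub>R T = r *\<^sub>R (S * T)"
    by (transfer, auto intro!: blinfun_eqI simp: blinfun.bilinear_simps)+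
  show "(0::'a endo) \<noteq> 1"
    by transfer (metis norm_blinfun_id norm_zero zero_neq_one)
  show "norm (S * T) \<le> norm S * norm T"
    by transfer (rule norm_blinfun_compose)
  show "norm (1::'a endo) = 1"
    by transfer simp
qed

end

lemma app_one [simp]: "1 $$ u = u"
  by transfer simp

lemma app_mult [simp]: "(S * T) $$ u = S $$ T $$ u"
  by transfer simp

section \<open>Exponentials in Banach algebras\<close>

lemma exp_mult_right_commute:
  fixes x y :: "'a::{real_normed_algebra_1, banach}"
  assumes "x * y = y * x"
  shows "exp x * y = y * exp x"
proof -
  have "x ^ n * y = y * x ^ n" for n
    using power_commuting_commutes[OF assms] .
  then have "(\<lambda>n. (x ^ n /\<^sub>R fact n) * y) = (\<lambda>n. y * (x ^ n /\<^sub>R fact n))"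
    by auto
  moreover have "(\<lambda>n. (x ^ n /\<^sub>R fact n) * y) sums (exp x * y)"
    by (intro sums_mult2 exp_converges)
  moreover have "(\<lambda>n. y * (x ^ n /\<^sub>R fact n)) sums (y * exp x)"
    by (intro sums_mult exp_converges)
  ultimately show ?thesis by (metis sums_unique2)
qed

lemma exp_scaleR_nat:
  fixes x :: "'a::{real_normed_algebra_1, banach}"
  shows "exp (real n *\<^sub>R x) = exp x ^ n"
proof (induction n)
  case (Suc n)
  have "exp (x + real n *\<^sub>R x) = exp x * exp (real n *\<^sub>R x)"
    by (rule exp_add_commuting) simp
  then show ?case using Suc by (simp add: scaleR_add_left)
qed simp

text \<open>The second hypothesis says that \<open>p\<close> fixes \<open>y * p\<close>, so after
  one step \<open>x\<close> and \<open>y\<close> act only on vectors fixed by \<open>p\<close>,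
  where they agree. The induction therefore runs over \<open>y ^ n * (y * p)\<close>, and exponent 0
  is treated apart. In the application \<open>p\<close> is a truncation, and \<open>x\<close> and
  \<open>y\<close> are multiples of two truncated generators.\<close>

lemma exp_intertwine:
  fixes x y p :: "'a::{real_normed_algebra_1, banach}"
  assumes "x * p = y * p" "p * y * p = y * p"
  shows "exp x * p = exp y * p"
proof -
  have "x ^ n * (y * p) = y ^ n * (y * p) \<and> p * (y ^ n * (y * p)) = y ^ n * (y * p)" for n
  proof (induction n)
    case 0
    then show ?case using assms by (simp add: mult.assoc)
  next
    case (Suc n)
    define q where "q = y ^ n * (y * p)"
    have q: "p * q = q" using Suc q_def by simp
    have "y * q = (y * p) * q" by (simp add: mult.assoc q)
    also have "\<dots> = (p * y * p) * q" by (simp only: assms(2))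
    also have "\<dots> = p * (y * q)" by (simp add: mult.assoc q)
    finally have "p * (y * q) = y * q" ..
    moreover have "x * q = (x * p) * q" by (simp add: mult.assoc q)
    moreover have "(x * p) * q = y * q" by (simp only: assms(1)) (simp add: mult.assoc q)
    moreover have "x ^ Suc n * (y * p) = x * q" "y ^ Suc n * (y * p) = y * q"
      using Suc by (simp_all add: q_def mult.assoc)
    ultimately show ?case by simp
  qed
  then have "x ^ n * p = y ^ n * p" for n
    by (cases n) (simp_all add: power_Suc2 mult.assoc assms del: power_Suc)
  then have eq: "(\<lambda>n. (x ^ n /\<^sub>R fact n) * p) = (\<lambda>n. (y ^ n /\<^sub>R fact n) * p)"
    by simp
  have S: "(\<lambda>n. (z ^ n /\<^sub>R fact n) * p) sums (exp z * p)" for z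
    by (intro sums_mult2 exp_converges)
  show ?thesis
    by (rule sums_unique2[OF S[of x, unfolded eq] S[of y]])
qed

lemma norm_exp_minus_linear_le:
  fixes x :: "'a::{real_normed_algebra_1, banach}"
  assumes "norm x \<le> 1"
  shows "norm (exp x - 1 - x) \<le> (norm x)\<^sup>2"
proof -
  let ?f = "\<lambda>x n. inverse (fact (n + 2)) *\<^sub>R (x ^ (n + 2))"
  have sr: "summable (?f (norm x))"
    using summable_exp_generic[of "norm x"] by (subst summable_iff_shift) auto
  have "norm (?f x n) \<le> ?f (norm x) n" for n
    using norm_power_ineq[of x "n+2"] by (simp add: divide_simps)
  then have "norm (\<Sum>n. ?f x n) \<le> (\<Sum>n. ?f (norm x) n)"
    by (rule norm_suminf_le) (use sr in auto)
  moreover have "exp x - 1 - x = (\<Sum>n. ?f x n)"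
    using exp_first_two_terms[of x] by (simp add: algebra_simps)
  moreover have "(\<Sum>n. ?f (norm x) n) = exp (norm x) - 1 - norm x"
    using exp_first_two_terms[of "norm x"] by (simp add: algebra_simps)
  moreover have "exp (norm x) \<le> 1 + norm x + (norm x)\<^sup>2"
    using exp_bound[of "norm x"] assms by auto
  ultimately show ?thesis by simp
qed

text \<open>\<open>exp x\<close> is the n-th power of exp(x/n), which differs from the Euler step by
  at most (norm x / n)^2. The n errors of order 1/n^2 vanish together in the limit, so
  \<open>K\<close> leaves no trace in the conclusion and may be as large as one likes.\<close>

lemma norm_exp_le_of_Euler:
  fixes x :: "'a::{real_normed_algebra_1, banach}"
  assumes "\<And>n. (0::nat) < n \<Longrightarrow> norm (1 + x /\<^sub>R n) \<le> 1 + c / real n + K / (real n)\<^sup>2"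
  shows "norm (exp x) \<le> exp c"
proof -
  \<comment> \<open>The error made in replacing the exponential by its first-order part joins the
    given second-order term.\<close>
  define M where "M = K + (norm x)\<^sup>2"
  have *: "norm (exp x) \<le> exp (c + M / real n)" if n: "n > 0" "n > norm x" for n :: nat
  proof -
    let ?y = "x /\<^sub>R real n"
    have ny: "norm ?y = norm x / n" using n by (simp add: divide_inverse mult.commute)
    have "norm ?y \<le> 1" using n by (subst ny) simp
    then have "norm (exp ?y - 1 - ?y) \<le> (norm ?y)\<^sup>2" by (rule norm_exp_minus_linear_le)
    moreover have "norm (exp ?y) \<le> norm (1 + ?y) + norm (exp ?y - 1 - ?y)"
      using norm_triangle_ineq[of "1 + ?y" "exp ?y - 1 - ?y"] by (simp add: algebra_simps)
    ultimately have "norm (exp ?y) \<le> 1 + c / real n + K / (real n)\<^sup>2 + (norm x / n)\<^sup>2"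
      using assms[OF n(1)] ny by simp
    also have "\<dots> = 1 + (c / n + M / n\<^sup>2)" by (simp add: M_def power_divide add_divide_distrib)
    also have "\<dots> \<le> exp (c / n + M / n\<^sup>2)" by (rule exp_ge_add_one_self)
    finally have "norm (exp ?y) ^ n \<le> exp (c / n + M / n\<^sup>2) ^ n"
      by (intro power_mono) auto
    also have "\<dots> = exp (c + M / n)"
      using n by (simp add: exp_of_nat_mult[symmetric] distrib_left power2_eq_square)
    finally have "norm (exp ?y) ^ n \<le> exp (c + M / n)" .
    moreover have "exp x = exp ?y ^ n"
      using n by (simp add: exp_scaleR_nat[symmetric])
    ultimately show ?thesis
      using norm_power_ineq[of "exp ?y" n] by simp
  qed
  have "\<forall>\<^sub>F n in sequentially. norm (exp x) \<le> exp (c + M / real n)"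
  proof -
    have "norm (exp x) \<le> exp (c + M / real n)" if "n > nat \<lceil>norm x\<rceil>" for n
    proof (rule *)
      show "norm x < real n" using that real_nat_ceiling_ge[of "norm x"] by linarith
    qed (use that in simp)
    then show ?thesis
      using eventually_gt_at_top[of "nat \<lceil>norm x\<rceil>"] by (rule eventually_mono[rotated])
  qed
  moreover have "(\<lambda>n. exp (c + M / real n)) \<longlonglongrightarrow> exp (c + 0)"
    by (intro tendsto_intros lim_const_over_n)
  ultimately show ?thesis
    using tendsto_lowerbound[OF _ _ trivial_limit_sequentially] by fastforce
qed

section \<open>Strong convergence\<close>

definition strong_lim :: "(nat \<Rightarrow> 'a::real_normed_vector endo) \<Rightarrow> 'a endo \<Rightarrow> bool" where
  "strong_lim E L \<longleftrightarrow> (\<forall>u. (\<lambda>n. E n $$ u) \<longlonglongrightarrow> L $$ u)"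

lemma strong_limD: "strong_lim E L \<Longrightarrow> (\<lambda>n. E n $$ u) \<longlonglongrightarrow> L $$ u"
  by (simp add: strong_lim_def)

lemma strong_lim_unique: "strong_lim E L \<Longrightarrow> strong_lim E L' \<Longrightarrow> L = L'"
  by (intro endo_eqI) (meson LIMSEQ_unique strong_lim_def)

lemma strong_lim_const: "strong_lim (\<lambda>n. L) L"
  by (simp add: strong_lim_def)

lemma strong_lim_diff: "strong_lim E L \<Longrightarrow> strong_lim F M \<Longrightarrow> strong_lim (\<lambda>n. E n - F n) (L - M)"
  by (auto simp: strong_lim_def app_simps intro!: tendsto_intros)

lemma strong_lim_mult:
  fixes E F :: "nat \<Rightarrow> 'a::{real_normed_vector, perfect_space} endo"
  assumes E: "strong_lim E L" and F: "strong_lim F M" and K: "\<And>n. norm (E n) \<le> K"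
  shows "strong_lim (\<lambda>n. E n * F n) (L * M)"
  unfolding strong_lim_def
proof
  fix u
  have "(\<lambda>n. E n $$ (F n $$ u - M $$ u)) \<longlonglongrightarrow> 0"
  proof (rule Lim_null_comparison[OF always_eventually])
    show "\<forall>n. norm (E n $$ (F n $$ u - M $$ u)) \<le> K * norm (F n $$ u - M $$ u)"
      by (meson norm_app K mult_right_mono norm_ge_zero order_trans)
    show "(\<lambda>n. K * norm (F n $$ u - M $$ u)) \<longlonglongrightarrow> 0"
      using strong_limD[OF F, of u] by (intro tendsto_mult_right_zero) (simp add: LIM_zero tendsto_norm_zero)
  qed
  from tendsto_add[OF this strong_limD[OF E, of "M $$ u"]]
  show "(\<lambda>n. (E n * F n) $$ u) \<longlonglongrightarrow> (L * M) $$ u"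
    by (simp add: app_simps)
qed

lemma strong_lim_mult_left:
  fixes E :: "nat \<Rightarrow> 'a::{real_normed_vector, perfect_space} endo"
  shows "strong_lim E L \<Longrightarrow> strong_lim (\<lambda>n. S * E n) (S * L)"
  by (auto simp: strong_lim_def intro: app.tendsto)

lemma strong_lim_mult_right:
  fixes E :: "nat \<Rightarrow> 'a::{real_normed_vector, perfect_space} endo"
  shows "strong_lim E L \<Longrightarrow> strong_lim (\<lambda>n. E n * S) (L * S)"
  by (auto simp: strong_lim_def)

lemma strong_lim_norm_le:
  assumes "strong_lim E L" "\<And>n. norm (E n) \<le> K"
  shows "norm L \<le> K"
proof (rule norm_endo_le)
  show "0 \<le> K" using norm_ge_zero assms(2) by (rule order_trans)
  fix u
  have "\<forall>n. norm (E n $$ u) \<le> K * norm u"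
    by (meson norm_app assms(2) mult_right_mono norm_ge_zero order_trans)
  then show "norm (L $$ u) \<le> K * norm u"
    using tendsto_upperbound[OF tendsto_norm[OF strong_limD[OF assms(1), of u]] always_eventually]
    by simp
qed

text \<open>The uniform bound reduces the Cauchy property to the vectors \<open>P m $$ u\<close>,
  which approximate \<open>u\<close> and on which the sequence is constant from index
  \<open>m\<close> on.\<close>

lemma ex_strong_lim:
  fixes E :: "nat \<Rightarrow> 'a::{banach, perfect_space} endo"
  assumes K: "\<And>n. norm (E n) \<le> K"
    and P: "strong_lim P 1"
    and EP: "\<And>m n u. m \<le> n \<Longrightarrow> E n $$ P m $$ u = E m $$ P m $$ u"
  shows "\<exists>L. strong_lim E L"
proof -
  have K0: "0 \<le> K" using norm_ge_zero K by (rule order_trans)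
  have "convergent (\<lambda>n. E n $$ u)" for u
  proof -
    have "Cauchy (\<lambda>n. E n $$ u)"
    proof (rule metric_CauchyI)
      fix e :: real assume e: "e > 0"
      have "(\<lambda>m. P m $$ u) \<longlonglongrightarrow> u" using strong_limD[OF P, of u] by simp
      then obtain m where m: "norm (P m $$ u - u) < e / (2 * (K + 1))"
        using e K0 LIMSEQ_D[of _ u "e / (2 * (K + 1))"] by force
      have *: "norm (E n $$ (u - P m $$ u)) < e / 2" for n
      proof -
        have "norm (E n $$ (u - P m $$ u)) \<le> K * norm (P m $$ u - u)"
          by (metis K mult_right_mono norm_app norm_ge_zero norm_minus_commute order_trans)
        also have "\<dots> \<le> (K + 1) * norm (P m $$ u - u)"
          by (intro mult_right_mono) auto
        also have "\<dots> < (K + 1) * (e / (2 * (K + 1)))"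
          using m K0 by (intro mult_strict_left_mono) auto
        also have "\<dots> = e / 2" using K0 by (simp add: divide_simps)
        finally show ?thesis .
      qed
      have "dist (E n $$ u) (E n' $$ u) < e" if "n \<ge> m" "n' \<ge> m" for n n'
      proof -
        have "E n $$ u - E n' $$ u = E n $$ (u - P m $$ u) - E n' $$ (u - P m $$ u)"
          using EP[OF that(1)] EP[OF that(2)] by (simp add: app_simps)
        then have "norm (E n $$ u - E n' $$ u) \<le> norm (E n $$ (u - P m $$ u)) + norm (E n' $$ (u - P m $$ u))"
          by (metis norm_triangle_ineq4)
        then show ?thesis using *[of n] *[of n'] by (simp add: dist_norm)
      qed
      then show "\<exists>M. \<forall>n\<ge>M. \<forall>n'\<ge>M. dist (E n $$ u) (E n' $$ u) < e" by blast
    qed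
    then show ?thesis by (simp add: Cauchy_convergent_iff)
  qed
  then obtain f where f: "\<And>u. (\<lambda>n. E n $$ u) \<longlonglongrightarrow> f u"
    unfolding convergent_def by metis
  have "bounded_linear f"
  proof (rule bounded_linear_intro[where K = K])
    show "f (u + v) = f u + f v" for u v
      using tendsto_add[OF f[of u] f[of v]] f[of "u + v"]
      by (simp add: app_simps LIMSEQ_unique)
    show "f (r *\<^sub>R u) = r *\<^sub>R f u" for r u
      using tendsto_scaleR[OF tendsto_const f[of u], of r] f[of "r *\<^sub>R u"]
      by (simp add: app_simps LIMSEQ_unique)
    show "norm (f u) \<le> norm u * K" for u
    proof -
      have "\<forall>n. norm (E n $$ u) \<le> norm u * K"
        by (metis norm_app K mult_right_mono norm_ge_zero order_trans mult.commute)
      then show ?thesis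
        using tendsto_upperbound[OF tendsto_norm[OF f[of u]] always_eventually] by simp
    qed
  qed
  then have "strong_lim E (endo f)"
    by (simp add: strong_lim_def app_endo f)
  then show ?thesis by blast
qed

section \<open>The Banach space of integrable functions on the line\<close>

text \<open>The Riesz-Fischer argument: a subsequence converges almost everywhere, and Fatou's lemma
  carries the Cauchy estimate over to its pointwise limit.\<close>

lemma L1_complete:
  fixes s :: "nat \<Rightarrow> 'a \<Rightarrow> 'b::{banach, second_countable_topology}"
  assumes s: "\<And>n. integrable M (s n)"
    and C: "\<And>e. e > 0 \<Longrightarrow> \<exists>N. \<forall>i\<ge>N. \<forall>j\<ge>N. (LINT x|M. norm (s i x - s j x)) < e"
  obtains h where "integrable M h" "(\<lambda>n. LINT x|M. norm (s n x - h x)) \<longlonglongrightarrow> 0"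
proof -
  have [measurable]: "s n \<in> borel_measurable M" for n
    using s by auto
  obtain r where r: "strict_mono r" "AE x in M. Cauchy (\<lambda>i. s (r i) x)"
    using cauchy_L1_AE_cauchy_subseq[OF s C] by blast
  define h where "h x = lim (\<lambda>i. s (r i) x)" for x
  have [measurable]: "h \<in> borel_measurable M"
    unfolding h_def by measurable
  have lim: "AE x in M. (\<lambda>i. s (r i) x) \<longlonglongrightarrow> h x"
    using r(2) by eventually_elim (auto simp: h_def Cauchy_convergent_iff convergent_LIMSEQ_iff)
  \<comment> \<open>Fatou's lemma is applied along the subsequence but bounds the distance to
    \<open>h\<close> for every late member of the full sequence. Integrability of the difference
    comes from the same bound.\<close>
  have int: "integrable M (\<lambda>x. s n x - h x) \<and> (LINT x|M. norm (s n x - h x)) \<le> e"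
    if "e > 0" and N: "\<And>i j. i \<ge> N \<Longrightarrow> j \<ge> N \<Longrightarrow> (LINT x|M. norm (s i x - s j x)) < e" "n \<ge> N" for e n N
  proof -
    have "(\<integral>\<^sup>+x. ennreal (norm (s n x - h x)) \<partial>M)
      = (\<integral>\<^sup>+x. liminf (\<lambda>i. ennreal (norm (s n x - s (r i) x))) \<partial>M)"
    proof (rule nn_integral_cong_AE, use lim in eventually_elim)
      fix x assume "(\<lambda>i. s (r i) x) \<longlonglongrightarrow> h x"
      then have "(\<lambda>i. ennreal (norm (s n x - s (r i) x))) \<longlonglongrightarrow> ennreal (norm (s n x - h x))"
        by (intro tendsto_intros)
      then show "ennreal (norm (s n x - h x)) = liminf (\<lambda>i. ennreal (norm (s n x - s (r i) x)))"
        by (rule lim_imp_Liminf[symmetric, rotated]) simp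
    qed
    also have "\<dots> \<le> liminf (\<lambda>i. \<integral>\<^sup>+x. ennreal (norm (s n x - s (r i) x)) \<partial>M)"
      by (rule nn_integral_liminf) simp
    also have "\<dots> \<le> liminf (\<lambda>i. ennreal e)"
    proof (rule Liminf_mono, rule eventually_mono[OF eventually_ge_at_top[of N]])
      fix i assume "i \<ge> N"
      then have "r i \<ge> N" using seq_suble[OF r(1), of i] by linarith
      have "(\<integral>\<^sup>+x. ennreal (norm (s n x - s (r i) x)) \<partial>M) = ennreal (LINT x|M. norm (s n x - s (r i) x))"
        using s by (intro nn_integral_eq_integral) auto
      also have "\<dots> \<le> ennreal e"
        using N(1)[OF \<open>n \<ge> N\<close> \<open>r i \<ge> N\<close>] by (intro ennreal_leI) simp
      finally show "(\<integral>\<^sup>+x. ennreal (norm (s n x - s (r i) x)) \<partial>M) \<le> ennreal e" .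
    qed
    also have "\<dots> = ennreal e"
      by (simp add: Liminf_const)
    finally have le: "(\<integral>\<^sup>+x. ennreal (norm (s n x - h x)) \<partial>M) \<le> ennreal e" .
    then have I: "integrable M (\<lambda>x. s n x - h x)"
      by (intro integrableI_bounded) (auto simp: le_less_trans)
    moreover have "(LINT x|M. norm (s n x - h x)) \<le> e"
      using le \<open>e > 0\<close> nn_integral_eq_integral[OF integrable_norm[OF I]] by simp
    ultimately show ?thesis by simp
  qed
  show ?thesis
  proof
    obtain N where "\<forall>i\<ge>N. \<forall>j\<ge>N. (LINT x|M. norm (s i x - s j x)) < 1"
      using C[of 1] by auto
    then have "integrable M (\<lambda>x. s N x - h x)"
      using int[of 1 N N] by simp
    then have "integrable M (\<lambda>x. s N x - (s N x - h x))"
      by (rule Bochner_Integration.integrable_diff[OF s])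
    then show "integrable M h" by simp
    show "(\<lambda>n. LINT x|M. norm (s n x - h x)) \<longlonglongrightarrow> 0"
    proof (rule LIMSEQ_I)
      fix e :: real assume "e > 0"
      then obtain N where "\<forall>i\<ge>N. \<forall>j\<ge>N. (LINT x|M. norm (s i x - s j x)) < e / 2"
        using C[of "e / 2"] by auto
      then have "\<forall>n\<ge>N. (LINT x|M. norm (s n x - h x)) \<le> e / 2"
        using int[of "e / 2" N] \<open>e > 0\<close> by auto
      then show "\<exists>N. \<forall>n\<ge>N. norm ((LINT x|M. norm (s n x - h x)) - 0) < e"
        using \<open>e > 0\<close> by (intro exI[of _ N]) fastforce
    qed
  qed
qed

text \<open>The weighted spaces depend on \<open>\<omega>\<close> and so cannot be types; multiplication by \<open>\<omega>\<close> embeds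
  each of them isometrically into the following one.\<close>

quotient_type l1 = "real \<Rightarrow> complex" / partial:
  "\<lambda>f g. integrable lebesgue f \<and> integrable lebesgue g \<and> (AE x in lebesgue. f x = g x)"
  morphisms fn toL1
proof (rule part_equivpI)
  show "\<exists>f::real \<Rightarrow> complex. integrable lebesgue f \<and> integrable lebesgue f \<and> (AE x in lebesgue. f x = f x)"
    by (rule exI[of _ "\<lambda>x. 0"]) auto
  show "symp (\<lambda>f g::real \<Rightarrow> complex. integrable lebesgue f \<and> integrable lebesgue g \<and> (AE x in lebesgue. f x = g x))"
    by (auto simp: symp_def eq_commute)
  have "AE x in lebesgue. f x = h x" if "AE x in lebesgue. f x = g x" "AE x in lebesgue. g x = h x"
    for f g h :: "real \<Rightarrow> complex"
    using that by eventually_elim simp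
  then show "transp (\<lambda>f g::real \<Rightarrow> complex. integrable lebesgue f \<and> integrable lebesgue g \<and> (AE x in lebesgue. f x = g x))"
    unfolding transp_def by blast
qed

lemma integrable_fn [simp]: "integrable lebesgue (fn u)"
  using Quotient_rep_reflp[OF Quotient_l1, of u] by simp

lemma toL1_fn [simp]: "toL1 (fn u) = u"
  using Quotient_abs_rep[OF Quotient_l1, of u] by simp

lemma toL1_eq_iff:
  "integrable lebesgue f \<Longrightarrow> integrable lebesgue g \<Longrightarrow> toL1 f = toL1 g \<longleftrightarrow> (AE x in lebesgue. f x = g x)"
  using Quotient_rel[OF Quotient_l1, of f g] by auto


lemma fn_toL1: "integrable lebesgue f \<Longrightarrow> AE x in lebesgue. fn (toL1 f) x = f x"
  using toL1_eq_iff[of "fn (toL1 f)" f] by simp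

lemma fn_measurable [measurable, simp]: "fn u \<in> borel_measurable lebesgue"
  using integrable_fn borel_measurable_integrable by blast

lemma l1_eq_iff: "u = v \<longleftrightarrow> (AE x in lebesgue. fn u x = fn v x)"
  using toL1_eq_iff[of "fn u" "fn v"] by simp

instantiation l1 :: real_normed_vector
begin

definition "0 = toL1 (\<lambda>x. 0)"
definition "u + v = toL1 (\<lambda>x. fn u x + fn v x)"
definition "u - v = toL1 (\<lambda>x. fn u x - fn v x)"
definition "- u = toL1 (\<lambda>x. - fn u x)" for u :: l1
definition "r *\<^sub>R u = toL1 (\<lambda>x. r *\<^sub>R fn u x)"
definition "norm u = (LINT x|lebesgue. norm (fn u x))"
definition dist_l1 :: "l1 \<Rightarrow> l1 \<Rightarrow> real" where "dist_l1 u v = norm (u - v)"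
definition sgn_l1 :: "l1 \<Rightarrow> l1" where "sgn_l1 u = inverse (norm u) *\<^sub>R u"
definition [code del]: "(uniformity :: (l1 \<times> l1) filter)
  = (INF e\<in>{0 <..}. principal {(x, y). dist x y < e})"
definition "open_l1 (U :: l1 set)
  \<longleftrightarrow> (\<forall>x\<in>U. eventually (\<lambda>(x', y). x' = x \<longrightarrow> y \<in> U) uniformity)"

lemma fn_zero: "AE x in lebesgue. fn 0 x = 0"
  unfolding zero_l1_def by (rule fn_toL1) simp

lemma fn_add: "AE x in lebesgue. fn (u + v) x = fn u x + fn v x"
  unfolding plus_l1_def by (rule fn_toL1) simp

lemma fn_diff: "AE x in lebesgue. fn (u - v) x = fn u x - fn v x"
  unfolding minus_l1_def by (rule fn_toL1) simp

lemma fn_minus: "AE x in lebesgue. fn (- u) x = - fn u x"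
  unfolding uminus_l1_def by (rule fn_toL1) simp

lemma fn_scaleR: "AE x in lebesgue. fn (r *\<^sub>R u) x = r *\<^sub>R fn u x"
  unfolding scaleR_l1_def by (rule fn_toL1) simp

instance
proof
  fix u v w :: l1 and r s :: real
  show "u + v + w = u + (v + w)"
    unfolding l1_eq_iff using fn_add[of "u + v" w] fn_add[of u "v + w"] fn_add[of u v] fn_add[of v w]
    by eventually_elim simp
  show "u + v = v + u"
    unfolding l1_eq_iff using fn_add[of u v] fn_add[of v u] by eventually_elim simp
  show "0 + u = u"
    unfolding l1_eq_iff using fn_add[of 0 u] fn_zero by eventually_elim simp
  show "- u + u = 0"
    unfolding l1_eq_iff using fn_add[of "- u" u] fn_zero fn_minus[of u] by eventually_elim simp
  show "u - v = u + - v"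
    unfolding l1_eq_iff using fn_add[of u "- v"] fn_diff[of u v] fn_minus[of v] by eventually_elim simp
  show "r *\<^sub>R (u + v) = r *\<^sub>R u + r *\<^sub>R v"
    unfolding l1_eq_iff using fn_add[of u v] fn_add[of "r *\<^sub>R u" "r *\<^sub>R v"] fn_scaleR[of r u] fn_scaleR[of r v] fn_scaleR[of r "u + v"]
    by eventually_elim (simp add: scaleR_add_right)
  show "(r + s) *\<^sub>R u = r *\<^sub>R u + s *\<^sub>R u"
    unfolding l1_eq_iff using fn_add[of "r *\<^sub>R u" "s *\<^sub>R u"] fn_scaleR[of r u] fn_scaleR[of s u] fn_scaleR[of "r + s" u]
    by eventually_elim (simp add: scaleR_add_left)
  show "r *\<^sub>R s *\<^sub>R u = (r * s) *\<^sub>R u"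
    unfolding l1_eq_iff using fn_scaleR[of s u] fn_scaleR[of r "s *\<^sub>R u"] fn_scaleR[of "r * s" u]
    by eventually_elim simp
  show "1 *\<^sub>R u = u"
    unfolding l1_eq_iff using fn_scaleR[of 1 u] by eventually_elim simp
  have "norm u = 0 \<longleftrightarrow> (AE x in lebesgue. fn u x = 0)"
    unfolding norm_l1_def by (subst integral_nonneg_eq_0_iff_AE) auto
  also have "\<dots> \<longleftrightarrow> u = 0"
    unfolding l1_eq_iff by (rule eventually_subst, use fn_zero in eventually_elim) simp
  finally show "norm u = 0 \<longleftrightarrow> u = 0" .
  have "norm (u + v) = (LINT x|lebesgue. norm (fn u x + fn v x))"
    unfolding norm_l1_def by (rule integral_cong_AE) (use fn_add[of u v] in auto)
  also have "\<dots> \<le> (LINT x|lebesgue. norm (fn u x) + norm (fn v x))"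
    by (intro integral_mono) (auto intro: norm_triangle_ineq)
  also have "\<dots> = norm u + norm v"
    unfolding norm_l1_def by (rule Bochner_Integration.integral_add) auto
  finally show "norm (u + v) \<le> norm u + norm v" .
  have "norm (r *\<^sub>R u) = (LINT x|lebesgue. \<bar>r\<bar> * norm (fn u x))"
    unfolding norm_l1_def by (rule integral_cong_AE) (use fn_scaleR[of r u] in auto)
  then show "norm (r *\<^sub>R u) = \<bar>r\<bar> * norm u"
    unfolding norm_l1_def by simp
qed (simp_all add: dist_l1_def sgn_l1_def uniformity_l1_def open_l1_def)

end

lemma norm_toL1: "integrable lebesgue f \<Longrightarrow> norm (toL1 f) = (LINT x|lebesgue. norm (f x))"
  unfolding norm_l1_def by (rule integral_cong_AE) (use fn_toL1[of f] in auto)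

lemma toL1_add:
  assumes f: "integrable lebesgue f" and g: "integrable lebesgue g"
  shows "toL1 (\<lambda>x. f x + g x) = toL1 f + toL1 g"
proof -
  have "AE x in lebesgue. f x + g x = fn (toL1 f) x + fn (toL1 g) x"
    using fn_toL1[OF f] fn_toL1[OF g] by eventually_elim simp
  then show ?thesis
    unfolding plus_l1_def using f g by (subst toL1_eq_iff) auto
qed

lemma toL1_diff:
  assumes f: "integrable lebesgue f" and g: "integrable lebesgue g"
  shows "toL1 (\<lambda>x. f x - g x) = toL1 f - toL1 g"
proof -
  have "AE x in lebesgue. f x - g x = fn (toL1 f) x - fn (toL1 g) x"
    using fn_toL1[OF f] fn_toL1[OF g] by eventually_elim simp
  then show ?thesis
    unfolding minus_l1_def using f g by (subst toL1_eq_iff) auto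
qed

lemma toL1_scaleR:
  assumes f: "integrable lebesgue f"
  shows "toL1 (\<lambda>x. r *\<^sub>R f x) = r *\<^sub>R toL1 f"
proof -
  have "AE x in lebesgue. r *\<^sub>R f x = r *\<^sub>R fn (toL1 f) x"
    using fn_toL1[OF f] by eventually_elim simp
  then show ?thesis
    unfolding scaleR_l1_def using f by (subst toL1_eq_iff) auto
qed

instance l1 :: banach
proof
  fix X :: "nat \<Rightarrow> l1" assume X: "Cauchy X"
  have nd: "norm (u - v) = (LINT x|lebesgue. norm (fn u x - fn v x))" for u v
    unfolding norm_l1_def by (rule integral_cong_AE) (use fn_diff[of u v] in auto)
  obtain h where h: "integrable lebesgue h" "(\<lambda>n. LINT x|lebesgue. norm (fn (X n) x - h x)) \<longlonglongrightarrow> 0"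
  proof (rule L1_complete[of lebesgue "\<lambda>n. fn (X n)"])
    fix e :: real assume "e > 0"
    then show "\<exists>N. \<forall>i\<ge>N. \<forall>j\<ge>N. (LINT x|lebesgue. norm (fn (X i) x - fn (X j) x)) < e"
      using metric_CauchyD[OF X, of e] by (simp add: dist_norm nd)
  qed simp
  have "norm (X n - toL1 h) = (LINT x|lebesgue. norm (fn (X n) x - h x))" for n
    unfolding nd by (rule integral_cong_AE) (use fn_toL1[OF h(1)] h(1) in auto)
  then have "X \<longlonglongrightarrow> toL1 h"
    using h(2) by (simp add: LIM_zero_iff[symmetric, of X] tendsto_norm_zero_iff[symmetric, of "\<lambda>n. X n - toL1 h"])
  then show "convergent X" by (auto simp: convergent_def)
qed

text \<open>This gives \<open>l1 endo\<close> its unit of norm 1. The indicator of the unit interval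
  supplies a nonzero vector, and small multiples of it move any point.\<close>

instance l1 :: perfect_space
proof
  fix x :: l1
  let ?f = "\<lambda>x::real. complex_of_real (indicator {0..1} x)"
  have I: "integrable lebesgue ?f"
    by (intro integrable_of_real) (auto simp: integrable_completion)
  define v where "v = toL1 ?f"
  have "norm v = 1"
    unfolding v_def norm_toL1[OF I] by simp
  show "\<not> open {x}"
  proof
    assume "open {x}"
    then obtain e where e: "e > 0" "\<And>y. dist y x < e \<Longrightarrow> y = x"
      by (auto simp: open_dist)
    then show False
      using e(2)[of "x + (e / 2) *\<^sub>R v"] \<open>norm v = 1\<close> by (auto simp: dist_norm)
  qed
qed


section \<open>Operators on functions and on classes of functions\<close>

lemma
  assumes T: "bounded_operator M T"
  shows bounded_operator_L1: "integrable M f \<Longrightarrow> integrable M (T f)"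
    and bounded_operator_add: "integrable M f \<Longrightarrow> integrable M g \<Longrightarrow>
      AE x in M. T (\<lambda>x. f x + g x) x = T f x + T g x"
    and bounded_operator_mult: "integrable M f \<Longrightarrow> AE x in M. T (\<lambda>x. c * f x) x = c * T f x"
    and bounded_operator_bound: "\<exists>K. \<forall>f. integrable M f \<longrightarrow> L1_norm M (T f) \<le> K * L1_norm M f"
  using T unfolding bounded_operator_def L1_def ae_eq_def by auto

text \<open>The difference \<open>h\<close> of the two functions has norm zero, so the norm estimate
  forces \<open>T h\<close> to vanish a.e. Thanks to this, \<open>lift_op\<close> does not depend on
  the representatives that \<open>fn\<close> picks.\<close>

lemma bounded_operator_cong_AE:
  fixes f g :: "'a \<Rightarrow> 'k::{real_normed_field, banach, second_countable_topology}"
  assumes T: "bounded_operator M T" and f: "integrable M f" and g: "integrable M g"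
    and eq: "AE x in M. f x = g x"
  shows "AE x in M. T f x = T g x"
proof -
  define h where "h x = f x - g x" for x
  have h: "integrable M h" using f g by (simp add: h_def[abs_def])
  have "L1_norm M h = 0"
    unfolding L1_norm_def by (rule integral_eq_zero_AE) (use eq in \<open>auto simp: h_def\<close>)
  moreover obtain K where "L1_norm M (T h) \<le> K * L1_norm M h"
    using bounded_operator_bound[OF T] h by blast
  ultimately have "(LINT x|M. norm (T h x)) \<le> 0"
    by (simp add: L1_norm_def)
  then have "(LINT x|M. norm (T h x)) = 0"
    by (intro antisym) auto
  then have "AE x in M. T h x = 0"
    using bounded_operator_L1[OF T h] by (simp add: integral_nonneg_eq_0_iff_AE)
  moreover have "AE x in M. T (\<lambda>x. h x + g x) x = T h x + T g x"
    by (rule bounded_operator_add[OF T h g])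
  moreover have "(\<lambda>x. h x + g x) = f" by (simp add: h_def)
  ultimately show ?thesis by (auto elim: eventually_elim2)
qed

definition lift_op :: "((real \<Rightarrow> complex) \<Rightarrow> (real \<Rightarrow> complex)) \<Rightarrow> l1 endo" where
  "lift_op T = endo (\<lambda>u. toL1 (T (fn u)))"

context
  fixes T :: "(real \<Rightarrow> complex) \<Rightarrow> real \<Rightarrow> complex"
  assumes T: "bounded_operator lebesgue T"
begin

lemma bounded_linear_lift_op: "bounded_linear (\<lambda>u. toL1 (T (fn u)))"
proof -
  obtain K where K: "\<And>f. integrable lebesgue f \<Longrightarrow> L1_norm lebesgue (T f) \<le> K * L1_norm lebesgue f"
    using bounded_operator_bound[OF T] by blast
  note I = bounded_operator_L1[OF T]
  show ?thesis
  proof (rule bounded_linear_intro[where K = K])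
    fix u v :: l1 and r :: real
    have "AE x in lebesgue. T (fn (u + v)) x = T (\<lambda>x. fn u x + fn v x) x"
      by (rule bounded_operator_cong_AE[OF T _ _ fn_add]) auto
    moreover have "AE x in lebesgue. T (\<lambda>x. fn u x + fn v x) x = T (fn u) x + T (fn v) x"
      by (rule bounded_operator_add[OF T]) auto
    ultimately have "AE x in lebesgue. T (fn (u + v)) x = T (fn u) x + T (fn v) x"
      by eventually_elim simp
    then show "toL1 (T (fn (u + v))) = toL1 (T (fn u)) + toL1 (T (fn v))"
      by (simp add: toL1_eq_iff toL1_add[symmetric] I)
    have "AE x in lebesgue. T (fn (r *\<^sub>R u)) x = T (\<lambda>x. of_real r * fn u x) x"
      by (rule bounded_operator_cong_AE[OF T]) (use fn_scaleR[of r u] in \<open>auto simp: scaleR_conv_of_real\<close>)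
    moreover have "AE x in lebesgue. T (\<lambda>x. of_real r * fn u x) x = of_real r * T (fn u) x"
      by (rule bounded_operator_mult[OF T]) auto
    ultimately have "AE x in lebesgue. T (fn (r *\<^sub>R u)) x = r *\<^sub>R T (fn u) x"
      by eventually_elim (simp add: scaleR_conv_of_real)
    then show "toL1 (T (fn (r *\<^sub>R u))) = r *\<^sub>R toL1 (T (fn u))"
      by (simp add: toL1_eq_iff toL1_scaleR[symmetric] I)
    show "norm (toL1 (T (fn u))) \<le> norm u * K"
      using K[of "fn u"] by (simp add: norm_toL1 I norm_l1_def[of u] L1_norm_def mult.commute)
  qed
qed

lemma app_lift_op:
  assumes "integrable lebesgue f"
  shows "lift_op T $$ toL1 f = toL1 (T f)"
proof -
  have "AE x in lebesgue. T (fn (toL1 f)) x = T f x"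
    by (rule bounded_operator_cong_AE[OF T _ _ fn_toL1]) (use assms in auto)
  then show ?thesis
    using bounded_operator_L1[OF T] assms
    by (simp add: lift_op_def app_endo[OF bounded_linear_lift_op] toL1_eq_iff)
qed

lemma fn_lift_op: "AE x in lebesgue. fn (lift_op T $$ u) x = T (fn u) x"
  using fn_toL1[OF bounded_operator_L1[OF T integrable_fn, of u]] app_lift_op[of "fn u"] by simp

lemma norm_lift_op_le:
  assumes "0 \<le> K"
    and "\<And>f. integrable lebesgue f \<Longrightarrow> L1_norm lebesgue (T f) \<le> K * L1_norm lebesgue f"
  shows "norm (lift_op T) \<le> K"
proof (rule norm_endo_le[OF assms(1)])
  fix u
  have "norm (lift_op T $$ u) = L1_norm lebesgue (T (fn u))"
    using app_lift_op[of "fn u"] by (simp add: norm_toL1 bounded_operator_L1[OF T] L1_norm_def)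
  then show "norm (lift_op T $$ u) \<le> K * norm u"
    using assms(2)[of "fn u"] by (simp add: L1_norm_def norm_l1_def[of u])
qed

end

lemma bounded_operator_multiplication:
  fixes \<phi> :: "'a \<Rightarrow> 'k::{real_normed_field, banach, second_countable_topology}"
  assumes [measurable]: "\<phi> \<in> borel_measurable M" and K: "AE x in M. norm (\<phi> x) \<le> K"
  shows "bounded_operator M (\<lambda>f x. \<phi> x * f x)"
    and "integrable M f \<Longrightarrow> L1_norm M (\<lambda>x. \<phi> x * f x) \<le> K * L1_norm M f"
proof -
  have I: "integrable M (\<lambda>x. \<phi> x * f x)" if f: "integrable M f" for f
  proof (rule Bochner_Integration.integrable_bound)
    show "integrable M (\<lambda>x. K * norm (f x))" using f by auto
    show "(\<lambda>x. \<phi> x * f x) \<in> borel_measurable M" using f by measurable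
    show "AE x in M. norm (\<phi> x * f x) \<le> norm (K * norm (f x))"
      using K by eventually_elim (auto simp: norm_mult abs_mult intro: mult_right_mono)
  qed
  show B: "L1_norm M (\<lambda>x. \<phi> x * f x) \<le> K * L1_norm M f" if f: "integrable M f" for f
  proof -
    have "L1_norm M (\<lambda>x. \<phi> x * f x) \<le> (LINT x|M. K * norm (f x))"
      unfolding L1_norm_def
    proof (rule integral_mono_AE)
      show "AE x in M. norm (\<phi> x * f x) \<le> K * norm (f x)"
        using K by eventually_elim (auto simp: norm_mult intro: mult_right_mono)
    qed (use f I in auto)
    then show ?thesis by (simp add: L1_norm_def)
  qed
  show "bounded_operator M (\<lambda>f x. \<phi> x * f x)"
    unfolding bounded_operator_def L1_def ae_eq_def using I B
    by (auto simp: algebra_simps)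
qed

section \<open>Multiplication operators, complex scalars and norming functionals\<close>

definition mul :: "(real \<Rightarrow> complex) \<Rightarrow> l1 endo" where
  "mul \<phi> = lift_op (\<lambda>f x. \<phi> x * f x)"

text \<open>The type classes provide real scalars only; complex scalars enter as elements of the algebra.\<close>

definition sc :: "complex \<Rightarrow> l1 endo" where
  "sc z = mul (\<lambda>x. z)"

lemma fn_mul:
  assumes "\<phi> \<in> borel_measurable lebesgue" "AE x in lebesgue. norm (\<phi> x) \<le> K"
  shows "AE x in lebesgue. fn (mul \<phi> $$ u) x = \<phi> x * fn u x"
  unfolding mul_def by (rule fn_lift_op) (rule bounded_operator_multiplication[OF assms])

lemma fn_sc: "AE x in lebesgue. fn (sc z $$ u) x = z * fn u x"
  unfolding sc_def by (rule fn_mul[of _ "norm z"]) auto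

lemma norm_sc_app: "norm (sc z $$ u) = norm z * norm u"
proof -
  have "norm (sc z $$ u) = (LINT x|lebesgue. norm z * norm (fn u x))"
    unfolding norm_l1_def by (rule integral_cong_AE) (use fn_sc[of z u] in \<open>auto simp: norm_mult\<close>)
  then show ?thesis by (simp add: norm_l1_def)
qed

lemma norm_sc_le: "norm (sc z) \<le> norm z"
  by (rule norm_endo_le) (auto simp: norm_sc_app)

lemma sc_add: "sc (z + w) = sc z + sc w"
proof (rule endo_eqI)
  fix u
  show "sc (z + w) $$ u = (sc z + sc w) $$ u"
    unfolding l1_eq_iff app_simps using fn_sc[of "z + w" u] fn_sc[of z u] fn_sc[of w u] fn_add[of "sc z $$ u" "sc w $$ u"]
    by eventually_elim (simp add: algebra_simps)
qed

lemma sc_mult: "sc (z * w) = sc z * sc w"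
proof (rule endo_eqI)
  fix u
  show "sc (z * w) $$ u = (sc z * sc w) $$ u"
    unfolding l1_eq_iff app_mult using fn_sc[of "z * w" u] fn_sc[of w u] fn_sc[of z "sc w $$ u"]
    by eventually_elim simp
qed

lemma sc_of_real: "sc (of_real r) = r *\<^sub>R 1"
proof (rule endo_eqI)
  fix u
  show "sc (of_real r) $$ u = (r *\<^sub>R 1) $$ u"
    unfolding l1_eq_iff app_simps app_one using fn_sc[of "of_real r" u] fn_scaleR[of r u]
    by eventually_elim (simp add: scaleR_conv_of_real)
qed

text \<open>Elements of \<open>l1 endo\<close> are merely real-linear; commuting with every
  \<open>sc z\<close> is how complex linearity is expressed. It is what makes the exponential of
  \<open>sc z * H\<close> holomorphic in \<open>z\<close>.\<close>

lemma sc_commute_lift_op: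
  assumes "bounded_operator lebesgue T"
  shows "lift_op T * sc z = sc z * lift_op T"
proof (rule endo_eqI)
  fix u
  have "AE x in lebesgue. T (fn (sc z $$ u)) x = T (\<lambda>x. z * fn u x) x"
    by (rule bounded_operator_cong_AE[OF assms _ _ fn_sc]) auto
  with bounded_operator_mult[OF assms integrable_fn[of u], of z]
    fn_lift_op[OF assms, of u] fn_lift_op[OF assms, of "sc z $$ u"] fn_sc[of z "lift_op T $$ u"]
  show "(lift_op T * sc z) $$ u = (sc z * lift_op T) $$ u"
    unfolding l1_eq_iff app_mult by eventually_elim simp
qed

text \<open>In L1 a functional that norms \<open>u\<close> is explicit: integrate against the
  conjugate of the sign of \<open>u\<close>, a measurable function of modulus at most 1.
  Compatibility with \<open>sc\<close> turns operator exponentials into complex-valued functions to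
  which Cauchy's inequality applies.\<close>

lemma ex_norming_functional:
  fixes u :: l1
  obtains \<phi> :: "l1 \<Rightarrow> complex" where "bounded_linear \<phi>" "\<And>z v. \<phi> (sc z $$ v) = z * \<phi> v"
    "\<And>v. norm (\<phi> v) \<le> norm v" "\<phi> u = of_real (norm u)"
proof
  define \<sigma> where "\<sigma> x = cnj (sgn (fn u x))" for x
  have [measurable]: "\<sigma> \<in> borel_measurable lebesgue"
  proof -
    have "(\<lambda>x. sgn (fn u x)) \<in> borel_measurable lebesgue"
      unfolding sgn_div_norm by measurable
    moreover have "cnj \<in> borel_measurable borel"
      by (intro borel_measurable_continuous_onI continuous_intros)
    ultimately show ?thesis
      unfolding \<sigma>_def by (rule measurable_compose)
  qed
  have le: "norm (\<sigma> x) \<le> 1" for x by (simp add: \<sigma>_def norm_sgn)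
  have I: "integrable lebesgue (\<lambda>x. \<sigma> x * fn v x)" for v
    using bounded_operator_multiplication(1)[of \<sigma> lebesgue 1] le bounded_operator_L1 by fastforce
  define \<phi> where "\<phi> v = (LINT x|lebesgue. \<sigma> x * fn v x)" for v
  have [measurable]: "(\<lambda>x. \<sigma> x * fn v x) \<in> borel_measurable lebesgue" for v
    by measurable
  show b: "norm (\<phi> v) \<le> norm v" for v
  proof -
    have "norm (\<phi> v) \<le> (LINT x|lebesgue. norm (\<sigma> x * fn v x))"
      unfolding \<phi>_def by (rule integral_norm_bound)
    also have "\<dots> \<le> norm v"
      unfolding norm_l1_def
      by (rule integral_mono)
        (use integrable_norm[OF I[of v]] le in \<open>auto simp: norm_mult intro!: mult_left_le_one_le\<close>)
    finally show ?thesis .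
  qed
  have add: "\<phi> (v + w) = \<phi> v + \<phi> w" for v w
  proof -
    have "\<phi> (v + w) = (LINT x|lebesgue. \<sigma> x * fn v x + \<sigma> x * fn w x)"
      unfolding \<phi>_def by (rule integral_cong_AE) (use fn_add[of v w] in \<open>auto simp: algebra_simps\<close>)
    then show ?thesis by (simp add: \<phi>_def I)
  qed
  show sc: "\<phi> (sc z $$ v) = z * \<phi> v" for z v
  proof -
    have "\<phi> (sc z $$ v) = (LINT x|lebesgue. z * (\<sigma> x * fn v x))"
      unfolding \<phi>_def by (rule integral_cong_AE) (use fn_sc[of z v] in auto)
    then show ?thesis by (simp add: \<phi>_def)
  qed
  have "\<phi> (r *\<^sub>R v) = r *\<^sub>R \<phi> v" for r v
    using sc[of "of_real r" v] by (simp only: sc_of_real app_simps app_one scaleR_conv_of_real[of r "\<phi> v"])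
  then show "bounded_linear \<phi>"
    by (intro bounded_linear_intro[where K = 1]) (use add b in auto)
  have "\<sigma> x * fn u x = of_real (norm (fn u x))" for x
    by (cases "fn u x = 0") (simp_all add: \<sigma>_def sgn_div_norm scaleR_conv_of_real mult.assoc
      mult.commute[of "cnj _"] complex_norm_square[symmetric] power2_eq_square)
  then show "\<phi> u = of_real (norm u)"
    by (simp add: \<phi>_def norm_l1_def)
qed

section \<open>Cauchy estimates for operator exponentials\<close>

lemma has_field_derivative_quadratic:
  fixes f :: "'a::real_normed_field \<Rightarrow> 'a"
  assumes "d > 0" "\<And>h. norm h \<le> d \<Longrightarrow> norm (f (z + h) - f z - h * D) \<le> K * (norm h)\<^sup>2"
  shows "(f has_field_derivative D) (at z)"
  unfolding DERIV_def
proof (rule LIM_zero_cancel, rule Lim_null_comparison)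
  show "\<forall>\<^sub>F h in at 0. norm ((f (z + h) - f z) / h - D) \<le> K * norm h"
    unfolding eventually_at
  proof (intro exI[of _ d] conjI ballI impI)
    fix h :: 'a assume h: "h \<noteq> 0 \<and> dist h 0 < d"
    have "(f (z + h) - f z) / h - D = (f (z + h) - f z - h * D) / h"
      using h by (simp add: field_simps)
    then have "norm ((f (z + h) - f z) / h - D) = norm (f (z + h) - f z - h * D) / norm h"
      by (simp add: norm_divide)
    also have "\<dots> \<le> K * (norm h)\<^sup>2 / norm h"
      using h assms(2)[of h] by (intro divide_right_mono) auto
    finally show "norm ((f (z + h) - f z) / h - D) \<le> K * norm h"
      using h by (simp add: power2_eq_square)
  qed (rule assms(1))
  show "((\<lambda>h. K * norm h) \<longlongrightarrow> 0) (at 0)"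
    by (intro tendsto_mult_right_zero tendsto_norm_zero tendsto_ident_at)
qed

lemma sc_commute: "sc z * sc w = sc w * sc z"
  by (simp add: sc_mult[symmetric] mult.commute)

lemma sc_left_commute: "sc z * (sc w * X) = sc w * (sc z * X)"
  by (simp add: mult.assoc[symmetric] sc_commute[of z w])

context
  fixes H :: "l1 endo"
  assumes H: "\<And>z. H * sc z = sc z * H"
begin

lemma H_left: "H * (sc z * X) = sc z * (H * X)"
  by (simp add: mult.assoc[symmetric] H)

lemma sc_commute_exp: "exp (sc z * H) * sc w = sc w * exp (sc z * H)"
  by (rule exp_mult_right_commute) (simp add: mult.assoc H sc_left_commute)

lemma commute_exp_sc: "exp (sc z * H) * H = H * exp (sc z * H)"
  by (rule exp_mult_right_commute) (simp add: mult.assoc H_left)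

lemma exp_sc_add: "exp (sc (z + w) * H) = exp (sc z * H) * exp (sc w * H)"
proof -
  have "sc z * H * (sc w * H) = sc w * H * (sc z * H)"
    by (simp add: mult.assoc H_left sc_left_commute)
  then show ?thesis
    by (simp add: sc_add distrib_right exp_add_commuting)
qed

lemma norm_exp_sc_quadratic:
  assumes "norm h * norm H \<le> 1"
  shows "norm (exp (sc h * H) - 1 - sc h * H) \<le> (norm H)\<^sup>2 * (norm h)\<^sup>2"
proof -
  have le: "norm (sc h * H) \<le> norm h * norm H"
    by (meson mult_right_mono norm_ge_zero norm_mult_ineq norm_sc_le order_trans)
  with assms have "norm (exp (sc h * H) - 1 - sc h * H) \<le> (norm (sc h * H))\<^sup>2"
    by (intro norm_exp_minus_linear_le) auto
  also have "\<dots> \<le> (norm h * norm H)\<^sup>2"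
    using le by (intro power_mono) auto
  finally show ?thesis by (simp add: power_mult_distrib mult.commute)
qed

lemma has_field_derivative_functional_exp:
  assumes \<phi>: "bounded_linear \<phi>" "\<And>z v. \<phi> (sc z $$ v) = z * \<phi> v" "\<And>v. norm (\<phi> v) \<le> norm v"
  shows "((\<lambda>w. \<phi> (exp (sc w * H) $$ u)) has_field_derivative \<phi> (exp (sc z * H) $$ H $$ u)) (at z)"
proof (rule has_field_derivative_quadratic)
  interpret \<phi>: bounded_linear \<phi> by fact
  \<comment> \<open>This radius gives \<open>norm h * norm H \<le> 1\<close>, the range of
    \<open>norm_exp_sc_quadratic\<close>; the added 1 covers \<open>H = 0\<close>.\<close>
  let ?d = "1 / (norm H + 1)"
  have pos: "norm H + 1 > 0" using norm_ge_zero[of H] by linarith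
  then show "?d > 0" by simp
  fix h :: complex assume h: "norm h \<le> ?d"
  have "norm h * norm H \<le> ?d * (norm H + 1)"
    by (intro mult_mono) (use h pos in auto)
  then have hH: "norm h * norm H \<le> 1" using pos by simp
  let ?E = "exp (sc z * H)"
  have e: "exp (sc (z + h) * H) = exp (sc h * H) * ?E"
    by (simp add: exp_sc_add[symmetric] add.commute)
  have s: "h * \<phi> (?E $$ H $$ u) = \<phi> ((sc h * H * ?E) $$ u)"
    using \<phi>(2)[of h "(?E * H) $$ u"] commute_exp_sc[of z] by (metis app_mult)
  have "\<phi> (exp (sc (z + h) * H) $$ u) - \<phi> (?E $$ u) - h * \<phi> (?E $$ H $$ u)
    = \<phi> ((exp (sc h * H) - 1 - sc h * H) $$ ?E $$ u)"
    unfolding s e by (simp add: \<phi>.diff app_simps)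
  then have "norm (\<phi> (exp (sc (z + h) * H) $$ u) - \<phi> (?E $$ u) - h * \<phi> (?E $$ H $$ u))
    \<le> norm ((exp (sc h * H) - 1 - sc h * H) $$ ?E $$ u)"
    using \<phi>(3) by simp
  also have "\<dots> \<le> norm (exp (sc h * H) - 1 - sc h * H) * norm (?E $$ u)"
    by (rule norm_app)
  also have "\<dots> \<le> ((norm H)\<^sup>2 * (norm h)\<^sup>2) * norm (?E $$ u)"
    by (intro mult_right_mono norm_exp_sc_quadratic hH) auto
  finally show "norm (\<phi> (exp (sc (z + h) * H) $$ u) - \<phi> (?E $$ u) - h * \<phi> (?E $$ H $$ u))
    \<le> ((norm H)\<^sup>2 * norm (?E $$ u)) * (norm h)\<^sup>2"
    by (simp add: mult_ac)
qed

text \<open>Neither bound contains \<open>norm H\<close>; both depend only on the size of the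
  exponential on a disc, so they are uniform over the truncated generators. The radius is doubled
  because the second derivative is needed on all of \<open>cball z r\<close>, and Cauchy's
  inequality at a point of that disc takes another disc of radius \<open>r\<close> around
  it.\<close>

lemma Cauchy_estimate_exp:
  assumes r: "r > 0" and B: "\<And>w. w \<in> cball z (2 * r) \<Longrightarrow> norm (exp (sc w * H)) \<le> B"
  shows "norm (exp (sc z * H) * H) \<le> B / r"
    and "norm h < r \<Longrightarrow>
      norm (exp (sc (z + h) * H) - exp (sc z * H) - sc h * (exp (sc z * H) * H)) \<le> 2 * B / r\<^sup>2 * (norm h)\<^sup>2"
proof -
  have B0: "0 \<le> B" using B[of z] r norm_ge_zero[of "exp (sc z * H)"] by (simp del: norm_ge_zero)
  \<comment> \<open>Each differentiation brings down one factor \<open>H\<close>, so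
    \<open>F \<phi> u n\<close> is the n-th derivative of \<open>F \<phi> u 0\<close>.\<close>
  define F where "F \<phi> u n w = \<phi> (exp (sc w * H) $$ (H ^ n) $$ u)"
    for \<phi> :: "l1 \<Rightarrow> complex" and u n w
  have DF: "(F \<phi> u n has_field_derivative F \<phi> u (Suc n) w) (at w)"
    if "bounded_linear \<phi>" "\<And>z v. \<phi> (sc z $$ v) = z * \<phi> v" "\<And>v. norm (\<phi> v) \<le> norm v" for \<phi> u n w
    using has_field_derivative_functional_exp[OF that, of "(H ^ n) $$ u" w]
    by (simp add: F_def[abs_def])
  have est: "norm (F \<phi> u n w) \<le> fact n * (B * norm u) / r ^ n"
    if w: "w \<in> cball z r" and \<phi>: "bounded_linear \<phi>" "\<And>z v. \<phi> (sc z $$ v) = z * \<phi> v" "\<And>v. norm (\<phi> v) \<le> norm v"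
    for \<phi> u n w
  proof -
    have "(deriv ^^ n) (F \<phi> u 0) = F \<phi> u n"
      by (induction n) (auto intro!: ext DERIV_imp_deriv DF[OF \<phi>])
    moreover have "norm ((deriv ^^ n) (F \<phi> u 0) w) \<le> fact n * (B * norm u) / r ^ n"
    proof (rule Cauchy_inequality[OF _ _ r])
      show "F \<phi> u 0 holomorphic_on ball w r"
        unfolding holomorphic_on_def field_differentiable_def
        using DF[OF \<phi>, of u 0] has_field_derivative_at_within by blast
      show "continuous_on (cball w r) (F \<phi> u 0)"
        using DF[OF \<phi>, of u 0] DERIV_isCont continuous_at_imp_continuous_on by blast
      fix x assume "cmod (w - x) = r"
      then have "x \<in> cball z (2 * r)"
        using w dist_triangle[of z x w] by (simp add: dist_norm)
      then have "norm (exp (sc x * H) $$ u) \<le> B * norm u"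
        by (meson B mult_right_mono norm_app norm_ge_zero order_trans)
      then show "cmod (F \<phi> u 0 x) \<le> B * norm u"
        using \<phi>(3)[of "exp (sc x * H) $$ u"] by (simp add: F_def)
    qed
    ultimately show ?thesis by simp
  qed
  show "norm (exp (sc z * H) * H) \<le> B / r"
  proof (rule norm_endo_le)
    show "0 \<le> B / r" using B0 r by simp
    fix u
    obtain \<phi> where \<phi>: "bounded_linear \<phi>" "\<And>z v. \<phi> (sc z $$ v) = z * \<phi> v" "\<And>v. norm (\<phi> v) \<le> norm v"
      "\<phi> ((exp (sc z * H) * H) $$ u) = of_real (norm ((exp (sc z * H) * H) $$ u))"
      using ex_norming_functional by blast
    show "norm ((exp (sc z * H) * H) $$ u) \<le> B / r * norm u"
      using est[OF _ \<phi>(1-3), of z u 1] \<phi>(4) r by (simp add: F_def)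
  qed
  show "norm (exp (sc (z + h) * H) - exp (sc z * H) - sc h * (exp (sc z * H) * H)) \<le> 2 * B / r\<^sup>2 * (norm h)\<^sup>2"
    (is "norm ?X \<le> _") if h: "norm h < r"
  proof (rule norm_endo_le)
    show "0 \<le> 2 * B / r\<^sup>2 * (norm h)\<^sup>2" using B0 by simp
    fix u
    obtain \<phi> where \<phi>: "bounded_linear \<phi>" "\<And>z v. \<phi> (sc z $$ v) = z * \<phi> v" "\<And>v. norm (\<phi> v) \<le> norm v"
      "\<phi> (?X $$ u) = of_real (norm (?X $$ u))"
      using ex_norming_functional by blast
    interpret \<phi>: bounded_linear \<phi> by fact
    \<comment> \<open>The second derivative is at most \<open>2 * (B * norm u) / r\<^sup>2\<close>
      by Cauchy's inequality. The remainder in \<open>field_Taylor\<close> is divided by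
      \<open>fact 1\<close> only, so the factor 2 stays.\<close>
    have "cmod (F \<phi> u 0 (z + h) - (\<Sum>i\<le>1. F \<phi> u i z * (z + h - z) ^ i / fact i))
      \<le> (2 * (B * norm u) / r\<^sup>2) * cmod (z + h - z) ^ Suc 1 / fact 1"
    proof (rule field_Taylor)
      show "convex (cball z r)" by simp
      show "cmod (F \<phi> u (Suc 1) w) \<le> 2 * (B * norm u) / r\<^sup>2" if "w \<in> cball z r" for w
        using est[OF that \<phi>(1-3), of u 2] by (simp add: numeral_2_eq_2)
      show "z \<in> cball z r" "z + h \<in> cball z r"
        using r h by (auto simp: dist_norm)
    qed (rule has_field_derivative_at_within, rule DF[OF \<phi>(1-3)])
    moreover have "F \<phi> u 0 (z + h) - (\<Sum>i\<le>1. F \<phi> u i z * (z + h - z) ^ i / fact i) = \<phi> (?X $$ u)"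
      by (simp add: F_def \<phi>.diff \<phi>.add app_simps \<phi>(2) algebra_simps)
    ultimately show "norm (?X $$ u) \<le> 2 * B / r\<^sup>2 * (norm h)\<^sup>2 * norm u"
      using \<phi>(4) by (simp add: power2_eq_square mult_ac)
  qed
qed

end

text \<open>The density argument of \<open>ex_strong_lim\<close> for an arbitrary filter and a known
  limit operator: convergence of an eventually bounded family is tested on truncated vectors
  only.\<close>

lemma tendsto_app_dense:
  assumes P: "strong_lim P (1 :: 'a::{real_normed_vector, perfect_space} endo)"
    and B: "\<forall>\<^sub>F z in F. norm (E z) \<le> B"
    and lim: "\<And>m. ((\<lambda>z. E z $$ P m $$ u) \<longlongrightarrow> L $$ P m $$ u) F"
  shows "((\<lambda>z. E z $$ u) \<longlongrightarrow> L $$ u) F"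
proof (rule tendstoI)
  fix e :: real assume e: "e > 0"
  define K where "K = \<bar>B\<bar> + norm L + 1"
  have K: "K > 0" by (simp add: K_def add_nonneg_pos)
  have "(\<lambda>m. P m $$ u) \<longlonglongrightarrow> u" using strong_limD[OF P, of u] by simp
  then obtain m where m: "norm (P m $$ u - u) < e / (2 * K)"
    using e K LIMSEQ_D[of _ u "e / (2 * K)"] by force
  define v where "v = u - P m $$ u"
  have v: "K * norm v < e / 2"
    using m K by (simp add: v_def norm_minus_commute field_simps)
  have "\<forall>\<^sub>F z in F. dist (E z $$ P m $$ u) (L $$ P m $$ u) < e / 2"
    using lim[of m] e by (intro tendstoD) auto
  with B show "\<forall>\<^sub>F z in F. dist (E z $$ u) (L $$ u) < e"
  proof eventually_elim
    case (elim z)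
    have "E z $$ u - L $$ u = (E z $$ P m $$ u - L $$ P m $$ u) + (E z $$ v - L $$ v)"
      by (simp add: v_def app_simps)
    then have "norm (E z $$ u - L $$ u) \<le> norm (E z $$ P m $$ u - L $$ P m $$ u) + (norm (E z $$ v) + norm (L $$ v))"
      using norm_triangle_ineq[of "E z $$ P m $$ u - L $$ P m $$ u" "E z $$ v - L $$ v"]
        norm_triangle_ineq4[of "E z $$ v" "L $$ v"] by simp
    moreover have "norm (E z $$ v) + norm (L $$ v) \<le> norm (E z) * norm v + norm L * norm v"
      by (intro add_mono norm_app)
    moreover have "\<dots> = (norm (E z) + norm L) * norm v" by (simp add: distrib_right)
    moreover have "\<dots> \<le> K * norm v"
      using elim by (intro mult_right_mono) (auto simp: K_def)
    ultimately show ?case using elim v by (simp add: dist_norm)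
  qed
qed

section \<open>Semigroups as strong limits of exponentials\<close>

text \<open>\<open>P m\<close> stands for the truncation to sizes at most \<open>m\<close>.
  \<open>GP\<close> says that later generators agree with \<open>G m\<close> on truncated vectors,
  and \<open>PG\<close> that these form an invariant subspace; together they make the exponentials
  consistent. \<open>norm_exp_G\<close> supplies the bound uniform in \<open>n\<close>.\<close>

locale truncated_generator =
  fixes P G :: "nat \<Rightarrow> l1 endo" and k C :: real
  assumes P: "strong_lim P 1"
    and GP: "\<And>m n. m \<le> n \<Longrightarrow> G n * P m = G m"
    and PG: "\<And>m. P m * G m = G m"
    and P_sc: "\<And>m z. P m * sc z = sc z * P m"
    and G_sc: "\<And>m z. G m * sc z = sc z * G m"
    and k: "k < 1" and C: "0 \<le> C"
    and norm_exp_G: "\<And>n z. k * norm z \<le> Re z \<Longrightarrow> norm (exp (sc z * G n)) \<le> exp (C * norm z)"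
begin

text \<open>For 0 < k < 1 this is the closed sector of half-angle \<open>arccos k\<close> with 0
  included, written without \<open>Arg\<close>.\<close>

definition cone :: "complex set" where "cone = {z. k * norm z \<le> Re z}"

definition T :: "complex \<Rightarrow> l1 endo" where
  "T z = (THE L. strong_lim (\<lambda>n. exp (sc z * G n)) L)"

lemma cone_0 [simp]: "0 \<in> cone"
  by (simp add: cone_def)

lemma of_real_cone [simp]: "0 \<le> t \<Longrightarrow> complex_of_real t \<in> cone"
  using mult_right_mono[of k 1 t] k by (simp add: cone_def)

lemma norm_exp_cone: "z \<in> cone \<Longrightarrow> norm (exp (sc z * G n)) \<le> exp (C * norm z)"
  by (simp add: cone_def norm_exp_G)

lemma PGP: "P m * (sc z * G m) * P m = sc z * G m * P m"
proof -
  have "P m * (sc z * G m) = sc z * (P m * G m)"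
    by (simp only: mult.assoc[symmetric] P_sc)
  then show ?thesis by (simp add: PG)
qed

lemma exp_G_P: "m \<le> n \<Longrightarrow> exp (sc z * G n) * P m = exp (sc z * G m) * P m"
  by (intro exp_intertwine PGP) (simp add: mult.assoc GP)

lemma T_lim:
  assumes "z \<in> cone"
  shows "strong_lim (\<lambda>n. exp (sc z * G n)) (T z)"
proof -
  have "\<exists>L. strong_lim (\<lambda>n. exp (sc z * G n)) L"
    by (rule ex_strong_lim[OF norm_exp_cone[OF assms] P]) (metis app_mult exp_G_P)
  then obtain L where L: "strong_lim (\<lambda>n. exp (sc z * G n)) L" ..
  show ?thesis
    unfolding T_def by (rule theI[of "strong_lim (\<lambda>n. exp (sc z * G n))"]) (rule L, rule strong_lim_unique[OF _ L])
qed

lemma T_eqI: "z \<in> cone \<Longrightarrow> strong_lim (\<lambda>n. exp (sc z * G n)) L \<Longrightarrow> T z = L"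
  by (rule strong_lim_unique[OF T_lim])

lemma norm_T: "z \<in> cone \<Longrightarrow> norm (T z) \<le> exp (C * norm z)"
  by (rule strong_lim_norm_le[OF T_lim norm_exp_cone])

lemma T_0: "T 0 = 1"
proof -
  have "sc 0 = 0" using sc_of_real[of 0] by simp
  then show ?thesis by (intro T_eqI) (simp_all add: strong_lim_const)
qed

lemma T_add:
  assumes z: "z \<in> cone" and w: "w \<in> cone" and zw: "z + w \<in> cone"
  shows "T (z + w) = T z * T w"
proof (rule T_eqI[OF zw])
  show "strong_lim (\<lambda>n. exp (sc (z + w) * G n)) (T z * T w)"
    unfolding exp_sc_add[OF G_sc]
    by (rule strong_lim_mult[OF T_lim[OF z] T_lim[OF w] norm_exp_cone[OF z]])
qed

lemma T_commute:
  assumes z: "z \<in> cone" and X: "X * sc z = sc z * X" "\<And>n. X * G n = G n * X"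
  shows "T z * X = X * T z"
proof -
  have "exp (sc z * G n) * X = X * exp (sc z * G n)" for n
  proof (rule exp_mult_right_commute)
    have "X * (sc z * G n) = sc z * (X * G n)" by (simp only: mult.assoc[symmetric] X(1))
    then show "sc z * G n * X = X * (sc z * G n)" by (simp add: mult.assoc X(2))
  qed
  then show ?thesis
    using strong_lim_mult_left[OF T_lim[OF z], of X] strong_lim_mult_right[OF T_lim[OF z], of X]
    by (simp add: strong_lim_unique)
qed

lemma T_sc: "z \<in> cone \<Longrightarrow> T z * sc w = sc w * T z"
  by (rule T_commute) (simp_all add: sc_commute[of w z] G_sc)

text \<open>After multiplication by \<open>P m\<close> the sequence that defines \<open>T z\<close>
  is eventually constant. On truncated vectors \<open>T\<close> is therefore the exponential of a
  bounded operator, and limits as \<open>z\<close> tends to 0 can be computed there.\<close>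

lemma T_P: "z \<in> cone \<Longrightarrow> T z * P m = exp (sc z * G m) * P m"
proof -
  assume z: "z \<in> cone"
  have "\<forall>\<^sub>F n in sequentially. exp (sc z * G n) * P m = exp (sc z * G m) * P m"
    using eventually_ge_at_top[of m] by eventually_elim (rule exp_G_P)
  then have "strong_lim (\<lambda>n. exp (sc z * G n) * P m) (exp (sc z * G m) * P m)"
    unfolding strong_lim_def by (auto intro!: tendsto_eventually elim!: eventually_mono simp flip: app_mult)
  then show ?thesis
    by (rule strong_lim_unique[OF strong_lim_mult_right[OF T_lim[OF z]]])
qed

lemma T_invariant:
  assumes "z \<in> cone" "closed S" "\<And>n. exp (sc z * G n) $$ u \<in> S"
  shows "T z $$ u \<in> S"
  using closed_sequentially[OF assms(2) assms(3) strong_limD[OF T_lim[OF assms(1)]]] .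

lemma tendsto_exp_sc_0: "((\<lambda>z. exp (sc z * G m)) \<longlongrightarrow> 1) (at 0 within S)"
proof (rule LIM_zero_cancel, rule Lim_null_comparison)
  let ?g = "norm (G m)"
  show "((\<lambda>z. ?g\<^sup>2 * (norm z)\<^sup>2 + norm z * ?g) \<longlongrightarrow> 0) (at 0 within S)"
    by (auto intro!: tendsto_eq_intros)
  have "\<forall>\<^sub>F z in at 0 within S. norm z * ?g < 1"
    by (rule order_tendstoD[where y = 0]) (auto intro!: tendsto_eq_intros)
  then show "\<forall>\<^sub>F z in at 0 within S. norm (exp (sc z * G m) - 1) \<le> ?g\<^sup>2 * (norm z)\<^sup>2 + norm z * ?g"
  proof eventually_elim
    case (elim z)
    have "norm (exp (sc z * G m) - 1) \<le> norm (exp (sc z * G m) - 1 - sc z * G m) + norm (sc z * G m)"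
      using norm_triangle_ineq[of "exp (sc z * G m) - 1 - sc z * G m" "sc z * G m"] by simp
    moreover have "norm (exp (sc z * G m) - 1 - sc z * G m) \<le> ?g\<^sup>2 * (norm z)\<^sup>2"
      using elim by (intro norm_exp_sc_quadratic G_sc) auto
    moreover have "norm (sc z * G m) \<le> norm z * ?g"
      by (meson mult_right_mono norm_ge_zero norm_mult_ineq norm_sc_le order_trans)
    ultimately show ?case by linarith
  qed
qed

lemma T_tendsto_0:
  assumes "S \<subseteq> cone"
  shows "((\<lambda>z. T z $$ u) \<longlongrightarrow> u) (at 0 within S)"
proof -
  have "((\<lambda>z. T z $$ u) \<longlongrightarrow> 1 $$ u) (at 0 within S)"
  proof (rule tendsto_app_dense[OF P])
    have "\<forall>\<^sub>F z in at 0 within S. C * norm z < 1"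
      by (rule order_tendstoD[where y = 0]) (auto intro!: tendsto_eq_intros)
    moreover have "\<forall>\<^sub>F z in at 0 within S. z \<in> S"
      by (simp add: eventually_at_filter)
    ultimately show "\<forall>\<^sub>F z in at 0 within S. norm (T z) \<le> exp 1"
    proof eventually_elim
      case (elim z)
      then have "norm (T z) \<le> exp (C * norm z)" using assms by (intro norm_T) auto
      also have "\<dots> \<le> exp 1" using elim by simp
      finally show ?case .
    qed
    fix m
    have "((\<lambda>z. exp (sc z * G m) $$ P m $$ u) \<longlongrightarrow> 1 $$ P m $$ u) (at 0 within S)"
      by (intro app.tendsto tendsto_exp_sc_0 tendsto_const)
    moreover have "\<forall>\<^sub>F z in at 0 within S. exp (sc z * G m) $$ P m $$ u = T z $$ P m $$ u"
      unfolding eventually_at_filter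
      using assms by (auto intro!: always_eventually simp flip: app_mult simp: T_P subset_iff)
    ultimately show "((\<lambda>z. T z $$ P m $$ u) \<longlongrightarrow> 1 $$ P m $$ u) (at 0 within S)"
      by (rule Lim_transform_eventually)
  qed
  then show ?thesis by simp
qed

text \<open>Norm convergence of difference quotients does not by itself survive a strong limit, but
  a quadratic norm bound does, by \<open>strong_lim_norm_le\<close>. Hence the derivative comes with
  an explicit remainder, which the Cauchy estimates make uniform in \<open>n\<close>.\<close>

lemma T_differentiable:
  assumes z: "k * norm z < Re z"
  obtains D K d where "d > 0" "\<And>w. D * sc w = sc w * D"
    "\<And>h::complex. norm h < d \<Longrightarrow> norm (T (z + h) - T z - sc h * D) \<le> K * (norm h)\<^sup>2"
proof -
  have "open {z. k * norm z < Re z}"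
    by (intro open_Collect_less continuous_intros)
  then obtain e where e: "e > 0" "cball z e \<subseteq> {z. k * norm z < Re z}"
    using z open_contains_cball by blast
  define r where "r = e / 2"
  have r: "r > 0" "cball z (2 * r) \<subseteq> cone"
    using e by (auto simp: r_def cone_def)
  have zc: "z \<in> cone" using z by (simp add: cone_def)
  define B where "B = exp (C * (norm z + 2 * r))"
  have B: "norm (exp (sc w * G n)) \<le> B" if "w \<in> cball z (2 * r)" for w n
  proof -
    have "norm w \<le> norm z + 2 * r"
      using that norm_triangle_sub[of w z] by (simp add: dist_norm norm_minus_commute)
    then have "exp (C * norm w) \<le> B"
      using C by (simp add: B_def mult_left_mono)
    then show ?thesis using norm_exp_cone[of w n] r that by force
  qed
  \<comment> \<open>The derivatives of the approximating exponentials converge strongly for the same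
    two reasons as the exponentials: a bound uniform in \<open>n\<close>, here from Cauchy's
    inequality, and consistency on truncated vectors.\<close>
  have "\<exists>D. strong_lim (\<lambda>n. exp (sc z * G n) * G n) D"
  proof (rule ex_strong_lim[OF _ P])
    show "norm (exp (sc z * G n) * G n) \<le> B / r" for n
      by (rule Cauchy_estimate_exp(1)[OF G_sc r(1) B])
    fix m n :: nat and u assume mn: "m \<le> n"
    have "exp (sc z * G n) * G n * P m = exp (sc z * G n) * P m * G m"
      using mn by (simp add: mult.assoc GP PG)
    also have "\<dots> = exp (sc z * G m) * G m * P m"
      by (subst exp_G_P[OF mn]) (simp add: mult.assoc GP PG)
    finally show "(exp (sc z * G n) * G n) $$ P m $$ u = (exp (sc z * G m) * G m) $$ P m $$ u"
      by (simp flip: app_mult)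
  qed
  then obtain D where D: "strong_lim (\<lambda>n. exp (sc z * G n) * G n) D" by blast
  show ?thesis
  proof (rule that[OF r(1)])
    fix w
    have "exp (sc z * G n) * G n * sc w = sc w * (exp (sc z * G n) * G n)" for n
      by (simp add: mult.assoc G_sc) (simp add: mult.assoc[symmetric] sc_commute_exp[OF G_sc])
    then show "D * sc w = sc w * D"
      using strong_lim_mult_left[OF D, of "sc w"] strong_lim_mult_right[OF D, of "sc w"]
      by (simp add: strong_lim_unique)
  next
    fix h :: complex assume h: "norm h < r"
    then have "z + h \<in> cball z (2 * r)" using r(1) by (simp add: dist_norm)
    then have zh: "z + h \<in> cone" using r by blast
    show "norm (T (z + h) - T z - sc h * D) \<le> 2 * B / r\<^sup>2 * (norm h)\<^sup>2"
    proof (rule strong_lim_norm_le)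
      show "strong_lim (\<lambda>n. exp (sc (z + h) * G n) - exp (sc z * G n) - sc h * (exp (sc z * G n) * G n))
        (T (z + h) - T z - sc h * D)"
        by (intro strong_lim_diff strong_lim_mult_left T_lim zc zh D)
      show "norm (exp (sc (z + h) * G n) - exp (sc z * G n) - sc h * (exp (sc z * G n) * G n))
        \<le> 2 * B / r\<^sup>2 * (norm h)\<^sup>2" for n
        by (rule Cauchy_estimate_exp(2)[OF G_sc r(1) B h])
    qed
  qed
qed

end

text \<open>\<open>R\<close> plays the role of \<open>(\<mu> - A)\<^sup>-\<^sup>1\<close> and \<open>K\<close> that of \<open>B(\<mu> - A)\<^sup>-\<^sup>1\<close>, so the
  domain is the range of \<open>R\<close> and \<open>(A + B)(R v) = (\<mu> R - 1 + K) v\<close>.\<close>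

locale resolvent_generator = truncated_generator +
  fixes R K :: "l1 endo" and \<mu> :: real
  assumes GR: "\<And>n. G n * R = (\<mu> *\<^sub>R R - 1 + K) * P n"
    and RP: "\<And>n. R * P n = P n * R"
    and norm_P: "\<And>n. norm (P n) \<le> 1"
    and K: "norm K < 1" and \<mu>: "C < \<mu>"
begin

definition L :: "l1 endo" where "L = \<mu> *\<^sub>R R - 1 + K"

definition quot :: "real \<Rightarrow> l1 \<Rightarrow> l1" where
  "quot t u = (1 / t) *\<^sub>R (T (of_real t) $$ u - u)"

text \<open>By the mean value inequality for exp(s G_n) R. Its derivative is exp(s G_n) L P_n, and
  \<open>L\<close> is bounded although the generators are not uniformly so; the bound is thus
  independent of \<open>n\<close> and passes to the limit.\<close>

lemma norm_T_R_diff: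
  assumes t: "0 \<le> t"
  shows "norm (T (of_real t) * R - R) \<le> t * exp (C * t) * norm L"
proof (rule strong_lim_norm_le)
  show "strong_lim (\<lambda>n. exp (sc (of_real t) * G n) * R - R) (T (of_real t) * R - R)"
    by (intro strong_lim_diff strong_lim_mult_right strong_lim_const T_lim) (use t in simp)
  fix n
  let ?f = "\<lambda>s. exp (s *\<^sub>R G n) * R"
  have D: "(?f has_vector_derivative exp (s *\<^sub>R G n) * G n * R) (at s within {0..t})" for s
    by (intro bounded_linear.has_vector_derivative[OF bounded_linear_mult_left] exp_scaleR_has_vector_derivative_right)
  have "norm (?f t - ?f 0) \<le> (exp (C * t) * norm L) * norm (t - 0)"
  proof (rule differentiable_bound)
    show "(?f has_derivative (\<lambda>h. h *\<^sub>R (exp (s *\<^sub>R G n) * G n * R))) (at s within {0..t})" for s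
      using D[of s] by (simp add: has_vector_derivative_def)
    show "onorm (\<lambda>h. h *\<^sub>R (exp (s *\<^sub>R G n) * G n * R)) \<le> exp (C * t) * norm L" if s: "s \<in> {0..t}" for s
    proof (rule onorm_bound)
      have "exp (s *\<^sub>R G n) * G n * R = exp (s *\<^sub>R G n) * (L * P n)"
        by (simp add: mult.assoc GR L_def)
      then have "norm (exp (s *\<^sub>R G n) * G n * R) \<le> norm (exp (s *\<^sub>R G n)) * (norm L * norm (P n))"
        using order_trans[OF norm_mult_ineq mult_left_mono[OF norm_mult_ineq norm_ge_zero]] by simp
      also have "\<dots> \<le> exp (C * t) * (norm L * 1)"
      proof (intro mult_mono)
        have "norm (exp (sc (of_real s) * G n)) \<le> exp (C * norm (complex_of_real s))"
          using s by (intro norm_exp_cone) simp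
        also have "\<dots> \<le> exp (C * t)" using s C by (simp add: mult_left_mono)
        finally show "norm (exp (s *\<^sub>R G n)) \<le> exp (C * t)" by (simp add: sc_of_real)
      qed (use norm_P in auto)
      finally show "norm (h *\<^sub>R (exp (s *\<^sub>R G n) * G n * R)) \<le> exp (C * t) * norm L * norm h" for h
        by (simp add: mult.commute mult_left_mono)
    qed simp
  qed (use t in auto)
  then show "norm (exp (sc (of_real t) * G n) * R - R) \<le> t * exp (C * t) * norm L"
    using t by (simp add: sc_of_real mult_ac)
qed

lemma quot_eventually_eq:
  "\<forall>\<^sub>F t in at_right 0. quot t (R $$ u) = ((1 / t) *\<^sub>R (T (of_real t) * R - R)) $$ u"
  by (simp add: quot_def app_simps)

text \<open>The range of \<open>R\<close> lies in the domain of the generator, with values given by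
  \<open>L\<close>. By \<open>norm_T_R_diff\<close> the operators whose limit is sought are bounded
  near 0, so it suffices to differentiate on truncated vectors, where the semigroup is an
  exponential in norm.\<close>

lemma quot_R_tendsto: "((\<lambda>t. quot t (R $$ u)) \<longlongrightarrow> L $$ u) (at_right 0)"
proof -
  have "((\<lambda>t. ((1 / t) *\<^sub>R (T (of_real t) * R - R)) $$ u) \<longlongrightarrow> L $$ u) (at_right 0)"
  proof (rule tendsto_app_dense[OF P])
    have "\<forall>\<^sub>F t in at_right (0::real). 0 < t \<and> t < 1"
      by (simp add: eventually_at_right_field) (meson zero_less_one)
    then show "\<forall>\<^sub>F t in at_right 0. norm ((1 / t) *\<^sub>R (T (of_real t) * R - R)) \<le> exp C * norm L"
    proof eventually_elim
      case (elim t)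
      have "norm ((1 / t) *\<^sub>R (T (of_real t) * R - R)) \<le> (1 / t) * (t * exp (C * t) * norm L)"
        using norm_T_R_diff[of t] elim by (simp add: divide_simps mult_ac)
      also have "\<dots> \<le> exp C * norm L"
        using elim C mult_left_mono[of t 1 C] by (simp add: mult_right_mono)
      finally show ?case .
    qed
    fix m
    let ?E = "\<lambda>t. ((1 / t) *\<^sub>R (exp (sc (of_real t) * G m) - 1))"
    have "((\<lambda>t. ?E t - G m) \<longlongrightarrow> 0) (at_right 0)"
    proof (rule Lim_null_comparison)
      let ?g = "norm (G m)"
      show "((\<lambda>t. ?g\<^sup>2 * t) \<longlongrightarrow> 0) (at_right 0)"
        by (auto intro!: tendsto_eq_intros)
      have "\<forall>\<^sub>F t in at_right 0. t * ?g < 1"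
        by (rule order_tendstoD[where y = 0]) (auto intro!: tendsto_eq_intros)
      moreover have "\<forall>\<^sub>F t in at_right (0::real). 0 < t"
        by (simp add: eventually_at_filter)
      ultimately show "\<forall>\<^sub>F t in at_right 0. norm (?E t - G m) \<le> ?g\<^sup>2 * t"
      proof eventually_elim
        case (elim t)
        have "norm (exp (sc (of_real t) * G m) - 1 - sc (of_real t) * G m) \<le> ?g\<^sup>2 * (norm (complex_of_real t))\<^sup>2"
          using elim by (intro norm_exp_sc_quadratic G_sc) auto
        moreover have "?E t - G m = (1 / t) *\<^sub>R (exp (sc (of_real t) * G m) - 1 - sc (of_real t) * G m)"
          using elim by (simp add: sc_of_real algebra_simps)
        ultimately have "norm (?E t - G m) \<le> (1 / t) * (?g\<^sup>2 * t\<^sup>2)"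
          using elim by (simp add: divide_right_mono)
        then show ?case using elim by (simp add: power2_eq_square)
      qed
    qed
    then have "((\<lambda>t. ?E t) \<longlongrightarrow> G m) (at_right 0)" by (rule LIM_zero_cancel)
    then have "((\<lambda>t. ?E t $$ P m $$ R $$ u) \<longlongrightarrow> G m $$ P m $$ R $$ u) (at_right 0)"
      by (intro app.tendsto tendsto_const)
    moreover have "G m $$ P m $$ R $$ u = L $$ P m $$ u"
    proof -
      have "G m * (P m * R) = G m * P m * R" by (simp add: mult.assoc)
      also have "\<dots> = L * P m" by (simp add: GP GR L_def)
      finally show ?thesis by (simp flip: app_mult)
    qed
    ultimately have 1: "((\<lambda>t. ?E t $$ P m $$ R $$ u) \<longlongrightarrow> L $$ P m $$ u) (at_right 0)"
      by simp
    have 2: "\<forall>\<^sub>F t in at_right (0::real).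
      ?E t $$ P m $$ R $$ u = ((1 / t) *\<^sub>R (T (of_real t) * R - R)) $$ P m $$ u"
    proof -
      have "?E t * (P m * R) = ((1 / t) *\<^sub>R (T (of_real t) * R - R)) * P m" if "t > 0" for t
      proof -
        have "?E t * (P m * R) = (1 / t) *\<^sub>R (exp (sc (of_real t) * G m) * P m * R - P m * R)"
          by (simp add: left_diff_distrib mult.assoc)
        also have "\<dots> = (1 / t) *\<^sub>R (T (of_real t) * P m * R - P m * R)"
          using that by (simp add: T_P)
        finally show ?thesis by (simp add: left_diff_distrib mult.assoc RP)
      qed
      then show ?thesis
        unfolding eventually_at_filter
        by (intro always_eventually allI impI) (simp flip: app_mult)
    qed
    show "((\<lambda>t. ((1 / t) *\<^sub>R (T (of_real t) * R - R)) $$ P m $$ u) \<longlongrightarrow> L $$ P m $$ u) (at_right 0)"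
      by (rule Lim_transform_eventually[OF 1 2])
  qed
  then show ?thesis
    by (rule Lim_transform_eventually) (use quot_eventually_eq[of u] in \<open>simp add: eq_commute\<close>)
qed

lemma quot_diff: "quot t (u - v) = quot t u - quot t v"
  by (simp add: quot_def app_simps algebra_simps)

text \<open>To first order in \<open>t\<close> an eigenvector would grow in norm by the factor 1 + t
  \<mu>, while the semigroup allows only exp(C t), whose slope at 0 is C < \<mu>.\<close>

lemma eigenvector_zero:
  assumes "((\<lambda>t. quot t u) \<longlongrightarrow> \<mu> *\<^sub>R u) (at_right 0)"
  shows "u = 0"
proof (rule ccontr)
  assume "u \<noteq> 0"
  have "((\<lambda>h. (exp (C * (0 + h)) - exp (C * 0)) / h) \<longlongrightarrow> C) (at 0)"
    by (rule DERIV_D) (auto intro!: derivative_eq_intros)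
  then have e: "((\<lambda>t. (exp (C * t) - 1) / t) \<longlongrightarrow> C) (at_right 0)"
    by (simp add: filterlim_at_split)
  have "\<mu> * norm u \<le> C * norm u + 0"
  proof (rule tendsto_le[OF _ _ tendsto_const])
    show "((\<lambda>t. (exp (C * t) - 1) / t * norm u + norm (quot t u - \<mu> *\<^sub>R u)) \<longlongrightarrow> C * norm u + 0) (at_right 0)"
      by (intro tendsto_add tendsto_mult e tendsto_const tendsto_norm_zero LIM_zero assms)
    have "\<forall>\<^sub>F t in at_right (0::real). 0 < t" by (simp add: eventually_at_filter)
    then show "\<forall>\<^sub>F t in at_right 0. \<mu> * norm u \<le> (exp (C * t) - 1) / t * norm u + norm (quot t u - \<mu> *\<^sub>R u)"
    proof eventually_elim
      case (elim t)
      have \<mu>0: "0 \<le> \<mu>" using C \<mu> by linarith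
      have "(1 + t * \<mu>) *\<^sub>R u = T (of_real t) $$ u - t *\<^sub>R (quot t u - \<mu> *\<^sub>R u)"
        using elim by (simp add: quot_def algebra_simps)
      then have "norm ((1 + t * \<mu>) *\<^sub>R u) \<le> norm (T (of_real t) $$ u) + norm (t *\<^sub>R (quot t u - \<mu> *\<^sub>R u))"
        by (metis norm_triangle_ineq4)
      moreover have "norm (T (of_real t) $$ u) \<le> exp (C * t) * norm u"
        using norm_app[of "T (of_real t)" u] norm_T[of "of_real t"] elim
        by (smt (verit) mult_right_mono norm_ge_zero norm_of_real of_real_cone)
      ultimately have "(1 + t * \<mu>) * norm u \<le> exp (C * t) * norm u + t * norm (quot t u - \<mu> *\<^sub>R u)"
        using elim \<mu>0 by simp
      then have "t * (\<mu> * norm u - norm (quot t u - \<mu> *\<^sub>R u)) \<le> (exp (C * t) - 1) * norm u"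
        by (simp add: algebra_simps)
      then have "\<mu> * norm u - norm (quot t u - \<mu> *\<^sub>R u) \<le> (exp (C * t) - 1) * norm u / t"
        using elim by (simp add: pos_le_divide_eq mult.commute)
      then show ?case by simp
    qed
  qed simp
  then show False using \<mu> \<open>u \<noteq> 0\<close> by simp
qed

text \<open>Since \<open>L = \<mu> *\<^sub>R R - 1 + K\<close>, applying \<mu> minus the generator
  to \<open>R $$ v\<close> gives \<open>v - K $$ v\<close>; the lemma is surjectivity of \<mu> minus
  the generator. The solution is the fixed point of a contraction.\<close>

lemma ex_preimage: "\<exists>v. v - K $$ v = h"
proof -
  have "\<exists>!v. h + K $$ v = v"
  proof (rule banach_fix_type[OF norm_ge_zero K], intro allI)
    fix v w
    have "dist (h + K $$ v) (h + K $$ w) = norm (K $$ (v - w))"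
      by (simp add: dist_norm app_simps)
    also have "\<dots> \<le> norm K * dist v w" by (simp add: norm_app dist_norm)
    finally show "dist (h + K $$ v) (h + K $$ w) \<le> norm K * dist v w" .
  qed
  then show ?thesis by (metis add_diff_cancel_right')
qed

text \<open>Why the domain is no larger than the range of \<open>R\<close>: if \<open>v\<close>
  solves the resolvent equation for \<open>u\<close>, then \<open>u - R $$ v\<close> is an
  eigenvector for \<mu>, hence zero.\<close>

lemma quot_tendstoD:
  assumes u: "((\<lambda>t. quot t u) \<longlongrightarrow> g) (at_right 0)"
  obtains v where "u = R $$ v" "g = L $$ v"
proof -
  obtain v where v: "v - K $$ v = \<mu> *\<^sub>R u - g"
    using ex_preimage by blast
  have "((\<lambda>t. quot t (u - R $$ v)) \<longlongrightarrow> g - L $$ v) (at_right 0)"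
    unfolding quot_diff by (intro tendsto_diff u quot_R_tendsto)
  moreover have Lv: "L $$ v = \<mu> *\<^sub>R (R $$ v) - (v - K $$ v)"
    by (simp add: L_def app_simps)
  then have "g - L $$ v = \<mu> *\<^sub>R (u - R $$ v)"
    by (simp add: v scaleR_diff_right)
  ultimately have "u - R $$ v = 0" by (intro eigenvector_zero) simp
  then show ?thesis using that[of v] Lv v by simp
qed

end

section \<open>Kernel operators\<close>

lemma sigma_finite_lebesgue: "sigma_finite_measure (lebesgue :: 'a::euclidean_space measure)"
proof
  obtain A :: "'a set set" where A: "countable A" "A \<subseteq> sets lborel" "\<Union>A = space lborel" "\<forall>a\<in>A. emeasure lborel a \<noteq> \<infinity>"
    using lborel.sigma_finite_countable by blast
  show "\<exists>A. countable A \<and> A \<subseteq> sets lebesgue \<and> \<Union>A = space lebesgue \<and> (\<forall>a\<in>A. emeasure (lebesgue :: 'a measure) a \<noteq> \<infinity>)"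
    using A by (intro exI[of _ A]) (auto simp: subset_iff)
qed

interpretation lebesgue: sigma_finite_measure "lebesgue :: real measure"
  by (rule sigma_finite_lebesgue)

interpretation lebesgue_pair: pair_sigma_finite "lebesgue :: real measure" "lebesgue :: real measure" ..

definition kernel_op :: "(real \<Rightarrow> real \<Rightarrow> real) \<Rightarrow> (real \<Rightarrow> 'b) \<Rightarrow> real \<Rightarrow> 'b::{banach, second_countable_topology}" where
  "kernel_op c f x = (LINT y|lebesgue. c x y *\<^sub>R f y)"

text \<open>Tonelli's theorem, with the column mass of the kernel bounded by a function
  \<open>m\<close> of \<open>y\<close>. A constant \<open>m\<close> yields bounded operators; with
  \<open>m = k * \<alpha> + C\<close> the lemma also covers the gain operator on the whole domain of
  the loss operator.\<close>

lemma
  fixes f :: "real \<Rightarrow> 'b::{banach, second_countable_topology}"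
  assumes c [measurable]: "(\<lambda>(x, y). c x y) \<in> borel_measurable (lebesgue \<Otimes>\<^sub>M lebesgue)"
    and c0: "\<And>x y. 0 \<le> c x y"
    and m: "AE y in lebesgue. (\<integral>\<^sup>+x. ennreal (c x y) \<partial>lebesgue) \<le> ennreal (m y)"
    and f [measurable]: "f \<in> borel_measurable lebesgue"
    and mf: "integrable lebesgue (\<lambda>y. m y * norm (f y))"
    and m0: "\<And>y. 0 \<le> m y"
  shows AE_integrable_kernel: "AE x in lebesgue. integrable lebesgue (\<lambda>y. c x y *\<^sub>R f y)"
    and integrable_kernel_op: "integrable lebesgue (kernel_op c f)"
    and kernel_op_bound: "(LINT x|lebesgue. norm (kernel_op c f x)) \<le> (LINT y|lebesgue. m y * norm (f y))"
proof -
  let ?F = "\<lambda>(x, y). c x y *\<^sub>R f y"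
  have F [measurable]: "?F \<in> borel_measurable (lebesgue \<Otimes>\<^sub>M lebesgue)"
    by measurable
  have le: "(\<integral>\<^sup>+x. \<integral>\<^sup>+y. ennreal (norm (c x y *\<^sub>R f y)) \<partial>lebesgue \<partial>lebesgue) \<le> ennreal (LINT y|lebesgue. m y * norm (f y))"
  proof -
    have "(\<integral>\<^sup>+x. \<integral>\<^sup>+y. ennreal (norm (c x y *\<^sub>R f y)) \<partial>lebesgue \<partial>lebesgue)
      = (\<integral>\<^sup>+y. \<integral>\<^sup>+x. ennreal (norm (c x y *\<^sub>R f y)) \<partial>lebesgue \<partial>lebesgue)"
      by (rule lebesgue_pair.Fubini') (use F in \<open>simp add: split_beta'\<close>)
    also have "\<dots> \<le> (\<integral>\<^sup>+y. ennreal (m y * norm (f y)) \<partial>lebesgue)"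
    proof (rule nn_integral_mono_AE, use m in eventually_elim)
      fix y assume y: "(\<integral>\<^sup>+x. ennreal (c x y) \<partial>lebesgue) \<le> ennreal (m y)"
      have "(\<lambda>x. c x y) \<in> borel_measurable lebesgue"
        using measurable_compose[OF measurable_Pair2'[of y lebesgue lebesgue] c] by simp
      then have "(\<integral>\<^sup>+x. ennreal (norm (c x y *\<^sub>R f y)) \<partial>lebesgue) = (\<integral>\<^sup>+x. ennreal (c x y) \<partial>lebesgue) * ennreal (norm (f y))"
        by (subst nn_integral_multc[symmetric]) (auto simp: c0 ennreal_mult'')
      also have "\<dots> \<le> ennreal (m y) * ennreal (norm (f y))"
        by (rule mult_right_mono[OF y]) simp
      finally show "(\<integral>\<^sup>+x. ennreal (norm (c x y *\<^sub>R f y)) \<partial>lebesgue) \<le> ennreal (m y * norm (f y))"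
        by (simp add: ennreal_mult'')
    qed
    also have "\<dots> = ennreal (LINT y|lebesgue. m y * norm (f y))"
      by (rule nn_integral_eq_integral[OF mf]) (simp add: m0)
    finally show ?thesis .
  qed
  have int: "integrable (lebesgue \<Otimes>\<^sub>M lebesgue) ?F"
  proof (rule integrableI_bounded[OF F])
    have "(\<integral>\<^sup>+p. ennreal (norm (?F p)) \<partial>(lebesgue \<Otimes>\<^sub>M lebesgue))
      = (\<integral>\<^sup>+x. \<integral>\<^sup>+y. ennreal (norm (c x y *\<^sub>R f y)) \<partial>lebesgue \<partial>lebesgue)"
      by (subst lebesgue.nn_integral_fst[symmetric]) auto
    with le show "(\<integral>\<^sup>+p. ennreal (norm (?F p)) \<partial>(lebesgue \<Otimes>\<^sub>M lebesgue)) < \<infinity>"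
      by (simp add: le_less_trans)
  qed
  show ae: "AE x in lebesgue. integrable lebesgue (\<lambda>y. c x y *\<^sub>R f y)"
    by (rule lebesgue_pair.AE_integrable_fst[OF int])
  show i: "integrable lebesgue (kernel_op c f)"
    unfolding kernel_op_def[abs_def] by (rule lebesgue_pair.integrable_fst[OF int])
  have "ennreal (LINT x|lebesgue. norm (kernel_op c f x)) = (\<integral>\<^sup>+x. ennreal (norm (kernel_op c f x)) \<partial>lebesgue)"
    by (rule nn_integral_eq_integral[symmetric]) (use i in auto)
  also have "\<dots> \<le> (\<integral>\<^sup>+x. \<integral>\<^sup>+y. ennreal (norm (c x y *\<^sub>R f y)) \<partial>lebesgue \<partial>lebesgue)"
    unfolding kernel_op_def
    by (rule nn_integral_mono_AE, use ae in eventually_elim) (rule integral_norm_bound_ennreal)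
  also note le
  finally show "(LINT x|lebesgue. norm (kernel_op c f x)) \<le> (LINT y|lebesgue. m y * norm (f y))"
    by (subst (asm) ennreal_le_iff) (auto intro!: integral_nonneg_AE simp: m0)
qed

lemma bounded_operator_kernel_op:
  fixes c :: "real \<Rightarrow> real \<Rightarrow> real"
  assumes c [measurable]: "(\<lambda>(x, y). c x y) \<in> borel_measurable (lebesgue \<Otimes>\<^sub>M lebesgue)"
    and c0: "\<And>x y. 0 \<le> c x y"
    and K: "AE y in lebesgue. (\<integral>\<^sup>+x. ennreal (c x y) \<partial>lebesgue) \<le> ennreal K" "0 \<le> K"
  shows "bounded_operator lebesgue (kernel_op c :: (real \<Rightarrow> complex) \<Rightarrow> _)"
    and "integrable lebesgue f \<Longrightarrow> L1_norm lebesgue (kernel_op c f :: real \<Rightarrow> complex) \<le> K * L1_norm lebesgue f"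
proof -
  have Kf: "integrable lebesgue (\<lambda>y. K * norm (f y))" if "integrable lebesgue f" for f :: "real \<Rightarrow> complex"
    using that by auto
  have m: "f \<in> borel_measurable lebesgue" if "integrable lebesgue f" for f :: "real \<Rightarrow> complex"
    using that by auto
  note * = AE_integrable_kernel[OF c c0 K(1) m Kf K(2)] integrable_kernel_op[OF c c0 K(1) m Kf K(2)]
    kernel_op_bound[OF c c0 K(1) m Kf K(2)]
  show B: "L1_norm lebesgue (kernel_op c f) \<le> K * L1_norm lebesgue f" if "integrable lebesgue f" for f :: "real \<Rightarrow> complex"
    using *(3)[OF that that] by (simp add: L1_norm_def)
  have add: "AE x in lebesgue. kernel_op c (\<lambda>x. f x + g x) x = kernel_op c f x + kernel_op c g x"
    if f: "integrable lebesgue f" and g: "integrable lebesgue g" for f g :: "real \<Rightarrow> complex"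
    using *(1)[OF f f] *(1)[OF g g]
    by eventually_elim (simp add: kernel_op_def scaleR_add_right)
  have mult: "kernel_op c (\<lambda>x. z * f x) x = z * kernel_op c f x" for f :: "real \<Rightarrow> complex" and z x
  proof -
    have "(\<lambda>y. c x y *\<^sub>R (z * f y)) = (\<lambda>y. z * (c x y *\<^sub>R f y))" by simp
    then show ?thesis unfolding kernel_op_def by (simp only: integral_mult_right_zero)
  qed
  show "bounded_operator lebesgue (kernel_op c :: (real \<Rightarrow> complex) \<Rightarrow> _)"
    unfolding bounded_operator_def L1_def ae_eq_def
    using *(2) add mult B by auto
qed

section \<open>Sums, products and the identity under \<open>lift_op\<close>\<close>

lemma bounded_operator_linear_combination:
  fixes S T :: "('a \<Rightarrow> 'k) \<Rightarrow> ('a \<Rightarrow> 'k::{real_normed_field, banach, second_countable_topology})"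
  assumes S: "bounded_operator M S" and T: "bounded_operator M T"
  shows "bounded_operator M (\<lambda>f x. a * S f x + b * T f x)"
proof -
  note I = bounded_operator_L1[OF S] bounded_operator_L1[OF T]
  obtain K K' where K: "\<And>f. integrable M f \<Longrightarrow> L1_norm M (S f) \<le> K * L1_norm M f"
    and K': "\<And>f. integrable M f \<Longrightarrow> L1_norm M (T f) \<le> K' * L1_norm M f"
    using bounded_operator_bound[OF S] bounded_operator_bound[OF T] by blast
  have "L1_norm M (\<lambda>x. a * S f x + b * T f x) \<le> (norm a * K + norm b * K') * L1_norm M f"
    if f: "integrable M f" for f
  proof -
    have "L1_norm M (\<lambda>x. a * S f x + b * T f x) \<le> (LINT x|M. norm a * norm (S f x) + norm b * norm (T f x))"
      unfolding L1_norm_def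
      by (rule integral_mono) (use I[OF f] in \<open>auto simp flip: norm_mult intro: norm_triangle_ineq\<close>)
    also have "\<dots> = norm a * L1_norm M (S f) + norm b * L1_norm M (T f)"
      unfolding L1_norm_def using I[OF f] by simp
    also have "\<dots> \<le> norm a * (K * L1_norm M f) + norm b * (K' * L1_norm M f)"
      by (intro add_mono mult_left_mono K K' f) auto
    finally show ?thesis by (simp add: algebra_simps)
  qed
  moreover have "AE x in M. a * S (\<lambda>x. f x + g x) x + b * T (\<lambda>x. f x + g x) x
      = (a * S f x + b * T f x) + (a * S g x + b * T g x)" if "integrable M f" "integrable M g" for f g
    using bounded_operator_add[OF S that] bounded_operator_add[OF T that]
    by eventually_elim (simp add: algebra_simps)
  moreover have "AE x in M. a * S (\<lambda>x. c * f x) x + b * T (\<lambda>x. c * f x) x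
      = c * (a * S f x + b * T f x)" if "integrable M f" for f c
    using bounded_operator_mult[OF S that, of c] bounded_operator_mult[OF T that, of c]
    by eventually_elim (simp add: algebra_simps)
  ultimately show ?thesis
    unfolding bounded_operator_def L1_def ae_eq_def using I by auto
qed

lemma lift_op_eqI:
  assumes "bounded_operator lebesgue T" and "\<And>u. AE x in lebesgue. fn (X $$ u) x = T (fn u) x"
  shows "X = lift_op T"
proof (rule endo_eqI)
  fix u
  show "X $$ u = lift_op T $$ u"
    unfolding l1_eq_iff using assms(2)[of u] fn_lift_op[OF assms(1), of u] by eventually_elim simp
qed

lemma lift_op_mult:
  assumes S: "bounded_operator lebesgue S" and T: "bounded_operator lebesgue T"
  shows "lift_op S * lift_op T = lift_op (\<lambda>f. S (T f))"
proof (rule endo_eqI)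
  fix u
  have "(lift_op S * lift_op T) $$ u = toL1 (S (T (fn u)))"
    using app_lift_op[OF T, of "fn u"] app_lift_op[OF S, of "T (fn u)"] bounded_operator_L1[OF T]
    by simp
  moreover have "bounded_operator lebesgue (\<lambda>f. S (T f))"
  proof -
    obtain K K' where K: "\<And>f. integrable lebesgue f \<Longrightarrow> L1_norm lebesgue (S f) \<le> K * L1_norm lebesgue f"
      and K': "\<And>f. integrable lebesgue f \<Longrightarrow> L1_norm lebesgue (T f) \<le> K' * L1_norm lebesgue f"
      using bounded_operator_bound[OF S] bounded_operator_bound[OF T] by blast
    note I = bounded_operator_L1[OF S] bounded_operator_L1[OF T]
    have "L1_norm lebesgue (S (T f)) \<le> (\<bar>K\<bar> * K') * L1_norm lebesgue f" if "integrable lebesgue f" for f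
    proof -
      have "L1_norm lebesgue (S (T f)) \<le> \<bar>K\<bar> * L1_norm lebesgue (T f)"
        by (rule order_trans[OF K[OF I(2)[OF that]] mult_right_mono]) (simp_all add: L1_norm_def)
      also have "\<dots> \<le> \<bar>K\<bar> * (K' * L1_norm lebesgue f)"
        using K'[OF that] by (intro mult_left_mono) auto
      finally show ?thesis by simp
    qed
    moreover have "AE x in lebesgue. S (T (\<lambda>x. f x + g x)) x = S (T f) x + S (T g) x"
      if f: "integrable lebesgue f" and g: "integrable lebesgue g" for f g
    proof -
      have "AE x in lebesgue. S (T (\<lambda>x. f x + g x)) x = S (\<lambda>x. T f x + T g x) x"
        by (rule bounded_operator_cong_AE[OF S _ _ bounded_operator_add[OF T f g]]) (use I f g in auto)
      with bounded_operator_add[OF S I(2)[OF f] I(2)[OF g]] show ?thesis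
        by eventually_elim simp
    qed
    moreover have "AE x in lebesgue. S (T (\<lambda>x. c * f x)) x = c * S (T f) x"
      if f: "integrable lebesgue f" for f c
    proof -
      have "AE x in lebesgue. S (T (\<lambda>x. c * f x)) x = S (\<lambda>x. c * T f x) x"
        by (rule bounded_operator_cong_AE[OF S _ _ bounded_operator_mult[OF T f]]) (use I f in auto)
      with bounded_operator_mult[OF S I(2)[OF f], of c] show ?thesis
        by eventually_elim simp
    qed
    ultimately show ?thesis
      unfolding bounded_operator_def L1_def ae_eq_def using I by auto
  qed
  then have "lift_op (\<lambda>f. S (T f)) $$ u = toL1 (S (T (fn u)))"
    using app_lift_op[of "\<lambda>f. S (T f)" "fn u"] by simp
  ultimately show "(lift_op S * lift_op T) $$ u = lift_op (\<lambda>f. S (T f)) $$ u" by simp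
qed

lemma bounded_operator_id: "bounded_operator M (\<lambda>f. f)"
  unfolding bounded_operator_def L1_def ae_eq_def by (auto intro: exI[of _ 1])

lemma lift_op_id: "lift_op (\<lambda>f. f) = 1"
  by (rule lift_op_eqI[OF bounded_operator_id, symmetric]) simp

lemma lift_op_linear_combination:
  assumes S: "bounded_operator lebesgue S" and T: "bounded_operator lebesgue T"
  shows "lift_op (\<lambda>f x. z * S f x + w * T f x) = sc z * lift_op S + sc w * lift_op T"
proof (rule lift_op_eqI[symmetric, OF bounded_operator_linear_combination[OF S T]])
  fix u
  show "AE x in lebesgue. fn ((sc z * lift_op S + sc w * lift_op T) $$ u) x = z * S (fn u) x + w * T (fn u) x"
    unfolding app_simps app_mult
    using fn_add[of "sc z $$ lift_op S $$ u" "sc w $$ lift_op T $$ u"] fn_sc[of z "lift_op S $$ u"]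
      fn_sc[of w "lift_op T $$ u"] fn_lift_op[OF S, of u] fn_lift_op[OF T, of u]
    by eventually_elim simp
qed

section \<open>Positive elements\<close>

definition pos :: "l1 set" where
  "pos = {u. AE x in lebesgue. fn u x = of_real (norm (fn u x))}"

text \<open>Exhibits the positive cone as the equality set of two continuous functions.\<close>

lemma pos_iff_norm: "u \<in> pos \<longleftrightarrow> norm u = Re (LINT x|lebesgue. fn u x)"
proof -
  have "norm u - Re (LINT x|lebesgue. fn u x) = (LINT x|lebesgue. norm (fn u x) - Re (fn u x))"
    by (simp add: norm_l1_def integrable_Re)
  then have "norm u = Re (LINT x|lebesgue. fn u x) \<longleftrightarrow> (LINT x|lebesgue. norm (fn u x) - Re (fn u x)) = 0"
    by linarith
  also have "\<dots> \<longleftrightarrow> (AE x in lebesgue. norm (fn u x) - Re (fn u x) = 0)"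
    by (rule integral_nonneg_eq_0_iff_AE) (auto simp: complex_Re_le_cmod integrable_Re)
  finally have "norm u = Re (LINT x|lebesgue. fn u x) \<longleftrightarrow> (AE x in lebesgue. norm (fn u x) - Re (fn u x) = 0)" .
  moreover have "norm z - Re z = 0 \<longleftrightarrow> z = of_real (norm z)" for z :: complex
    using cmod_power2[of z] by (auto simp: complex_eq_iff)
  ultimately show ?thesis by (simp only: pos_def mem_Collect_eq)
qed

lemma closed_pos: "closed pos"
proof -
  have "bounded_linear (\<lambda>u. LINT x|lebesgue. fn u x)"
  proof (rule bounded_linear_intro[where K = 1])
    fix u v :: l1 and r :: real
    have "(LINT x|lebesgue. fn (u + v) x) = (LINT x|lebesgue. fn u x + fn v x)"
      by (rule integral_cong_AE) (use fn_add[of u v] in auto)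
    then show "(LINT x|lebesgue. fn (u + v) x) = (LINT x|lebesgue. fn u x) + (LINT x|lebesgue. fn v x)"
      by simp
    have "(LINT x|lebesgue. fn (r *\<^sub>R u) x) = (LINT x|lebesgue. r *\<^sub>R fn u x)"
      by (rule integral_cong_AE) (use fn_scaleR[of r u] in auto)
    then show "(LINT x|lebesgue. fn (r *\<^sub>R u) x) = r *\<^sub>R (LINT x|lebesgue. fn u x)"
      by simp
    show "norm (LINT x|lebesgue. fn u x) \<le> norm u * 1"
      by (simp add: norm_l1_def integral_norm_bound)
  qed
  then have "continuous_on UNIV (\<lambda>u. Re (LINT x|lebesgue. fn u x))"
    by (intro continuous_on_Re linear_continuous_on)
  then have "closed {u. norm u = Re (LINT x|lebesgue. fn u x)}"
    by (intro closed_Collect_eq continuous_on_norm_id)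
  moreover have "pos = {u. norm u = Re (LINT x|lebesgue. fn u x)}"
    using pos_iff_norm by blast
  ultimately show ?thesis by simp
qed

lemma pos_add: "u \<in> pos \<Longrightarrow> v \<in> pos \<Longrightarrow> u + v \<in> pos"
  unfolding pos_def mem_Collect_eq
proof -
  assume "AE x in lebesgue. fn u x = of_real (norm (fn u x))" "AE x in lebesgue. fn v x = of_real (norm (fn v x))"
  with fn_add[of u v] show "AE x in lebesgue. fn (u + v) x = of_real (norm (fn (u + v) x))"
  proof eventually_elim
    case (elim x)
    then have "fn (u + v) x = of_real (norm (fn u x) + norm (fn v x))" by simp
    then show ?case by (metis abs_of_nonneg add_nonneg_nonneg norm_ge_zero norm_of_real)
  qed
qed

lemma pos_scaleR: "u \<in> pos \<Longrightarrow> 0 \<le> r \<Longrightarrow> r *\<^sub>R u \<in> pos"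
  unfolding pos_def mem_Collect_eq
  by (drule eventually_conj[OF fn_scaleR[of r u]], erule eventually_mono)
    (metis abs_of_nonneg norm_scaleR of_real_mult scaleR_conv_of_real)

lemma pos_0: "0 \<in> pos"
  unfolding pos_def mem_Collect_eq using fn_zero by eventually_elim simp

lemma exp_pos:
  assumes X: "\<And>u. u \<in> pos \<Longrightarrow> X $$ u \<in> pos" and u: "u \<in> pos"
  shows "exp X $$ u \<in> pos"
proof -
  have Xn: "(X ^ n) $$ u \<in> pos" for n
    by (induction n) (use u X in auto)
  have "(\<lambda>n. (X ^ n /\<^sub>R fact n) $$ u) sums (exp X $$ u)"
    by (rule bounded_linear.sums[OF app.bounded_linear_left exp_converges])
  then have "(\<lambda>N. \<Sum>n<N. (X ^ n /\<^sub>R fact n) $$ u) \<longlonglongrightarrow> exp X $$ u"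
    by (simp add: sums_def)
  moreover have "(\<Sum>n<N. (X ^ n /\<^sub>R fact n) $$ u) \<in> pos" for N
    by (induction N) (auto intro!: pos_0 pos_add pos_scaleR Xn simp: app_simps)
  ultimately show ?thesis
    by (rule closed_sequentially[OF closed_pos, rotated])
qed

lemma exp_scaleR_one: "exp (r *\<^sub>R 1) = exp r *\<^sub>R (1 :: 'a::{real_normed_algebra_1, banach})"
  using exp_of_real[of r, where 'a = 'a] by (simp add: of_real_def)

section \<open>The fragmentation semigroup on the line\<close>

text \<open>The square of the right-hand side exceeds that of the left by exactly (Re w -
  |w|^2/2)^2. In the Euler step the linear term -Re w is what pays for the gain.\<close>

lemma norm_one_minus_le: "norm (1 - w) \<le> 1 - Re w + (norm w)\<^sup>2 / 2" for w :: complex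
proof (rule power2_le_imp_le)
  have "(norm (1 - w))\<^sup>2 = 1 - 2 * Re w + (norm w)\<^sup>2"
    unfolding cmod_power2 by (simp add: power2_eq_square algebra_simps)
  also have "\<dots> \<le> (1 - 2 * Re w + (norm w)\<^sup>2) + (Re w - (norm w)\<^sup>2 / 2)\<^sup>2" by simp
  also have "\<dots> = (1 - Re w + (norm w)\<^sup>2 / 2)\<^sup>2"
    by (simp add: power2_eq_square algebra_simps)
  finally show "(norm (1 - w))\<^sup>2 \<le> (1 - Re w + (norm w)\<^sup>2 / 2)\<^sup>2" .
  have "2 * Re w \<le> (Re w)\<^sup>2 + 1"
    using sum_squares_bound[of "Re w" 1] by simp
  moreover have "(Re w)\<^sup>2 \<le> (norm w)\<^sup>2" by (simp add: cmod_power2)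
  ultimately show "0 \<le> 1 - Re w + (norm w)\<^sup>2 / 2" by linarith
qed

lemma lebesgue_borel_measurable_id [measurable]: "(\<lambda>x::real. x) \<in> borel_measurable lebesgue"
  by (rule measurable_completion) simp

lemma borel_measurable_kernel_section:
  fixes c :: "real \<Rightarrow> real \<Rightarrow> real"
  assumes "(\<lambda>(x, y). c x y) \<in> borel_measurable (lebesgue \<Otimes>\<^sub>M lebesgue)"
  shows "c x \<in> borel_measurable lebesgue" "(\<lambda>x. c x y) \<in> borel_measurable lebesgue"
  using measurable_compose[OF measurable_Pair1'[of x lebesgue lebesgue] assms]
    measurable_compose[OF measurable_Pair2'[of y lebesgue lebesgue] assms] by simp_all

lemma kernel_op_cong_AE:
  fixes f g :: "real \<Rightarrow> 'b::{banach, second_countable_topology}"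
  assumes c: "(\<lambda>(x, y). c x y) \<in> borel_measurable (lebesgue \<Otimes>\<^sub>M lebesgue)"
    and [measurable]: "f \<in> borel_measurable lebesgue" "g \<in> borel_measurable lebesgue"
    and "AE y in lebesgue. f y = g y"
  shows "kernel_op c f x = kernel_op c g x"
proof -
  note [measurable] = borel_measurable_kernel_section(1)[OF c, of x]
  show ?thesis
    unfolding kernel_op_def by (rule integral_cong_AE) (use assms(4) in auto)
qed

text \<open>\<open>\<alpha>\<close> is the loss rate and \<open>c\<close> the gain kernel with the
  rate already included, both acting on functions multiplied by the weight. \<open>c_bound\<close>
  is the relative bound of the gain by the loss, expressed through column masses. The sign and
  support conditions hold everywhere, not just a.e., so that truncations can be computed
  pointwise.\<close>

locale fragmentation =
  fixes \<alpha> :: "real \<Rightarrow> real" and c :: "real \<Rightarrow> real \<Rightarrow> real" and k C :: real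
  assumes \<alpha>_meas [measurable]: "\<alpha> \<in> borel_measurable lebesgue"
    and \<alpha>_nonneg: "\<And>x. 0 \<le> \<alpha> x"
    and \<alpha>_locally_bounded: "\<And>n::nat. \<exists>B. AE x in lebesgue. x \<le> n \<longrightarrow> \<alpha> x \<le> B"
    and c_meas [measurable]: "(\<lambda>(x, y). c x y) \<in> borel_measurable (lebesgue \<Otimes>\<^sub>M lebesgue)"
    and c_nonneg: "\<And>x y. 0 \<le> c x y"
    and c_lower: "\<And>x y. y \<le> x \<Longrightarrow> c x y = 0"
    and c_bound: "AE y in lebesgue. (\<integral>\<^sup>+x. ennreal (c x y) \<partial>lebesgue) \<le> ennreal (k * \<alpha> y + C)"
    and k: "0 < k" "k < 1" and C: "0 \<le> C"
begin

definition \<alpha>\<^sub>n :: "nat \<Rightarrow> real \<Rightarrow> real" where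
  "\<alpha>\<^sub>n n x = (if x \<le> n then \<alpha> x else 0)"

text \<open>Cutting in \<open>y\<close> alone also confines \<open>x\<close>: by
  \<open>c_lower\<close> only \<open>x < y\<close> contributes. This is why truncated vectors stay
  truncated, see \<open>cut_gen\<close>.\<close>

definition c\<^sub>n :: "nat \<Rightarrow> real \<Rightarrow> real \<Rightarrow> real" where
  "c\<^sub>n n x y = (if y \<le> n then c x y else 0)"

definition cut :: "nat \<Rightarrow> real \<Rightarrow> complex" where
  "cut n x = (if x \<le> n then 1 else 0)"

text \<open>The explicit factors \<open>1\<close> and \<open>- 1\<close> make the body an instance
  of \<open>bounded_operator_linear_combination\<close>.\<close>

definition gen :: "nat \<Rightarrow> (real \<Rightarrow> complex) \<Rightarrow> real \<Rightarrow> complex" where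
  "gen n f x = 1 * kernel_op (c\<^sub>n n) f x + (- 1) * (of_real (\<alpha>\<^sub>n n x) * f x)"

definition G :: "nat \<Rightarrow> l1 endo" where "G n = lift_op (gen n)"

definition P :: "nat \<Rightarrow> l1 endo" where "P n = mul (cut n)"

abbreviation "\<mu> \<equiv> C + 1"

definition R :: "l1 endo" where "R = mul (\<lambda>x. of_real (1 / (\<mu> + \<alpha> x)))"

definition K :: "l1 endo" where "K = lift_op (kernel_op (\<lambda>x y. c x y / (\<mu> + \<alpha> y)))"

lemma \<mu>_pos: "0 < \<mu> + \<alpha> x"
  using C \<alpha>_nonneg[of x] by linarith

lemma \<alpha>\<^sub>n_meas [measurable]: "\<alpha>\<^sub>n n \<in> borel_measurable lebesgue"
  unfolding \<alpha>\<^sub>n_def[abs_def] by measurable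

lemma cut_meas [measurable]: "cut n \<in> borel_measurable lebesgue"
  unfolding cut_def[abs_def] by measurable

lemma c\<^sub>n_meas [measurable]: "(\<lambda>(x, y). c\<^sub>n n x y) \<in> borel_measurable (lebesgue \<Otimes>\<^sub>M lebesgue)"
proof -
  have [measurable]: "snd \<in> borel_measurable (lebesgue \<Otimes>\<^sub>M (lebesgue :: real measure))"
    using measurable_compose[OF measurable_snd lebesgue_borel_measurable_id] by simp
  show ?thesis
    using c_meas unfolding c\<^sub>n_def[abs_def] split_beta' by measurable
qed

lemma \<alpha>\<^sub>n_nonneg: "0 \<le> \<alpha>\<^sub>n n x"
  by (simp add: \<alpha>\<^sub>n_def \<alpha>_nonneg)

lemma c\<^sub>n_nonneg: "0 \<le> c\<^sub>n n x y"
  by (simp add: c\<^sub>n_def c_nonneg)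

lemma \<alpha>\<^sub>n_bounded:
  obtains B where "0 \<le> B" "AE x in lebesgue. \<alpha>\<^sub>n n x \<le> B"
proof -
  obtain B where "AE x in lebesgue. x \<le> n \<longrightarrow> \<alpha> x \<le> B"
    using \<alpha>_locally_bounded by blast
  then have "AE x in lebesgue. \<alpha>\<^sub>n n x \<le> \<bar>B\<bar>"
    by eventually_elim (auto simp: \<alpha>\<^sub>n_def)
  then show ?thesis using that[of "\<bar>B\<bar>"] by simp
qed

lemma c\<^sub>n_bound:
  assumes "AE y in lebesgue. (\<integral>\<^sup>+x. ennreal (c x y) \<partial>lebesgue) \<le> ennreal (k' * \<alpha> y + C')"
  shows "AE y in lebesgue. (\<integral>\<^sup>+x. ennreal (c\<^sub>n n x y) \<partial>lebesgue) \<le> ennreal (k' * \<alpha>\<^sub>n n y + C')"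
  using assms by eventually_elim (auto simp: c\<^sub>n_def \<alpha>\<^sub>n_def)

lemma bounded_operator_c\<^sub>n: "bounded_operator lebesgue (kernel_op (c\<^sub>n n) :: (real \<Rightarrow> complex) \<Rightarrow> _)"
proof -
  obtain B where B: "0 \<le> B" "AE x in lebesgue. \<alpha>\<^sub>n n x \<le> B" by (rule \<alpha>\<^sub>n_bounded)
  have "AE y in lebesgue. (\<integral>\<^sup>+x. ennreal (c\<^sub>n n x y) \<partial>lebesgue) \<le> ennreal (k * B + C)"
    using c\<^sub>n_bound[OF c_bound, of n] B(2)
  proof eventually_elim
    case (elim y)
    have "k * \<alpha>\<^sub>n n y + C \<le> k * B + C" using elim k by (simp add: mult_left_mono)
    with elim(1) show ?case by (meson ennreal_leI order_trans)
  qed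
  then show ?thesis
    by (rule bounded_operator_kernel_op(1)[OF c\<^sub>n_meas c\<^sub>n_nonneg]) (use k B C in simp)
qed

lemma bounded_operator_\<alpha>\<^sub>n: "bounded_operator lebesgue (\<lambda>f x. complex_of_real (\<alpha>\<^sub>n n x) * f x)"
proof -
  obtain B where "0 \<le> B" "AE x in lebesgue. \<alpha>\<^sub>n n x \<le> B" by (rule \<alpha>\<^sub>n_bounded)
  then show ?thesis
    by (intro bounded_operator_multiplication(1)[where K = B]) (auto simp: \<alpha>\<^sub>n_nonneg)
qed

lemma bounded_operator_gen: "bounded_operator lebesgue (gen n)"
  unfolding gen_def[abs_def]
  by (rule bounded_operator_linear_combination[OF bounded_operator_c\<^sub>n bounded_operator_\<alpha>\<^sub>n])

lemma bounded_operator_cut: "bounded_operator lebesgue (\<lambda>f x. cut n x * f x)"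
  by (rule bounded_operator_multiplication(1)[where K = 1]) (auto simp: cut_def)

lemma R_bound: "norm (complex_of_real (1 / (\<mu> + \<alpha> x))) \<le> 1"
proof -
  have "1 \<le> \<mu> + \<alpha> x" using C \<alpha>_nonneg[of x] by linarith
  then show ?thesis unfolding norm_of_real by simp
qed

lemma bounded_operator_R: "bounded_operator lebesgue (\<lambda>f x. complex_of_real (1 / (\<mu> + \<alpha> x)) * f x)"
  by (rule bounded_operator_multiplication(1)[where K = 1]) (use R_bound in auto)

text \<open>A bound for the column masses of the kernel of \<open>K\<close>. Comparing
  \<open>k * \<alpha> x + C\<close> with \<open>\<mu> + \<alpha> x\<close> coefficient by
  coefficient gives the ratios \<open>k\<close> and \<open>C / \<mu>\<close>; the latter is below 1
  because \<open>\<mu>\<close> is \<open>C + 1\<close>.\<close>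

definition q :: real where "q = max k (C / \<mu>)"

lemma q: "0 \<le> q" "q < 1" "k * \<alpha> x + C \<le> q * (\<mu> + \<alpha> x)"
proof -
  have "k * \<alpha> x \<le> q * \<alpha> x" by (rule mult_right_mono) (auto simp: q_def \<alpha>_nonneg)
  moreover have "C / \<mu> \<le> q" by (simp add: q_def)
  then have "C \<le> q * \<mu>" using C by (simp add: pos_divide_le_eq)
  ultimately show "k * \<alpha> x + C \<le> q * (\<mu> + \<alpha> x)" using C by (simp add: algebra_simps)
  show "0 \<le> q" "q < 1" using k C by (auto simp: q_def)
qed

lemma K_meas [measurable]:
  "(\<lambda>(x, y). c x y / (\<mu> + \<alpha> y)) \<in> borel_measurable (lebesgue \<Otimes>\<^sub>M lebesgue)"
  unfolding split_beta' by measurable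

lemma K_nonneg: "0 \<le> c x y / (\<mu> + \<alpha> y)"
  using c_nonneg \<mu>_pos[of y] by simp

lemma K_bound: "AE y in lebesgue. (\<integral>\<^sup>+x. ennreal (c x y / (\<mu> + \<alpha> y)) \<partial>lebesgue) \<le> ennreal q"
  using c_bound
proof eventually_elim
  case (elim y)
  note [measurable] = borel_measurable_kernel_section(2)[OF c_meas, of y]
  have "(\<integral>\<^sup>+x. ennreal (c x y / (\<mu> + \<alpha> y)) \<partial>lebesgue) = (\<integral>\<^sup>+x. ennreal (c x y) * ennreal (1 / (\<mu> + \<alpha> y)) \<partial>lebesgue)"
    using \<mu>_pos[of y] c_nonneg by (intro nn_integral_cong) (simp flip: ennreal_mult)
  also have "\<dots> = (\<integral>\<^sup>+x. ennreal (c x y) \<partial>lebesgue) * ennreal (1 / (\<mu> + \<alpha> y))"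
    by (rule nn_integral_multc) simp
  also have "\<dots> \<le> ennreal (q * (\<mu> + \<alpha> y)) * ennreal (1 / (\<mu> + \<alpha> y))"
    by (intro mult_right_mono order_trans[OF elim] ennreal_leI q) simp
  also have "\<dots> = ennreal q"
    using \<mu>_pos[of y] q(1) by (simp flip: ennreal_mult)
  finally show ?case .
qed

lemmas bounded_operator_K = bounded_operator_kernel_op[OF K_meas K_nonneg K_bound q(1)]

text \<open>The constants are left free because two pairs are used: \<open>k\<close> and
  \<open>C\<close> for the cone, and 1 and 0 for contractivity, where the condition on
  \<open>z\<close> just says that \<open>z\<close> is real and nonnegative.\<close>

lemma norm_exp_G_general:
  assumes bound: "AE y in lebesgue. (\<integral>\<^sup>+x. ennreal (c x y) \<partial>lebesgue) \<le> ennreal (k' * \<alpha> y + C')"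
    and k': "0 \<le> k'" "0 \<le> C'" and z: "k' * norm z \<le> Re z"
  shows "norm (exp (sc z * G n)) \<le> exp (C' * norm z)"
proof -
  obtain B where B: "0 \<le> B" "AE x in lebesgue. \<alpha>\<^sub>n n x \<le> B" by (rule \<alpha>\<^sub>n_bounded)
  show ?thesis
  \<comment> \<open>\<open>B\<close> depends on the truncation, but the quadratic constant is absent
    from the conclusion of the Euler lemma, so the final bound does not.\<close>
  proof (rule norm_exp_le_of_Euler[where K = "(norm z * B)\<^sup>2 / 2"])
    fix N :: nat assume N: "0 < N"
    define w where "w = z / of_nat N"
    have wn: "norm w = norm z / N" and wr: "Re w = Re z / N"
      using N by (simp_all add: w_def norm_divide)
    have kw: "k' * norm w \<le> Re w"
      unfolding wn wr using z N by (simp add: divide_right_mono)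
    have "w = of_real (inverse (real N)) * z"
      by (simp add: w_def divide_inverse mult.commute)
    then have "sc w = sc z /\<^sub>R N"
      by (simp only: sc_mult sc_of_real) simp
    moreover have "sc 1 = 1" using sc_of_real[of 1] by simp
    ultimately have eq: "1 + (sc z * G n) /\<^sub>R N = lift_op (\<lambda>f x. 1 * f x + w * gen n f x)"
      using lift_op_linear_combination[OF bounded_operator_id bounded_operator_gen, of 1 w n] by (simp add: lift_op_id G_def)
    let ?M = "1 + C' * norm z / N + (norm z * B)\<^sup>2 / 2 / (real N)\<^sup>2"
    have "0 \<le> ?M" using k' by simp
    show "norm (1 + (sc z * G n) /\<^sub>R N) \<le> ?M"
      unfolding eq
    proof (rule norm_lift_op_le[OF bounded_operator_linear_combination[OF bounded_operator_id bounded_operator_gen] \<open>0 \<le> ?M\<close>])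
      fix f :: "real \<Rightarrow> complex" assume f: "integrable lebesgue f"
      note [measurable] = borel_measurable_integrable[OF f]
      let ?m = "\<lambda>y. k' * \<alpha>\<^sub>n n y + C'"
      have m0: "0 \<le> ?m y" for y using k' \<alpha>\<^sub>n_nonneg by simp
      have mf: "integrable lebesgue (\<lambda>y. ?m y * norm (f y))"
      proof (rule Bochner_Integration.integrable_bound)
        show "integrable lebesgue (\<lambda>y. (k' * B + C') * norm (f y))" using f by auto
        show "AE y in lebesgue. norm (?m y * norm (f y)) \<le> norm ((k' * B + C') * norm (f y))"
          using B(2) by eventually_elim
            (use B(1) k' m0 in \<open>auto simp: abs_mult intro!: mult_right_mono mult_left_mono\<close>)
      qed measurable
      note Ck = integrable_kernel_op[OF c\<^sub>n_meas c\<^sub>n_nonneg c\<^sub>n_bound[OF bound] _ mf m0]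
        kernel_op_bound[OF c\<^sub>n_meas c\<^sub>n_nonneg c\<^sub>n_bound[OF bound] _ mf m0]
      have kf: "integrable lebesgue (kernel_op (c\<^sub>n n) f)" by (rule Ck) measurable
      let ?g = "\<lambda>x. (1 - w * of_real (\<alpha>\<^sub>n n x)) * f x"
      have g: "integrable lebesgue ?g"
        using bounded_operator_L1[OF bounded_operator_\<alpha>\<^sub>n f, of n] f by (simp add: algebra_simps)
      have "L1_norm lebesgue (\<lambda>x. 1 * f x + w * gen n f x) \<le> (LINT x|lebesgue. norm (?g x) + norm w * norm (kernel_op (c\<^sub>n n) f x))"
        unfolding L1_norm_def
      proof (rule integral_mono)
        show "integrable lebesgue (\<lambda>x. norm (1 * f x + w * gen n f x))"
          using bounded_operator_L1[OF bounded_operator_gen f] f by simp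
        show "integrable lebesgue (\<lambda>x. norm (?g x) + norm w * norm (kernel_op (c\<^sub>n n) f x))"
          using g kf by simp
        fix x
        have "1 * f x + w * gen n f x = ?g x + w * kernel_op (c\<^sub>n n) f x"
          by (simp add: gen_def algebra_simps)
        then show "norm (1 * f x + w * gen n f x) \<le> norm (?g x) + norm w * norm (kernel_op (c\<^sub>n n) f x)"
          by (metis norm_mult norm_triangle_ineq)
      qed
      also have "\<dots> = (LINT x|lebesgue. norm (?g x)) + norm w * (LINT x|lebesgue. norm (kernel_op (c\<^sub>n n) f x))"
        using g kf by simp
      also have "\<dots> \<le> (LINT x|lebesgue. norm (?g x)) + norm w * (LINT y|lebesgue. ?m y * norm (f y))"
        by (intro add_left_mono mult_left_mono Ck(2)) auto
      also have "\<dots> = (LINT x|lebesgue. norm (?g x) + norm w * (?m x * norm (f x)))"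
        using g mf by simp
      also have "\<dots> \<le> (LINT x|lebesgue. ?M * norm (f x))"
      proof (rule integral_mono_AE)
        show "AE x in lebesgue. norm (?g x) + norm w * (?m x * norm (f x)) \<le> ?M * norm (f x)"
          using B(2)
        proof eventually_elim
          case (elim x)
          let ?a = "\<alpha>\<^sub>n n x"
          have a0: "0 \<le> ?a" by (rule \<alpha>\<^sub>n_nonneg)
          have "norm (1 - w * of_real ?a) \<le> 1 - Re w * ?a + (norm w * ?a)\<^sup>2 / 2"
            using norm_one_minus_le[of "w * of_real ?a"] a0 by (simp add: norm_mult)
          moreover have "(norm w * ?a)\<^sup>2 \<le> (norm w * B)\<^sup>2"
            using elim a0 by (intro power_mono mult_left_mono) auto
          \<comment> \<open>Here the loss absorbs the gain; this is where the condition on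
            \<open>z\<close> enters.\<close>
          moreover have "norm w * (k' * ?a) \<le> Re w * ?a"
            using mult_right_mono[OF kw a0] by (simp add: mult_ac)
          ultimately have "norm (1 - w * of_real ?a) + norm w * ?m x \<le> 1 + C' * norm w + (norm w * B)\<^sup>2 / 2"
            by (simp add: algebra_simps)
          also have "\<dots> = ?M" using N by (simp add: wn power_mult_distrib power_divide)
          finally have "(norm (1 - w * of_real ?a) + norm w * ?m x) * norm (f x) \<le> ?M * norm (f x)"
            by (rule mult_right_mono) simp
          then show ?case unfolding norm_mult by (simp only: distrib_right mult.assoc)
        qed
      qed (use g mf f in auto)
      finally show "L1_norm lebesgue (\<lambda>x. 1 * f x + w * gen n f x) \<le> ?M * L1_norm lebesgue f"
        by (simp add: L1_norm_def)
    qed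
  qed
qed

lemma P_strong_lim: "strong_lim P 1"
  unfolding strong_lim_def
proof
  fix u
  have eq: "norm (P n $$ u - 1 $$ u) = (LINT x|lebesgue. norm (cut n x * fn u x - fn u x))" for n
    unfolding norm_l1_def app_one
    by (rule integral_cong_AE)
      (use fn_diff[of "P n $$ u" u] fn_lift_op[OF bounded_operator_cut, of n u] in \<open>auto simp: P_def mul_def\<close>)
  have "(\<lambda>n. LINT x|lebesgue. norm (cut n x * fn u x - fn u x)) \<longlonglongrightarrow> integral\<^sup>L (lebesgue :: real measure) (\<lambda>x. 0)"
  proof (rule integral_dominated_convergence[where w = "\<lambda>x. norm (fn u x)"])
    show "AE x in lebesgue. (\<lambda>n. norm (cut n x * fn u x - fn u x)) \<longlonglongrightarrow> 0"
    proof (intro AE_I2 tendsto_eventually)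
      fix x :: real
      show "\<forall>\<^sub>F n in sequentially. norm (cut n x * fn u x - fn u x) = 0"
        using eventually_ge_at_top[of "nat \<lceil>x\<rceil>"]
      proof eventually_elim
        case (elim n)
        then have "x \<le> n" using real_nat_ceiling_ge[of x] by linarith
        then show ?case by (simp add: cut_def)
      qed
    qed
    show "AE x in lebesgue. norm (norm (cut n x * fn u x - fn u x)) \<le> norm (fn u x)" for n
      by (simp add: cut_def)
  qed auto
  then have "(\<lambda>n. norm (P n $$ u - 1 $$ u)) \<longlonglongrightarrow> 0" unfolding eq by simp
  then show "(\<lambda>n. P n $$ u) \<longlonglongrightarrow> 1 $$ u"
    by (rule LIM_zero_cancel[OF tendsto_norm_zero_cancel])
qed

lemma kernel_op_cut: "kernel_op c' (\<lambda>y. cut n y * f y) = kernel_op (\<lambda>x y. if y \<le> n then c' x y else 0) f"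
  unfolding kernel_op_def[abs_def]
  by (intro ext Bochner_Integration.integral_cong) (auto simp: cut_def)

lemma gen_cut: "m \<le> n \<Longrightarrow> gen n (\<lambda>x. cut m x * f x) = gen m f"
proof -
  assume "m \<le> n"
  then have "(\<lambda>x y. if y \<le> real m then c\<^sub>n n x y else 0) = c\<^sub>n m"
    by (auto simp: c\<^sub>n_def fun_eq_iff)
  then show ?thesis
    using \<open>m \<le> n\<close> unfolding gen_def[abs_def] kernel_op_cut by (auto simp: \<alpha>\<^sub>n_def cut_def fun_eq_iff)
qed

lemma cut_gen: "(\<lambda>x. cut m x * gen m f x) = gen m f"
proof
  fix x :: real
  have "kernel_op (c\<^sub>n m) f x = 0" if "\<not> x \<le> m"
  proof -
    have "(\<lambda>y. c\<^sub>n m x y *\<^sub>R f y) = (\<lambda>y. 0)"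
      using that c_lower[of _ x] by (auto simp: c\<^sub>n_def fun_eq_iff)
    then show ?thesis by (simp add: kernel_op_def)
  qed
  then show "cut m x * gen m f x = gen m f x"
    by (auto simp: gen_def cut_def \<alpha>\<^sub>n_def)
qed

text \<open>With \<rho> = 1/(\<mu> + \<alpha>) one has \<mu> \<rho> - 1 = - \<alpha> \<rho>, so
  \<open>\<mu> *\<^sub>R R - 1\<close> is the loss part applied after \<open>R\<close>, and
  \<open>K\<close> is the gain part applied after \<open>R\<close>. Truncating the coefficients on
  the left amounts to truncating the argument on the right.\<close>

lemma G_R: "G n * R = (\<mu> *\<^sub>R R - 1 + K) * P n"
proof -
  define \<rho> where "\<rho> x = complex_of_real (1 / (\<mu> + \<alpha> x))" for x
  have R': "R = lift_op (\<lambda>f x. \<rho> x * f x)" "bounded_operator lebesgue (\<lambda>f x. \<rho> x * f x)"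
    using bounded_operator_R by (simp_all add: R_def mul_def \<rho>_def)
  note lc = bounded_operator_linear_combination[OF R'(2) bounded_operator_id, of "of_real \<mu>" "-1"]
  note lc2 = bounded_operator_linear_combination[OF lc bounded_operator_K(1), of 1 1]
  have sc1: "sc 1 = 1" "sc (- 1) = - 1"
    using sc_of_real[of 1] sc_of_real[of "-1"] by simp_all
  have "\<mu> *\<^sub>R R - 1 + K = lift_op (\<lambda>f x. 1 * (of_real \<mu> * (\<rho> x * f x) + (- 1) * f x)
      + 1 * kernel_op (\<lambda>x y. c x y / (\<mu> + \<alpha> y)) f x)"
    unfolding lift_op_linear_combination[OF lc bounded_operator_K(1)]
      lift_op_linear_combination[OF R'(2) bounded_operator_id] sc1 sc_of_real lift_op_id
    by (simp add: R'(1) K_def)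
  then have "(\<mu> *\<^sub>R R - 1 + K) * P n = lift_op (\<lambda>f x. 1 * (of_real \<mu> * (\<rho> x * (cut n x * f x)) + (- 1) * (cut n x * f x))
      + 1 * kernel_op (\<lambda>x y. c x y / (\<mu> + \<alpha> y)) (\<lambda>x. cut n x * f x) x)"
    unfolding P_def mul_def by (simp only: lift_op_mult[OF lc2 bounded_operator_cut])
  moreover have "G n * R = lift_op (\<lambda>f. gen n (\<lambda>x. \<rho> x * f x))"
    unfolding G_def R'(1) by (rule lift_op_mult[OF bounded_operator_gen R'(2)])
  moreover have "gen n (\<lambda>x. \<rho> x * f x) = (\<lambda>x. 1 * (of_real \<mu> * (\<rho> x * (cut n x * f x)) + (- 1) * (cut n x * f x))
      + 1 * kernel_op (\<lambda>x y. c x y / (\<mu> + \<alpha> y)) (\<lambda>x. cut n x * f x) x)" for f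
  proof
    fix x
    have "kernel_op (c\<^sub>n n) (\<lambda>x. \<rho> x * f x) x = kernel_op (\<lambda>x y. c x y / (\<mu> + \<alpha> y)) (\<lambda>x. cut n x * f x) x"
      unfolding kernel_op_def
      by (rule Bochner_Integration.integral_cong)
        (auto simp: c\<^sub>n_def cut_def \<rho>_def scaleR_conv_of_real)
    moreover have "of_real \<mu> * \<rho> x - 1 = - of_real (\<alpha> x) * \<rho> x"
    proof -
      have "complex_of_real (\<mu> + \<alpha> x) * \<rho> x = 1"
        using \<mu>_pos[of x] unfolding \<rho>_def of_real_mult[symmetric] by simp
      then show ?thesis by (simp add: algebra_simps)
    qed
    then have "cut n x * f x * (of_real \<mu> * \<rho> x - 1) = - of_real (\<alpha>\<^sub>n n x) * \<rho> x * f x"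
      by (simp add: cut_def \<alpha>\<^sub>n_def)
    ultimately show "gen n (\<lambda>x. \<rho> x * f x) x = 1 * (of_real \<mu> * (\<rho> x * (cut n x * f x)) + (- 1) * (cut n x * f x))
      + 1 * kernel_op (\<lambda>x y. c x y / (\<mu> + \<alpha> y)) (\<lambda>x. cut n x * f x) x"
      by (simp add: gen_def algebra_simps)
  qed
  ultimately show ?thesis by simp
qed

sublocale resolvent_generator P G k C R K \<mu>
proof
  show "strong_lim P 1" by (rule P_strong_lim)
  show "G n * P m = G m" if "m \<le> n" for m n
    unfolding G_def P_def mul_def using lift_op_mult[OF bounded_operator_gen bounded_operator_cut]
    by (simp add: gen_cut[OF that])
  show "P m * G m = G m" for m
    unfolding G_def P_def mul_def using lift_op_mult[OF bounded_operator_cut bounded_operator_gen]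
    by (simp add: cut_gen)
  show "P m * sc z = sc z * P m" for m z
    unfolding P_def mul_def by (rule sc_commute_lift_op[OF bounded_operator_cut])
  show "G m * sc z = sc z * G m" for m z
    unfolding G_def by (rule sc_commute_lift_op[OF bounded_operator_gen])
  show "norm (exp (sc z * G n)) \<le> exp (C * norm z)" if "k * norm z \<le> Re z" for n z
    by (rule norm_exp_G_general[OF c_bound]) (use k C that in auto)
  show "G n * R = (\<mu> *\<^sub>R R - 1 + K) * P n" for n by (rule G_R)
  show "R * P n = P n * R" for n
    unfolding R_def P_def mul_def lift_op_mult[OF bounded_operator_R bounded_operator_cut]
      lift_op_mult[OF bounded_operator_cut bounded_operator_R] by (simp add: mult_ac)
  show "norm (P n) \<le> 1" for n
    unfolding P_def mul_def
    by (rule norm_lift_op_le[OF bounded_operator_cut zero_le_one])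
      (rule bounded_operator_multiplication(2), auto simp: cut_def)
  show "norm K < 1"
    using norm_lift_op_le[OF bounded_operator_K(1) q(1) bounded_operator_K(2)] q(2) by (simp add: K_def)
qed (use k C in auto)

lemma norm_T_le_1:
  assumes "AE y in lebesgue. (\<integral>\<^sup>+x. ennreal (c x y) \<partial>lebesgue) \<le> ennreal (\<alpha> y)" and t: "0 \<le> t"
  shows "norm (T (of_real t)) \<le> 1"
proof (rule strong_lim_norm_le[OF T_lim])
  show "norm (exp (sc (of_real t) * G n)) \<le> 1" for n
    using norm_exp_G_general[of 1 0 "of_real t" n] assms by simp
qed (use t in simp)

text \<open>The loss is the only negative part of \<open>G n\<close>, and on the truncation its rate
  is at most \<open>B\<close>, so the shift by \<open>B\<close> leaves a nonnegative coefficient.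
  \<open>T_pos\<close> then writes the exponential as exp(- t B) times the exponential of a positive
  operator.\<close>

lemma G_plus_pos:
  assumes "AE x in lebesgue. \<alpha>\<^sub>n n x \<le> B" and u: "u \<in> pos"
  shows "(G n + B *\<^sub>R 1) $$ u \<in> pos"
proof -
  have u': "AE x in lebesgue. fn u x = of_real (norm (fn u x))" using u by (simp add: pos_def)
  have k: "kernel_op (c\<^sub>n n) (fn u) x = of_real (LINT y|lebesgue. c\<^sub>n n x y * norm (fn u y))" for x
  proof -
    have "kernel_op (c\<^sub>n n) (fn u) x = kernel_op (c\<^sub>n n) (\<lambda>x. of_real (norm (fn u x))) x"
      by (rule kernel_op_cong_AE[OF c\<^sub>n_meas]) (use u' in auto)
    then show ?thesis
      by (simp add: kernel_op_def scaleR_conv_of_real flip: of_real_mult)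
  qed
  have "(G n + B *\<^sub>R 1) $$ u = G n $$ u + B *\<^sub>R u" by (simp add: app_simps)
  moreover have "AE x in lebesgue. fn (G n $$ u + B *\<^sub>R u) x = of_real (norm (fn (G n $$ u + B *\<^sub>R u) x))"
    using fn_lift_op[OF bounded_operator_gen, of n u, folded G_def] fn_add[of "G n $$ u" "B *\<^sub>R u"]
      fn_scaleR[of B u] u' assms(1)
  proof eventually_elim
    case (elim x)
    define r where "r = (LINT y|lebesgue. c\<^sub>n n x y * norm (fn u y)) + (B - \<alpha>\<^sub>n n x) * norm (fn u x)"
    have "0 \<le> r"
      unfolding r_def using elim(5) by (intro add_nonneg_nonneg integral_nonneg_AE) (auto simp: c\<^sub>n_nonneg)
    have "fn (G n $$ u + B *\<^sub>R u) x = kernel_op (c\<^sub>n n) (fn u) x + of_real (B - \<alpha>\<^sub>n n x) * fn u x"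
      unfolding elim(1-3) by (simp add: gen_def scaleR_conv_of_real algebra_simps)
    also have "\<dots> = of_real r"
      unfolding r_def k by (subst elim(4)) simp
    finally show ?case using \<open>0 \<le> r\<close> by simp
  qed
  ultimately show ?thesis by (simp add: pos_def)
qed

lemma T_pos:
  assumes t: "0 \<le> t" and u: "u \<in> pos"
  shows "T (of_real t) $$ u \<in> pos"
proof (rule T_invariant[OF _ closed_pos])
  fix n
  obtain B where B: "0 \<le> B" "AE x in lebesgue. \<alpha>\<^sub>n n x \<le> B" by (rule \<alpha>\<^sub>n_bounded)
  let ?X = "t *\<^sub>R (G n + B *\<^sub>R 1)" and ?Y = "(- (t * B)) *\<^sub>R (1 :: l1 endo)"
  have "exp (sc (of_real t) * G n) = exp (?X + ?Y)"
    by (simp add: sc_of_real algebra_simps)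
  also have "\<dots> = exp ?X * exp ?Y"
    by (rule exp_add_commuting) simp
  also have "\<dots> $$ u = exp (- (t * B)) *\<^sub>R (exp ?X $$ u)"
    by (simp add: exp_scaleR_one app_simps del: scaleR_minus_left)
  finally have eq: "exp (sc (of_real t) * G n) $$ u = exp (- (t * B)) *\<^sub>R (exp ?X $$ u)" .
  have "?X $$ v \<in> pos" if "v \<in> pos" for v
    using pos_scaleR[OF G_plus_pos[OF B(2) that] t] by (simp add: app_simps)
  then show "exp (sc (of_real t) * G n) $$ u \<in> pos"
    unfolding eq by (intro pos_scaleR exp_pos u) auto
qed (use t in simp)

text \<open>Both coefficients vanish off \<Omega>, so each truncated generator commutes with the
  restriction to \<Omega>. The functions supported in \<Omega> will be the image of the weighted
  space, which is thereby invariant under \<open>T\<close>.\<close>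

lemma T_restrict_commute:
  assumes z: "z \<in> cone" and \<Omega>: "\<Omega> \<in> sets lebesgue"
    and off: "\<And>x. x \<notin> \<Omega> \<Longrightarrow> \<alpha> x = 0" "\<And>x y. x \<notin> \<Omega> \<or> y \<notin> \<Omega> \<Longrightarrow> c x y = 0"
  shows "T z * mul (indicator \<Omega>) = mul (indicator \<Omega>) * T z"
proof (rule T_commute[OF z])
  have b: "bounded_operator lebesgue (\<lambda>f x. (indicator \<Omega> x :: complex) * f x)"
    by (rule bounded_operator_multiplication(1)[where K = 1]) (use \<Omega> in \<open>auto simp: indicator_def\<close>)
  show "mul (indicator \<Omega>) * sc z = sc z * mul (indicator \<Omega>)"
    unfolding mul_def by (rule sc_commute_lift_op[OF b])
  fix n
  have "gen n (\<lambda>x. indicator \<Omega> x * f x) = (\<lambda>x. indicator \<Omega> x * gen n f x)" for f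
  proof
    fix x
    have "kernel_op (c\<^sub>n n) (\<lambda>x. indicator \<Omega> x * f x) x = kernel_op (c\<^sub>n n) f x"
      unfolding kernel_op_def
      by (rule Bochner_Integration.integral_cong) (use off(2)[of x] in \<open>auto simp: c\<^sub>n_def indicator_def\<close>)
    moreover have "kernel_op (c\<^sub>n n) f x = indicator \<Omega> x * kernel_op (c\<^sub>n n) f x"
      using off(2)[of x] by (cases "x \<in> \<Omega>") (auto simp: kernel_op_def c\<^sub>n_def cong: if_cong)
    ultimately show "gen n (\<lambda>x. indicator \<Omega> x * f x) x = indicator \<Omega> x * gen n f x"
      by (simp add: gen_def algebra_simps)
  qed
  then show "mul (indicator \<Omega>) * G n = G n * mul (indicator \<Omega>)"
    unfolding mul_def G_def lift_op_mult[OF b bounded_operator_gen] lift_op_mult[OF bounded_operator_gen b]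
    by simp
qed

section \<open>Domain and values of the generator on the line\<close>

lemma fn_R: "AE x in lebesgue. fn (R $$ v) x = fn v x / of_real (\<mu> + \<alpha> x)"
  using fn_lift_op[OF bounded_operator_R, of v] unfolding R_def mul_def
  by eventually_elim simp

lemma fn_L:
  "AE x in lebesgue. fn (L $$ v) x = kernel_op c (fn (R $$ v)) x - of_real (\<alpha> x) * fn (R $$ v) x"
proof -
  have Rv: "AE x in lebesgue. fn v x = of_real (\<mu> + \<alpha> x) * fn (R $$ v) x"
    using fn_R[of v]
  proof eventually_elim
    case (elim x)
    have "complex_of_real (\<mu> + \<alpha> x) \<noteq> 0"
      using \<mu>_pos[of x] by (simp only: of_real_eq_0_iff)
    then show ?case by (simp only: elim) simp
  qed
  have k: "kernel_op (\<lambda>x y. c x y / (\<mu> + \<alpha> y)) (fn v) x = kernel_op c (fn (R $$ v)) x" for x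
  proof -
    have "kernel_op (\<lambda>x y. c x y / (\<mu> + \<alpha> y)) (fn v) x
      = kernel_op (\<lambda>x y. c x y / (\<mu> + \<alpha> y)) (\<lambda>y. of_real (\<mu> + \<alpha> y) * fn (R $$ v) y) x"
      by (rule kernel_op_cong_AE[OF K_meas]) (use Rv in auto)
    also have "\<dots> = kernel_op c (fn (R $$ v)) x"
      unfolding kernel_op_def
    proof (rule Bochner_Integration.integral_cong)
      fix y
      show "(c x y / (\<mu> + \<alpha> y)) *\<^sub>R (complex_of_real (\<mu> + \<alpha> y) * fn (R $$ v) y) = c x y *\<^sub>R fn (R $$ v) y"
        using \<mu>_pos[of y] unfolding scaleR_conv_of_real mult.assoc[symmetric] of_real_mult[symmetric] by simp
    qed simp
    finally show ?thesis .
  qed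
  have L_app: "L $$ v = (\<mu> *\<^sub>R (R $$ v) - v) + K $$ v" by (simp add: L_def app_simps)
  show ?thesis
    unfolding L_app
    using fn_add[of "\<mu> *\<^sub>R (R $$ v) - v" "K $$ v"] fn_diff[of "\<mu> *\<^sub>R (R $$ v)" v] fn_scaleR[of \<mu> "R $$ v"]
      fn_lift_op[OF bounded_operator_K(1), of v, folded K_def] Rv
  proof eventually_elim
    case (elim x)
    show ?case
      unfolding elim(1-4) k by (subst elim(5)) (simp add: scaleR_conv_of_real algebra_simps)
  qed
qed

text \<open>The preimage of \<open>u\<close> is its product with \<open>\<mu> + \<alpha>\<close>,
  which is integrable exactly when the product with \<open>\<alpha>\<close> is, because
  \<open>u\<close> itself is integrable.\<close>

lemma range_R_iff: "(\<exists>v. u = R $$ v) \<longleftrightarrow> integrable lebesgue (\<lambda>x. of_real (\<alpha> x) * fn u x)"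
proof
  assume "\<exists>v. u = R $$ v"
  then obtain v where v: "u = R $$ v" ..
  show "integrable lebesgue (\<lambda>x. of_real (\<alpha> x) * fn u x)"
  proof (rule Bochner_Integration.integrable_bound[OF integrable_fn[of v]])
    show "AE x in lebesgue. norm (of_real (\<alpha> x) * fn u x) \<le> norm (fn v x)"
      using fn_R[of v] unfolding v
    proof eventually_elim
      case (elim x)
      have "norm (of_real (\<alpha> x) * fn (R $$ v) x) = \<alpha> x / (\<mu> + \<alpha> x) * norm (fn v x)"
        using \<mu>_pos[of x] \<alpha>_nonneg[of x] unfolding elim norm_mult norm_divide norm_of_real by simp
      also have "\<dots> \<le> 1 * norm (fn v x)"
        using \<mu>_pos[of x] C by (intro mult_right_mono) auto
      finally show ?case by simp
    qed
  qed measurable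
next
  assume i: "integrable lebesgue (\<lambda>x. of_real (\<alpha> x) * fn u x)"
  let ?f = "\<lambda>x. of_real (\<mu> + \<alpha> x) * fn u x"
  have f: "integrable lebesgue ?f"
    using i by (simp add: algebra_simps)
  have "u = R $$ toL1 ?f"
    unfolding l1_eq_iff using fn_R[of "toL1 ?f"] fn_toL1[OF f]
  proof eventually_elim
    case (elim x)
    have "complex_of_real (\<mu> + \<alpha> x) \<noteq> 0"
      using \<mu>_pos[of x] by (simp only: of_real_eq_0_iff)
    then show ?case by (simp only: elim) simp
  qed
  then show "\<exists>v. u = R $$ v" ..
qed

end

section \<open>Weighted spaces as subspaces\<close>

locale weight =
  fixes \<omega> :: "real \<Rightarrow> real"
  assumes \<omega>_meas: "\<omega> \<in> borel_measurable (lebesgue_on {0..})"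
    and \<omega>_nonneg: "\<And>x. 0 \<le> x \<Longrightarrow> 0 \<le> \<omega> x"
begin

abbreviation "W \<equiv> weighted \<omega>"

text \<open>Extension by 0 lets all integrals run over the whole line; the values of \<omega> at
  negative arguments are arbitrary.\<close>

definition w :: "real \<Rightarrow> real" where "w x = (if 0 < x then \<omega> x else 0)"

definition \<Omega> :: "real set" where "\<Omega> = {x. 0 < w x}"

definition emb :: "(real \<Rightarrow> complex) \<Rightarrow> l1" where
  "emb f = toL1 (\<lambda>x. w x *\<^sub>R f x)"

text \<open>Outside \<open>\<Omega>\<close> the inverse weight is \<open>inverse 0 = 0\<close>.\<close>

definition ext :: "l1 \<Rightarrow> real \<Rightarrow> complex" where
  "ext u x = fn u x /\<^sub>R w x"

definition embr :: "(real \<Rightarrow> real) \<Rightarrow> l1" where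
  "embr f = emb (\<lambda>x. of_real (f x))"

lemma w_nonneg: "0 \<le> w x"
  by (simp add: w_def \<omega>_nonneg)

lemma w_meas [measurable]: "w \<in> borel_measurable lebesgue"
proof -
  have "\<omega> \<in> borel_measurable (lebesgue_on {0<..})"
    by (rule measurable_restrict_mono[OF \<omega>_meas]) auto
  then have "(\<lambda>x. indicator {0<..} x *\<^sub>R \<omega> x) \<in> borel_measurable lebesgue"
    by (subst (asm) borel_measurable_restrict_space_iff) auto
  also have "(\<lambda>x. indicator {0<..} x *\<^sub>R \<omega> x) = w"
    by (auto simp: w_def indicator_def)
  finally show ?thesis .
qed

lemma \<omega>_meas_pos [measurable]: "\<omega> \<in> borel_measurable (lebesgue_on {0<..})"
  by (rule measurable_restrict_mono[OF \<omega>_meas]) auto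

lemma \<Omega>_sets [measurable]: "\<Omega> \<in> sets lebesgue"
  unfolding \<Omega>_def using measurable_sets[OF w_meas, of "{0<..}"] by (simp add: vimage_def)

lemma not_\<Omega>: "x \<notin> \<Omega> \<longleftrightarrow> w x = 0"
  using w_nonneg[of x] by (auto simp: \<Omega>_def)

lemma AE_W_iff: "(AE x in W. Q x) \<longleftrightarrow> (AE x in lebesgue. x \<in> \<Omega> \<longrightarrow> Q x)"
  unfolding weighted_def
  by (subst AE_density, simp, subst AE_restrict_space_iff)
    (auto simp: \<Omega>_def w_def intro!: arg_cong[where f = "\<lambda>P. eventually P _"])

lemma
  fixes f :: "real \<Rightarrow> 'b::{banach, second_countable_topology}"
  shows measurable_W_iff: "f \<in> borel_measurable W \<longleftrightarrow> (\<lambda>x. indicator {0<..} x *\<^sub>R f x) \<in> borel_measurable lebesgue"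
    and measurable_wf: "f \<in> borel_measurable W \<Longrightarrow> (\<lambda>x. w x *\<^sub>R f x) \<in> borel_measurable lebesgue"
    and integrable_W_iff: "f \<in> borel_measurable W \<Longrightarrow> integrable W f \<longleftrightarrow> integrable lebesgue (\<lambda>x. w x *\<^sub>R f x)"
    and integral_W: "f \<in> borel_measurable W \<Longrightarrow> integral\<^sup>L W f = (LINT x|lebesgue. w x *\<^sub>R f x)"
proof -
  have sub: "f \<in> borel_measurable W \<longleftrightarrow> f \<in> borel_measurable (lebesgue_on {0<..})"
    by (simp add: weighted_def)
  show m: "f \<in> borel_measurable W \<longleftrightarrow> (\<lambda>x. indicator {0<..} x *\<^sub>R f x) \<in> borel_measurable lebesgue"
    unfolding sub by (subst borel_measurable_restrict_space_iff) auto
  have eq: "indicator {0<..} x * \<omega> x = w x" for x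
    by (simp add: w_def indicator_def)
  show "(\<lambda>x. w x *\<^sub>R f x) \<in> borel_measurable lebesgue" if "f \<in> borel_measurable W"
  proof -
    have [measurable]: "(\<lambda>x. indicator {0<..} x *\<^sub>R f x) \<in> borel_measurable lebesgue" using that m by simp
    have "(\<lambda>x. w x *\<^sub>R (indicator {0<..} x *\<^sub>R f x)) \<in> borel_measurable lebesgue" by measurable
    also have "(\<lambda>x. w x *\<^sub>R (indicator {0<..} x *\<^sub>R f x)) = (\<lambda>x. w x *\<^sub>R f x)"
      by (auto simp: w_def indicator_def)
    finally show ?thesis .
  qed
  have ae: "AE x in lebesgue_on {0<..}. 0 \<le> \<omega> x"
    by (subst AE_restrict_space_iff) (auto simp: \<omega>_nonneg)
  show "integrable W f \<longleftrightarrow> integrable lebesgue (\<lambda>x. w x *\<^sub>R f x)" if "f \<in> borel_measurable W"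
    unfolding weighted_def using that
    by (subst integrable_density[OF _ \<omega>_meas_pos ae]) (auto simp: sub integrable_restrict_space eq)
  show "integral\<^sup>L W f = (LINT x|lebesgue. w x *\<^sub>R f x)" if "f \<in> borel_measurable W"
    unfolding weighted_def using that
    by (subst integral_density[OF _ \<omega>_meas_pos ae]) (auto simp: sub integral_restrict_space eq)
qed

lemma integrable_wf:
  fixes f :: "real \<Rightarrow> 'b::{banach, second_countable_topology}"
  shows "integrable W f \<Longrightarrow> integrable lebesgue (\<lambda>x. w x *\<^sub>R f x)"
  using integrable_W_iff[of f] by auto

lemma L1_norm_W:
  fixes f :: "real \<Rightarrow> 'k::{real_normed_field, banach, second_countable_topology}"
  assumes "integrable W f"
  shows "L1_norm W f = (LINT x|lebesgue. norm (w x *\<^sub>R f x))"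
proof -
  have "L1_norm W f = (LINT x|lebesgue. w x *\<^sub>R norm (f x))"
    unfolding L1_norm_def by (rule integral_W) (use assms in auto)
  then show ?thesis by (simp add: w_nonneg)
qed

lemma norm_emb: "integrable W f \<Longrightarrow> norm (emb f) = L1_norm W f"
  by (simp add: emb_def norm_toL1 integrable_wf L1_norm_W)

lemma fn_emb: "integrable W f \<Longrightarrow> AE x in lebesgue. fn (emb f) x = w x *\<^sub>R f x"
  unfolding emb_def by (rule fn_toL1[OF integrable_wf])

lemma emb_eq_iff:
  assumes "integrable W f" "integrable W g"
  shows "emb f = emb g \<longleftrightarrow> ae_eq W f g"
  unfolding emb_def ae_eq_def AE_W_iff
  by (subst toL1_eq_iff[OF integrable_wf[OF assms(1)] integrable_wf[OF assms(2)]])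
    (auto simp: not_\<Omega>[symmetric] intro!: arg_cong[where f = "\<lambda>P. eventually P _"])

lemma emb_add: "integrable W f \<Longrightarrow> integrable W g \<Longrightarrow> emb (\<lambda>x. f x + g x) = emb f + emb g"
  unfolding emb_def by (simp add: scaleR_add_right toL1_add integrable_wf)

lemma emb_diff: "integrable W f \<Longrightarrow> integrable W g \<Longrightarrow> emb (\<lambda>x. f x - g x) = emb f - emb g"
  unfolding emb_def by (simp add: scaleR_diff_right toL1_diff integrable_wf)

lemma emb_mult:
  assumes "integrable W f"
  shows "emb (\<lambda>x. z * f x) = sc z $$ emb f"
  unfolding l1_eq_iff
  using fn_sc[of z "emb f"] fn_emb[OF assms] fn_emb[OF integrable_mult_right[OF assms, of z]]
  by eventually_elim simp

lemma integrable_ext [simp]: "integrable W (ext u)"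
proof (subst integrable_W_iff)
  have [measurable]: "ext u \<in> borel_measurable lebesgue"
    unfolding ext_def[abs_def] by measurable
  show "ext u \<in> borel_measurable W"
    unfolding measurable_W_iff by measurable
  show "integrable lebesgue (\<lambda>x. w x *\<^sub>R ext u x)"
  proof (rule Bochner_Integration.integrable_bound[OF integrable_fn[of u]])
    show "AE x in lebesgue. norm (w x *\<^sub>R ext u x) \<le> norm (fn u x)"
    proof (rule AE_I2)
      show "norm (w x *\<^sub>R ext u x) \<le> norm (fn u x)" for x
        by (cases "w x = 0") (auto simp: ext_def)
    qed
  qed measurable
qed

text \<open>The projection onto the image of \<open>emb\<close>, as \<open>emb_ext\<close> and
  \<open>Q_emb\<close> confirm.\<close>

definition Q :: "l1 endo" where "Q = mul (indicator \<Omega>)"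

lemma fn_Q: "AE x in lebesgue. fn (Q $$ u) x = indicator \<Omega> x * fn u x"
  unfolding Q_def by (rule fn_mul[where K = 1]) (auto simp: indicator_def)

lemma emb_ext: "emb (ext u) = Q $$ u"
  unfolding l1_eq_iff using fn_emb[OF integrable_ext, of u] fn_Q[of u]
proof eventually_elim
  case (elim x)
  then show ?case using not_\<Omega>[of x] by (cases "w x = 0") (auto simp: ext_def)
qed

lemma norm_Q: "norm (Q $$ u) \<le> norm u"
proof -
  have "norm Q \<le> 1"
    unfolding Q_def mul_def
    by (rule norm_lift_op_le[OF bounded_operator_multiplication(1)[where K = 1] zero_le_one])
      (auto simp: indicator_def intro!: bounded_operator_multiplication(2)[where K = 1, simplified mult_1])
  then have "norm Q * norm u \<le> 1 * norm u" by (rule mult_right_mono) simp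
  with norm_app[of Q u] show ?thesis by simp
qed

lemma Q_emb:
  assumes "integrable W f"
  shows "Q $$ emb f = emb f"
  unfolding l1_eq_iff using fn_emb[OF assms] fn_Q[of "emb f"]
proof eventually_elim
  case (elim x)
  then show ?case using not_\<Omega>[of x] by (cases "w x = 0") auto
qed

lemma ext_emb: "integrable W f \<Longrightarrow> ae_eq W (ext (emb f)) f"
  by (subst emb_eq_iff[symmetric]) (auto simp: emb_ext Q_emb)

lemma ext_add: "ae_eq W (ext (u + v)) (\<lambda>x. ext u x + ext v x)"
  by (subst emb_eq_iff[symmetric]) (auto simp: emb_add emb_ext app_simps)

lemma ext_sc: "ae_eq W (ext (sc z $$ u)) (\<lambda>x. z * ext u x)"
proof (subst emb_eq_iff[symmetric])
  have "Q * sc z = sc z * Q"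
    unfolding Q_def mul_def
    by (rule sc_commute_lift_op[OF bounded_operator_multiplication(1)[where K = 1]]) (auto simp: indicator_def)
  then show "emb (ext (sc z $$ u)) = emb (\<lambda>x. z * ext u x)"
    by (simp add: emb_mult emb_ext) (simp flip: app_mult)
qed auto

lemma L1_norm_ext: "L1_norm W (ext u) \<le> norm u"
  using norm_Q[of u] by (simp add: norm_emb[symmetric] emb_ext)

text \<open>The operator \<open>E\<close> transported to functions on the weighted space. Applying
  \<open>emb\<close> returns \<open>Q $$ E $$ emb f\<close>, which is \<open>E $$ emb f\<close>
  whenever \<open>E\<close> commutes with \<open>Q\<close>.\<close>

definition down :: "l1 endo \<Rightarrow> (real \<Rightarrow> complex) \<Rightarrow> real \<Rightarrow> complex" where
  "down E f = ext (E $$ emb f)"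

lemma integrable_down [simp]: "integrable W (down E f)"
  by (simp add: down_def)

lemma bounded_operator_down:
  assumes E: "\<And>z. E * sc z = sc z * E"
  shows "bounded_operator W (down E)"
    and "integrable W f \<Longrightarrow> L1_norm W (down E f) \<le> norm E * L1_norm W f"
proof -
  show B: "L1_norm W (down E f) \<le> norm E * L1_norm W f" if "integrable W f" for f
    using order_trans[OF L1_norm_ext norm_app, of E "emb f"] that by (simp add: down_def norm_emb)
  have "E $$ sc z $$ u = sc z $$ E $$ u" for z u
    using E by (simp flip: app_mult)
  then show "bounded_operator W (down E)"
    unfolding bounded_operator_def L1_def
    using B ext_add ext_sc by (auto simp: down_def emb_add emb_mult app_simps)
qed

lemma bounded_operator_op_norm_le:
  fixes T :: "(real \<Rightarrow> 'k) \<Rightarrow> (real \<Rightarrow> 'k::{real_normed_field, banach, second_countable_topology})"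
  assumes K: "\<And>f. integrable M f \<Longrightarrow> L1_norm M (T f) \<le> K * L1_norm M f" and "0 \<le> K"
  shows "op_norm M T \<le> K" and "0 \<le> op_norm M T"
proof -
  have le: "L1_norm M (T f) / L1_norm M f \<le> K" if "f \<in> L1 M" for f
  proof -
    have "0 \<le> L1_norm M f" by (simp add: L1_norm_def)
    then show ?thesis
      using K[of f] that \<open>0 \<le> K\<close> by (cases "L1_norm M f = 0") (auto simp: L1_def pos_divide_le_eq)
  qed
  have z: "(\<lambda>x. 0) \<in> L1 M" by (simp add: L1_def)
  then show "op_norm M T \<le> K"
    unfolding op_norm_def using le by (intro cSUP_least) auto
  \<comment> \<open>The quotient for the zero function is 0 by the convention for division by zero,
    so the supremum, being taken over a bounded set, is nonnegative.\<close>
  have "L1_norm M (T (\<lambda>x. 0)) / L1_norm M (\<lambda>x. 0 :: 'k) \<le> op_norm M T"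
    unfolding op_norm_def by (rule cSUP_upper[OF z]) (use le in \<open>auto intro!: bdd_aboveI2\<close>)
  then show "0 \<le> op_norm M T" by (simp add: L1_norm_def)
qed

lemma embr_eq_iff:
  assumes "integrable W f" "integrable W g"
  shows "embr f = embr g \<longleftrightarrow> ae_eq W f g"
  unfolding embr_def using assms by (subst emb_eq_iff) (auto simp: ae_eq_def)

lemma norm_embr: "integrable W f \<Longrightarrow> norm (embr f) = L1_norm W f"
  unfolding embr_def by (subst norm_emb) (auto simp: L1_norm_def)

lemma embr_add: "integrable W f \<Longrightarrow> integrable W g \<Longrightarrow> embr (\<lambda>x. f x + g x) = embr f + embr g"
  unfolding embr_def by (simp add: emb_add)

lemma embr_diff: "integrable W f \<Longrightarrow> integrable W g \<Longrightarrow> embr (\<lambda>x. f x - g x) = embr f - embr g"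
  unfolding embr_def by (simp add: emb_diff)

lemma embr_scaleR: "integrable W f \<Longrightarrow> embr (\<lambda>x. r * f x) = r *\<^sub>R embr f"
  unfolding embr_def by (simp add: emb_mult sc_of_real app_simps)

lemma fn_embr: "integrable W f \<Longrightarrow> AE x in lebesgue. fn (embr f) x = of_real (w x * f x)"
  unfolding embr_def using fn_emb[of "\<lambda>x. of_real (f x)"] by (auto simp: scaleR_conv_of_real)

lemma embr_pos_iff:
  assumes "integrable W f"
  shows "embr f \<in> pos \<longleftrightarrow> (AE x in W. 0 \<le> f x)"
proof -
  have iff: "complex_of_real (w x * f x) = of_real (norm (complex_of_real (w x * f x))) \<longleftrightarrow> (x \<in> \<Omega> \<longrightarrow> 0 \<le> f x)" for x
    using w_nonneg[of x] unfolding norm_of_real of_real_eq_iff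
    by (auto simp: \<Omega>_def abs_mult zero_le_mult_iff abs_of_nonneg)
  have "(AE x in lebesgue. fn (embr f) x = of_real (norm (fn (embr f) x))) \<longleftrightarrow> (AE x in lebesgue. x \<in> \<Omega> \<longrightarrow> 0 \<le> f x)"
    by (rule eventually_subst) (use fn_embr[OF assms] in eventually_elim, simp only: iff)
  then show ?thesis unfolding pos_def AE_W_iff by simp
qed

end

section \<open>The fragmentation semigroup on the weighted space\<close>

text \<open>\<open>\<alpha>\<close> and \<open>c\<close> are versions of the coefficients adapted to
  the line; \<open>a\<close> and \<open>b\<close> are the given ones. \<open>c_eq\<close> is
  multiplied out because \<open>w y\<close> may be zero: for \<open>x\<close> in \<Omega> it then
  forces the given kernel to vanish for almost all such \<open>y > x\<close>, so arbitrary values of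
  \<open>f\<close> there do not matter. \<open>B_meas\<close> is a separate requirement because a
  density leaves the measurable sets unchanged: measurability also concerns the zeros of the weight,
  about which \<open>c_eq\<close> says nothing.\<close>

locale weighted_fragmentation = weight \<omega> + fragmentation \<alpha> c k C
  for \<omega> \<alpha> :: "real \<Rightarrow> real" and c :: "real \<Rightarrow> real \<Rightarrow> real" and k C :: real +
  fixes a :: "real \<Rightarrow> real" and b :: "real \<Rightarrow> real \<Rightarrow> real"
  assumes \<alpha>_off: "\<And>x. x \<notin> \<Omega> \<Longrightarrow> \<alpha> x = 0"
    and c_off: "\<And>x y. x \<notin> \<Omega> \<or> y \<notin> \<Omega> \<Longrightarrow> c x y = 0"
    and \<alpha>_eq: "AE x in lebesgue. x \<in> \<Omega> \<longrightarrow> \<alpha> x = a x"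
    and a_meas: "a \<in> borel_measurable W"
    and B_meas: "\<And>f. f \<in> borel_measurable W \<Longrightarrow> B_op a b f \<in> borel_measurable W"
    and c_eq: "AE x in lebesgue. x \<in> \<Omega> \<longrightarrow>
      (AE y in lebesgue. w x * (indicator {x<..} y * (a y * b x y)) = c x y * w y)"
begin

lemma T_Q: "z \<in> cone \<Longrightarrow> T z * Q = Q * T z"
  unfolding Q_def by (rule T_restrict_commute[OF _ \<Omega>_sets]) (use \<alpha>_off c_off in auto)

lemma Q_T_emb: "z \<in> cone \<Longrightarrow> integrable W f \<Longrightarrow> Q $$ T z $$ emb f = T z $$ emb f"
  using T_Q[of z] Q_emb[of f] by (metis app_mult)

lemma emb_down_T: "z \<in> cone \<Longrightarrow> integrable W f \<Longrightarrow> emb (down (T z) f) = T z $$ emb f"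
  by (simp add: down_def emb_ext Q_T_emb)

definition S :: "real \<Rightarrow> (real \<Rightarrow> real) \<Rightarrow> real \<Rightarrow> real" where
  "S t f x = Re (ext (T (of_real t) $$ embr f) x)"

lemma integrable_S [simp]: "integrable W (S t f)"
  unfolding S_def[abs_def] by (rule integrable_Re) simp

text \<open>The real part taken in \<open>S\<close> discards nothing: \<open>f\<close> is the
  difference of its positive and negative parts, and \<open>T\<close> maps both to positive elements
  by \<open>T_pos\<close>. That the result lies in the image of \<open>emb\<close> is
  \<open>Q_T_emb\<close>.\<close>

lemma embr_S:
  assumes t: "0 \<le> t" and f: "integrable W f"
  shows "embr (S t f) = T (of_real t) $$ embr f"
proof -
  define u where "u = T (of_real t) $$ embr f"
  let ?p = "\<lambda>x. max (f x) 0" and ?n = "\<lambda>x. max (- f x) 0"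
  have I: "integrable W ?p" "integrable W ?n" using f by auto
  have "embr f = embr (\<lambda>x. ?p x - ?n x)"
    by (rule arg_cong[where f = embr]) (auto simp: max_def)
  then have u: "u = T (of_real t) $$ embr ?p - T (of_real t) $$ embr ?n"
    by (simp add: u_def embr_diff I app_simps)
  have "T (of_real t) $$ embr ?p \<in> pos" "T (of_real t) $$ embr ?n \<in> pos"
    using I by (auto intro!: T_pos t simp: embr_pos_iff)
  then have "AE x in lebesgue. fn u x = of_real (Re (fn u x))"
    unfolding pos_def mem_Collect_eq u
    using fn_diff[of "T (of_real t) $$ embr ?p" "T (of_real t) $$ embr ?n"]
    by eventually_elim (metis Re_complex_of_real of_real_diff)
  then have "AE x in lebesgue. x \<in> \<Omega> \<longrightarrow> complex_of_real (S t f x) = ext u x"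
  proof eventually_elim
    case (elim x)
    have "Im (fn u x) = 0" by (subst elim) simp
    then have "Im (ext u x) = 0" by (simp add: ext_def)
    then show ?case by (simp add: S_def u_def[symmetric] complex_eq_iff)
  qed
  then have "embr (S t f) = emb (ext u)"
    unfolding embr_def by (subst emb_eq_iff) (simp_all add: ae_eq_def AE_W_iff)
  also have "\<dots> = u"
    using Q_T_emb[of "of_real t" "\<lambda>x. of_real (f x)"] t f by (simp add: emb_ext u_def embr_def)
  finally show ?thesis by (simp add: u_def)
qed

lemma S_bounded:
  assumes t: "0 \<le> t"
  shows "bounded_operator W (S t)"
    and "integrable W f \<Longrightarrow> L1_norm W (S t f) \<le> norm (T (of_real t)) * L1_norm W f"
proof -
  show B: "L1_norm W (S t f) \<le> norm (T (of_real t)) * L1_norm W f" if "integrable W f" for f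
    using norm_app[of "T (of_real t)" "embr f"] that by (simp add: norm_embr[symmetric] embr_S t)
  have "ae_eq W (S t (\<lambda>x. f x + g x)) (\<lambda>x. S t f x + S t g x)" if "integrable W f" "integrable W g" for f g
    using that by (subst embr_eq_iff[symmetric]) (simp_all add: embr_S t embr_add app_simps)
  moreover have "ae_eq W (S t (\<lambda>x. r * f x)) (\<lambda>x. r * S t f x)" if "integrable W f" for f r
    using that by (subst embr_eq_iff[symmetric]) (simp_all add: embr_S t embr_scaleR app_simps)
  ultimately show "bounded_operator W (S t)"
    unfolding bounded_operator_def L1_def using B by auto
qed

lemma C0_semigroup_S: "C0_semigroup W S"
  unfolding C0_semigroup_def L1_def mem_Collect_eq
proof (intro conjI allI impI ballI)
  fix f :: "real \<Rightarrow> real" assume "f \<in> {f. integrable W f}"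
  then have f: "integrable W f" by simp
  show "ae_eq W (S 0 f) f"
    using f embr_S[of 0 f] by (subst embr_eq_iff[symmetric]) (simp_all add: T_0)
  show "ae_eq W (S (s + t) f) (S s (S t f))" if "0 \<le> s" "0 \<le> t" for s t
    using f that T_add[OF of_real_cone[OF that(1)] of_real_cone[OF that(2)]] of_real_cone[of "s + t"]
    by (subst embr_eq_iff[symmetric]) (simp_all add: embr_S del: of_real_cone)
  have "((\<lambda>t. T (of_real t) $$ embr f) \<longlongrightarrow> embr f) (at_right 0)"
  proof (rule filterlim_compose[OF T_tendsto_0[OF subset_refl]])
    show "LIM t at_right 0. complex_of_real t :> at 0 within cone"
      unfolding filterlim_at
      by (auto intro!: tendsto_eq_intros simp: eventually_at_filter)
  qed
  then have "((\<lambda>t. norm (T (of_real t) $$ embr f - embr f)) \<longlongrightarrow> 0) (at_right 0)"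
    by (intro tendsto_norm_zero LIM_zero)
  moreover have "\<forall>\<^sub>F t in at_right 0. norm (T (of_real t) $$ embr f - embr f) = L1_norm W (\<lambda>x. S t f x - f x)"
    using f by (auto simp: eventually_at_filter norm_embr[symmetric] embr_diff embr_S)
  ultimately show "((\<lambda>t. L1_norm W (\<lambda>x. S t f x - f x)) \<longlongrightarrow> 0) (at_right 0)"
    by (rule Lim_transform_eventually)
qed (rule S_bounded)

section \<open>The generator on the weighted space\<close>

lemma has_generator_value_iff:
  "has_generator_value W S f g \<longleftrightarrow> integrable W f \<and> integrable W g \<and>
    ((\<lambda>t. quot t (embr f)) \<longlongrightarrow> embr g) (at_right 0)"
proof (cases "integrable W f \<and> integrable W g")
  case True
  have eq: "norm (quot t (embr f) - embr g) = L1_norm W (\<lambda>x. (S t f x - f x) / of_real t - g x)" if "0 < t" for t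
  proof -
    have I: "integrable W (\<lambda>x. S t f x - f x)" "integrable W (\<lambda>x. (1 / t) * (S t f x - f x))"
      using True by auto
    have "embr (\<lambda>x. (1 / t) * (S t f x - f x) - g x) = (1 / t) *\<^sub>R (embr (S t f) - embr f) - embr g"
      using True by (simp only: embr_diff[OF I(2)] embr_scaleR[OF I(1)] embr_diff[OF integrable_S])
    also have "\<dots> = quot t (embr f) - embr g"
      using True that by (simp add: embr_S quot_def)
    finally have "norm (quot t (embr f) - embr g) = L1_norm W (\<lambda>x. (1 / t) * (S t f x - f x) - g x)"
      using norm_embr[OF Bochner_Integration.integrable_diff[OF I(2)], of g] True by simp
    then show ?thesis by simp
  qed
  have "((\<lambda>t. quot t (embr f)) \<longlongrightarrow> embr g) (at_right 0) \<longleftrightarrow>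
    ((\<lambda>t. norm (quot t (embr f) - embr g)) \<longlongrightarrow> 0) (at_right 0)"
    by (simp add: LIM_zero_iff tendsto_norm_zero_iff)
  also have "\<dots> \<longleftrightarrow> ((\<lambda>t. L1_norm W (\<lambda>x. (S t f x - f x) / of_real t - g x)) \<longlongrightarrow> 0) (at_right 0)"
    by (rule tendsto_cong) (simp add: eventually_at_filter eq)
  finally show ?thesis using True by (simp add: has_generator_value_def L1_def)
qed (auto simp: has_generator_value_def L1_def)

lemma A_dom_iff: "f \<in> A_dom \<omega> a \<longleftrightarrow> integrable W f \<and> (\<exists>v. embr f = R $$ v)"
proof (cases "integrable W f")
  case True
  note [measurable] = a_meas borel_measurable_integrable[OF True]
  have m: "(\<lambda>x. a x * f x) \<in> borel_measurable W" by measurable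
  have [measurable]: "(\<lambda>x. w x * f x) \<in> borel_measurable lebesgue" "(\<lambda>x. w x * (a x * f x)) \<in> borel_measurable lebesgue"
    using measurable_wf[of f] measurable_wf[OF m] by auto
  have "(\<exists>v. embr f = R $$ v) \<longleftrightarrow> integrable lebesgue (\<lambda>x. of_real (\<alpha> x) * fn (embr f) x)"
    by (rule range_R_iff)
  also have "\<dots> \<longleftrightarrow> integrable lebesgue (\<lambda>x. complex_of_real (w x * (a x * f x)))"
  proof (rule integrable_cong_AE)
    show "AE x in lebesgue. of_real (\<alpha> x) * fn (embr f) x = complex_of_real (w x * (a x * f x))"
      using fn_embr[OF True] \<alpha>_eq
    proof eventually_elim
      case (elim x)
      then show ?case using not_\<Omega>[of x] by (cases "w x = 0") (auto simp: mult_ac)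
    qed
  qed measurable
  also have "\<dots> \<longleftrightarrow> integrable W (\<lambda>x. a x * f x)"
    using integrable_W_iff[OF m] by (simp only: complex_of_real_integrable_eq real_scaleR_def)
  finally show ?thesis using True by (simp add: A_dom_def L1_def)
qed (simp add: A_dom_def L1_def)

text \<open>For \<open>f\<close> in the domain, both \<open>g = w f\<close> and its product with
  \<open>\<alpha>\<close> are integrable, so the relative bound makes Tonelli's theorem applicable
  to \<open>c\<close> and \<open>g\<close>. It gives convergence of the integral defining
  \<open>B_op\<close> at almost every point of \<Omega> and integrability of the result;
  \<open>c_eq\<close> translates between the two kernels after division by
  \<open>w x > 0\<close>.\<close>

lemma
  assumes f: "f \<in> A_dom \<omega> a"
  shows A_dom_B_dom: "f \<in> B_dom \<omega> a b"
    and integrable_generator: "integrable W (\<lambda>x. A_op a f x + B_op a b f x)"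
    and embr_generator: "embr f = R $$ v \<Longrightarrow> embr (\<lambda>x. A_op a f x + B_op a b f x) = L $$ v"
proof -
  have I: "integrable W f" "integrable W (\<lambda>x. a x * f x)"
    using f by (auto simp: A_dom_def L1_def)
  define g where "g y = w y * f y" for y
  have g: "integrable lebesgue g" using integrable_wf[OF I(1)] by (simp add: g_def[abs_def])
  note [measurable] = borel_measurable_integrable[OF g]
  have "integrable lebesgue (\<lambda>x. w x * (a x * f x))" using integrable_wf[OF I(2)] by simp
  moreover have "AE x in lebesgue. w x * (a x * f x) = \<alpha> x * g x"
    using \<alpha>_eq
  proof eventually_elim
    case (elim x)
    then show ?case using not_\<Omega>[of x] by (cases "w x = 0") (auto simp: g_def mult_ac)
  qed
  ultimately have \<alpha>g: "integrable lebesgue (\<lambda>x. \<alpha> x * g x)"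
    by (subst integrable_cong_AE[where g = "\<lambda>x. w x * (a x * f x)"]) (auto simp: eq_commute)
  let ?m = "\<lambda>y. k * \<alpha> y + C"
  have m0: "0 \<le> ?m y" for y using k C \<alpha>_nonneg[of y] by simp
  have "integrable lebesgue (\<lambda>y. k * norm (\<alpha> y * g y) + C * norm (g y))"
    using \<alpha>g g by auto
  then have mg: "integrable lebesgue (\<lambda>y. ?m y * norm (g y))"
    by (simp add: abs_mult \<alpha>_nonneg algebra_simps)
  note kernel = AE_integrable_kernel[OF c_meas c_nonneg c_bound _ mg m0]
    integrable_kernel_op[OF c_meas c_nonneg c_bound _ mg m0]
  have ae: "AE x in lebesgue. x \<in> \<Omega> \<longrightarrow> set_integrable lebesgue {x<..} (\<lambda>y. a y * b x y * f y)
      \<and> w x * B_op a b f x = kernel_op c g x"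
  proof -
    have "AE x in lebesgue. integrable lebesgue (\<lambda>y. c x y *\<^sub>R g y)"
      by (rule kernel) measurable
    with c_eq show ?thesis
    proof eventually_elim
      case (elim x)
      show ?case
      proof
        assume x: "x \<in> \<Omega>"
        then have wx: "w x > 0" by (simp add: \<Omega>_def)
        let ?h = "\<lambda>y. indicator {x<..} y *\<^sub>R (a y * b x y * f y)"
        have int: "integrable lebesgue (\<lambda>y. (c x y *\<^sub>R g y) / w x)" using elim(2) by simp
        have "AE y in lebesgue. w x * (indicator {x<..} y * (a y * b x y)) = c x y * w y"
          using elim(1) x by simp
        then have eq: "AE y in lebesgue. (c x y *\<^sub>R g y) / w x = ?h y"
        proof eventually_elim
          case (elim y)
          have "c x y *\<^sub>R g y = (c x y * w y) * f y" by (simp add: g_def)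
          also have "\<dots> = w x * ?h y" by (simp add: elim[symmetric])
          finally show ?case using wx by simp
        qed
        \<comment> \<open>In this locale \<open>b\<close> is not known to be measurable; the
          measurability is inherited from the side of \<open>c\<close> by completeness of Lebesgue
          measure.\<close>
        have h: "?h \<in> borel_measurable lebesgue"
          by (rule borel_measurable_AE[OF borel_measurable_integrable[OF int] eq])
        have "integrable lebesgue ?h"
          using int integrable_cong_AE[OF borel_measurable_integrable[OF int] h eq] by simp
        moreover have "B_op a b f x = (LINT y|lebesgue. (c x y *\<^sub>R g y) / w x)"
          unfolding B_op_def set_lebesgue_integral_def
          by (rule integral_cong_AE[OF h borel_measurable_integrable[OF int]]) (use eq in \<open>simp add: eq_commute\<close>)
        then have "w x * B_op a b f x = kernel_op c g x"
          using wx by (simp add: kernel_op_def)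
        ultimately show "set_integrable lebesgue {x<..} (\<lambda>y. a y * b x y * f y) \<and> w x * B_op a b f x = kernel_op c g x"
          by (simp add: set_integrable_def)
      qed
    qed
  qed
  have wB: "AE x in lebesgue. w x * B_op a b f x = kernel_op c g x"
    using ae
  proof eventually_elim
    case (elim x)
    have "kernel_op c g x = 0" if "x \<notin> \<Omega>" using c_off[of x] that by (simp add: kernel_op_def)
    then show ?case using elim not_\<Omega>[of x] by auto
  qed
  have Bm: "B_op a b f \<in> borel_measurable W" using B_meas I(1) by auto
  have kg: "integrable lebesgue (kernel_op c g)" by (rule kernel) measurable
  have BI: "integrable W (B_op a b f)"
    using measurable_wf[OF Bm] wB kg
    by (subst integrable_W_iff[OF Bm], subst integrable_cong_AE[where g = "kernel_op c g"]) auto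
  show "f \<in> B_dom \<omega> a b"
    unfolding B_dom_def L1_def mem_Collect_eq AE_W_iff
    using I BI ae by (auto elim: eventually_mono)
  show AB: "integrable W (\<lambda>x. A_op a f x + B_op a b f x)"
    using I BI by (simp add: A_op_def)
  assume v: "embr f = R $$ v"
  have k: "kernel_op c (fn (R $$ v)) x = of_real (kernel_op c g x)" for x
  proof -
    have "kernel_op c (fn (R $$ v)) x = kernel_op c (\<lambda>y. of_real (g y)) x"
    proof (rule kernel_op_cong_AE[OF c_meas])
      show "AE y in lebesgue. fn (R $$ v) y = of_real (g y)"
        using fn_embr[OF I(1)] by (simp only: v g_def)
    qed measurable
    then show ?thesis by (simp add: kernel_op_def scaleR_conv_of_real flip: of_real_mult)
  qed
  show "embr (\<lambda>x. A_op a f x + B_op a b f x) = L $$ v"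
    unfolding l1_eq_iff using fn_embr[OF AB] fn_L[of v] fn_embr[OF I(1)] wB \<alpha>_eq
  proof eventually_elim
    case (elim x)
    have "w x * a x * f x = \<alpha> x * (w x * f x)"
      using elim(5) not_\<Omega>[of x] by (cases "w x = 0") auto
    moreover have "w x * (A_op a f x + B_op a b f x) = w x * B_op a b f x - w x * a x * f x"
      by (simp add: A_op_def algebra_simps)
    ultimately have "w x * (A_op a f x + B_op a b f x) = kernel_op c g x - \<alpha> x * (w x * f x)"
      by (simp only: elim(4))
    then show ?case
      unfolding elim(1) elim(2) k elim(3)[unfolded v] by simp
  qed
qed

lemma is_generator_S: "is_generator W S (A_dom \<omega> a) (\<lambda>f x. A_op a f x + B_op a b f x)"
proof -
  have 1: "has_generator_value W S f (\<lambda>x. A_op a f x + B_op a b f x)" if f: "f \<in> A_dom \<omega> a" for f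
  proof -
    obtain v where v: "embr f = R $$ v" using f A_dom_iff by blast
    then show ?thesis
      using f integrable_generator[OF f] embr_generator[OF f v] quot_R_tendsto[of v]
      by (simp add: has_generator_value_iff A_dom_iff)
  qed
  have 2: "f \<in> A_dom \<omega> a" if "has_generator_value W S f g" for f g
  proof -
    have "integrable W f" "((\<lambda>t. quot t (embr f)) \<longlongrightarrow> embr g) (at_right 0)"
      using that by (simp_all add: has_generator_value_iff)
    then show ?thesis using quot_tendstoD[of "embr f" "embr g"] A_dom_iff by metis
  qed
  show ?thesis unfolding is_generator_def using 1 2 by blast
qed

lemma positive_semigroup_S: "positive_semigroup W S"
  unfolding positive_semigroup_def L1_def
proof (intro allI impI ballI)
  fix t :: real and f :: "real \<Rightarrow> real" assume "0 \<le> t" "f \<in> {f. integrable W f}" "AE x in W. 0 \<le> f x"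
  then have "embr (S t f) \<in> pos"
    by (simp add: embr_S T_pos embr_pos_iff)
  then show "AE x in W. 0 \<le> S t f x" by (simp add: embr_pos_iff)
qed

lemma substochastic_semigroup_S:
  assumes "AE y in lebesgue. (\<integral>\<^sup>+x. ennreal (c x y) \<partial>lebesgue) \<le> ennreal (\<alpha> y)"
  shows "substochastic_semigroup W S"
  unfolding substochastic_semigroup_def
proof (intro conjI positive_semigroup_S allI impI)
  fix t :: real assume t: "0 \<le> t"
  show "op_norm W (S t) \<le> 1"
  proof (rule bounded_operator_op_norm_le(1))
    fix f :: "real \<Rightarrow> real" assume f: "integrable W f"
    have "L1_norm W (S t f) \<le> norm (T (of_real t)) * L1_norm W f" by (rule S_bounded(2)[OF t f])
    also have "\<dots> \<le> 1 * L1_norm W f"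
      by (intro mult_right_mono norm_T_le_1 assms t) (simp add: L1_norm_def)
    finally show "L1_norm W (S t f) \<le> 1 * L1_norm W f" .
  qed simp
qed

text \<open>The strict inequality is the input of \<open>T_differentiable\<close>: it keeps a whole
  disc around \<open>z\<close> inside the cone.\<close>

lemma sector_cone:
  assumes "z \<in> sector (arccos k)"
  shows "k * norm z < Re z"
proof -
  have z: "z \<noteq> 0" "\<bar>Arg z\<bar> < arccos k" using assms by (auto simp: sector_def)
  have "cos (arccos k) < cos \<bar>Arg z\<bar>"
    using z k by (intro cos_monotone_0_pi arccos_ubound) auto
  then have "k < cos (Arg z)" using k by simp
  moreover have "Re z = norm z * cos (Arg z)"
    by (metis Re_rcis rcis_cmod_Arg)
  ultimately show ?thesis using z by (simp add: mult.commute)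
qed

lemma cone_add: "z \<in> cone \<Longrightarrow> z' \<in> cone \<Longrightarrow> z + z' \<in> cone"
  using mult_left_mono[OF norm_triangle_ineq[of z z'], of k] k by (simp add: cone_def distrib_left)

text \<open>After \<open>emb\<close>, the projection \<open>Q\<close> stands in front of the whole
  remainder and is removed by \<open>norm_Q\<close>, so the quadratic bound on the line applies
  directly. Division by \<open>h\<close> leaves a bound linear in \<open>norm h\<close>.\<close>

lemma operator_analytic_T: "operator_analytic_on W (\<lambda>z. down (T z)) (sector (arccos k))"
  unfolding operator_analytic_on_def
proof
  fix z assume "z \<in> sector (arccos k)"
  then obtain D K d where d: "d > 0" and D: "\<And>y. D * sc y = sc y * D"
    and K: "\<And>h::complex. norm h < d \<Longrightarrow> norm (T (z + h) - T z - sc h * D) \<le> K * (norm h)\<^sup>2"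
    using T_differentiable[OF sector_cone] by metis
  let ?X = "\<lambda>h f x. (down (T (z + h)) f x - down (T z) f x) / h - down D f x"
  have le: "L1_norm W (?X h f) \<le> (K * norm h) * L1_norm W f"
    if h: "h \<noteq> 0" "norm h < d" and f: "integrable W f" for h f
  proof -
    have I: "integrable W (?X h f)"
      by (intro Bochner_Integration.integrable_diff integrable_divide integrable_down)
    have "?X h f = (\<lambda>x. (1 / h) * ((down (T (z + h)) f x - down (T z) f x) - h * down D f x))"
      using h by (auto simp: field_simps)
    then have "emb (?X h f) = emb (\<lambda>x. (1 / h) * ((down (T (z + h)) f x - down (T z) f x) - h * down D f x))"
      by (rule arg_cong)
    also have "\<dots> = sc (1 / h) $$ (emb (down (T (z + h)) f) - emb (down (T z) f) - sc h $$ emb (down D f))"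
      by (subst emb_mult, simp, subst emb_diff, simp, simp, subst emb_diff, simp, simp, subst emb_mult) simp_all
    also have "\<dots> = sc (1 / h) $$ (Q $$ (T (z + h) - T z - sc h * D) $$ emb f)"
    proof -
      have "sc h $$ Q $$ u = Q $$ sc h $$ u" for u
        using sc_commute_lift_op[OF bounded_operator_multiplication(1)[of "indicator \<Omega>" lebesgue 1], of h]
        by (auto simp: Q_def mul_def indicator_def simp flip: app_mult)
      then show ?thesis
        by (simp only: down_def emb_ext app_simps app_mult)
    qed
    finally have eX: "emb (?X h f) = sc (1 / h) $$ (Q $$ (T (z + h) - T z - sc h * D) $$ emb f)" .
    have "L1_norm W (?X h f) = norm (1 / h) * norm (Q $$ (T (z + h) - T z - sc h * D) $$ emb f)"
      unfolding norm_emb[OF I, symmetric] eX norm_sc_app ..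
    also have "\<dots> \<le> norm (1 / h) * (norm (T (z + h) - T z - sc h * D) * norm (emb f))"
      by (intro mult_left_mono order_trans[OF norm_Q norm_app]) simp
    also have "\<dots> \<le> norm (1 / h) * ((K * (norm h)\<^sup>2) * norm (emb f))"
      by (intro mult_left_mono mult_right_mono K h) auto
    also have "\<dots> = (K * norm h) * L1_norm W f"
      using h f by (simp add: norm_emb norm_divide power2_eq_square)
    finally show ?thesis .
  qed
  \<comment> \<open>The quadratic estimate at \<open>h = d / 2\<close> forces \<open>K\<close> to be
    nonnegative.\<close>
  have K0: "0 \<le> K"
    using order_trans[OF norm_ge_zero K[of "of_real (d / 2)"]] d by (simp add: zero_le_mult_iff)
  have b: "0 \<le> op_norm W (?X h) \<and> op_norm W (?X h) \<le> K * norm h" if "h \<noteq> 0 \<and> norm h < d" for h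
    using bounded_operator_op_norm_le[of W "?X h" "K * norm h"] le[of h] that K0 by simp
  have "((\<lambda>h. op_norm W (?X h)) \<longlongrightarrow> 0) (at 0)"
  proof (rule tendsto_sandwich)
    have ev: "\<forall>\<^sub>F h in at (0::complex). h \<noteq> 0 \<and> norm h < d"
      using d by (auto simp: eventually_at dist_norm)
    show "\<forall>\<^sub>F h in at 0. 0 \<le> op_norm W (?X h)"
      by (rule eventually_mono[OF ev]) (rule conjunct1[OF b])
    show "\<forall>\<^sub>F h in at 0. op_norm W (?X h) \<le> K * norm h"
      by (rule eventually_mono[OF ev]) (rule conjunct2[OF b])
    show "((\<lambda>h::complex. K * norm h) \<longlongrightarrow> 0) (at 0)"
      by (intro tendsto_mult_right_zero tendsto_norm_zero tendsto_ident_at)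
  qed simp
  then show "\<exists>D. bounded_operator W D \<and>
      ((\<lambda>h. op_norm W (\<lambda>f x. (down (T (z + h)) f x - down (T z) f x) / h - D f x)) \<longlongrightarrow> 0) (at 0)"
    using bounded_operator_down(1)[OF D] by blast
qed

lemma emb_eq_embr: "integrable W f \<Longrightarrow> emb f = embr (\<lambda>x. Re (f x)) + sc \<i> $$ embr (\<lambda>x. Im (f x))"
  unfolding embr_def
  by (subst emb_mult[symmetric], simp add: integrable_Im, subst emb_add[symmetric])
    (auto simp: integrable_Re integrable_Im complex_eq[symmetric])

lemma analytic_semigroup_S: "analytic_semigroup W S"
  unfolding analytic_semigroup_def
proof (intro exI conjI)
  have sc: "z \<in> sector (arccos k) \<Longrightarrow> z \<in> cone" for z
    using sector_cone[of z] by (simp add: cone_def)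
  show "0 < arccos k" using arccos_less_arccos[of k 1] k by simp
  show "arccos k \<le> pi / 2" using k by (intro arccos_le_pi2) auto
  show "\<forall>z\<in>insert 0 (sector (arccos k)). bounded_operator W (down (T z))"
    using sc by (auto intro!: bounded_operator_down(1) T_sc)
  show "operator_analytic_on W (\<lambda>z. down (T z)) (sector (arccos k))"
    by (rule operator_analytic_T)
  show "\<forall>f\<in>L1 W. ae_eq W (down (T 0) f) f"
    by (auto simp: L1_def down_def T_0 ext_emb)
  show "\<forall>t\<ge>0. \<forall>f\<in>L1 W. ae_eq W (down (T (of_real t)) f) (complexification (S t) f)"
  proof (intro allI impI ballI)
    fix t :: real and f :: "real \<Rightarrow> complex" assume t: "0 \<le> t" and "f \<in> L1 W"
    then have f: "integrable W f" by (simp add: L1_def)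
    have c: "complexification (S t) f = (\<lambda>x. of_real (S t (\<lambda>y. Re (f y)) x) + \<i> * of_real (S t (\<lambda>y. Im (f y)) x))"
      by (simp add: complexification_def Complex_eq)
    have I: "integrable W (complexification (S t) f)"
      unfolding c by (intro Bochner_Integration.integrable_add integrable_mult_right integrable_of_real integrable_S)
    have "emb (complexification (S t) f) = embr (S t (\<lambda>y. Re (f y))) + sc \<i> $$ embr (S t (\<lambda>y. Im (f y)))"
      by (subst emb_eq_embr[OF I]) (simp add: complexification_def)
    also have "\<dots> = T (of_real t) $$ (embr (\<lambda>x. Re (f x)) + sc \<i> $$ embr (\<lambda>x. Im (f x)))"
      using T_sc[of "of_real t" \<i>] t f
      by (simp add: embr_S integrable_Re integrable_Im app_simps) (simp flip: app_mult)
    also have "\<dots> = emb (down (T (of_real t)) f)"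
      using t f by (simp add: emb_down_T emb_eq_embr[OF f, symmetric])
    finally show "ae_eq W (down (T (of_real t)) f) (complexification (S t) f)"
      by (subst emb_eq_iff[symmetric]) (simp_all add: I)
  qed
  show "\<forall>z\<in>sector (arccos k). \<forall>y\<in>sector (arccos k). \<forall>f\<in>L1 W.
      ae_eq W (down (T (z + y)) f) (down (T z) (down (T y) f))"
  proof (intro ballI)
    fix z y and f :: "real \<Rightarrow> complex"
    assume zy: "z \<in> sector (arccos k)" "y \<in> sector (arccos k)" and "f \<in> L1 W"
    then have f: "integrable W f" by (simp add: L1_def)
    note c = sc[OF zy(1)] sc[OF zy(2)] cone_add[OF sc[OF zy(1)] sc[OF zy(2)]]
    have "emb (down (T (z + y)) f) = T (z + y) $$ emb f"
      by (rule emb_down_T[OF c(3) f])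
    also have "\<dots> = emb (down (T z) (down (T y) f))"
      unfolding T_add[OF c] app_mult emb_down_T[OF c(1) integrable_down] emb_down_T[OF c(2) f] ..
    finally show "ae_eq W (down (T (z + y)) f) (down (T z) (down (T y) f))"
      by (subst emb_eq_iff[symmetric]) simp_all
  qed
  show "\<forall>\<theta>'. 0 < \<theta>' \<and> \<theta>' < arccos k \<longrightarrow>
    (\<forall>f\<in>L1 W. ((\<lambda>z. L1_norm W (\<lambda>x. down (T z) f x - f x)) \<longlongrightarrow> 0) (at 0 within sector \<theta>'))"
  proof (intro allI impI ballI)
    fix \<theta>' and f :: "real \<Rightarrow> complex" assume \<theta>': "0 < \<theta>' \<and> \<theta>' < arccos k" and "f \<in> L1 W"
    then have f: "integrable W f" by (simp add: L1_def)
    have sub: "sector \<theta>' \<subseteq> cone" using \<theta>' sc by (auto simp: sector_def)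
    have "((\<lambda>z. norm (T z $$ emb f - emb f)) \<longlongrightarrow> 0) (at 0 within sector \<theta>')"
      by (intro tendsto_norm_zero LIM_zero T_tendsto_0 sub)
    moreover have "\<forall>\<^sub>F z in at 0 within sector \<theta>'. norm (T z $$ emb f - emb f) = L1_norm W (\<lambda>x. down (T z) f x - f x)"
      unfolding eventually_at_filter
      using f sub by (intro always_eventually allI impI) (subst norm_emb[symmetric], auto simp: emb_diff emb_down_T)
    ultimately show "((\<lambda>z. L1_norm W (\<lambda>x. down (T z) f x - f x)) \<longlongrightarrow> 0) (at 0 within sector \<theta>')"
      by (rule Lim_transform_eventually)
  qed
qed

end

section \<open>From the given coefficients to a jointly measurable kernel\<close>

lemma lebesgue_pair_projections [measurable]:
  "fst \<in> borel_measurable ((lebesgue :: real measure) \<Otimes>\<^sub>M (lebesgue :: real measure))"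
  "snd \<in> borel_measurable ((lebesgue :: real measure) \<Otimes>\<^sub>M (lebesgue :: real measure))"
  using measurable_compose[OF measurable_fst lebesgue_borel_measurable_id]
    measurable_compose[OF measurable_snd lebesgue_borel_measurable_id] by blast+

text \<open>The given kernel is Lebesgue measurable in the plane, whereas Tonelli's theorem was
  applied with measurability for the product of the two line sigma-algebras. A Borel version differs
  from it only on a planar null set, and almost every section of such a set, in either direction, is
  null.\<close>

lemma kernel_Borel_representative:
  fixes b :: "real \<Rightarrow> real \<Rightarrow> real"
  assumes "(\<lambda>(x, y). b x y) \<in> borel_measurable (lebesgue_on ({0<..} \<times> {0<..}))"
  obtains b' :: "real \<Rightarrow> real \<Rightarrow> real"
  where "(\<lambda>(x, y). b' x y) \<in> borel_measurable (lebesgue \<Otimes>\<^sub>M lebesgue)"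
    and "AE x in lebesgue. AE y in lebesgue. 0 < x \<longrightarrow> 0 < y \<longrightarrow> b x y = b' x y"
    and "AE y in lebesgue. AE x in lebesgue. 0 < x \<longrightarrow> 0 < y \<longrightarrow> b x y = b' x y"
proof -
  let ?Q = "{0<..} \<times> {0<..} :: (real \<times> real) set"
  have "?Q \<in> sets lebesgue" by (intro lmeasurable_open borel_open sets_completionI_sets) (simp add: borel_open open_Times)
  then have "(\<lambda>p. indicator ?Q p *\<^sub>R (case p of (x, y) \<Rightarrow> b x y)) \<in> borel_measurable lebesgue"
    using assms by (subst (asm) borel_measurable_restrict_space_iff) auto
  from completion_ex_borel_measurable_real[OF this] obtain \<beta>
    where \<beta>: "\<beta> \<in> borel_measurable lborel" "AE p in lborel. indicator ?Q p *\<^sub>R (case p of (x, y) \<Rightarrow> b x y) = \<beta> p"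
    by blast
  \<comment> \<open>The exceptional set itself need not be Borel, since \<open>b\<close> is not; a
    Borel null set containing it makes the order of the two a.e. quantifiers exchangeable.\<close>
  from AE_E[OF \<beta>(2)] obtain N where N: "{p \<in> space lborel. indicator ?Q p *\<^sub>R (case p of (x, y) \<Rightarrow> b x y) \<noteq> \<beta> p} \<subseteq> N"
      "emeasure lborel N = 0" "N \<in> sets lborel"
    by blast
  have N': "AE p in lborel \<Otimes>\<^sub>M (lborel :: real measure). p \<notin> N"
    unfolding lborel_prod using N by (intro AE_not_in) (auto simp: null_sets_def)
  have Ns: "{p \<in> space (lborel \<Otimes>\<^sub>M (lborel :: real measure)). (fst p, snd p) \<notin> N} \<in> sets (lborel \<Otimes>\<^sub>M lborel)"
    unfolding lborel_prod using N(3) by auto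
  have b: "0 < x \<longrightarrow> 0 < y \<longrightarrow> b x y = \<beta> (x, y)" if "(x, y) \<notin> N" for x y
  proof -
    have "indicator ?Q (x, y) *\<^sub>R (case (x, y) of (x, y) \<Rightarrow> b x y) = \<beta> (x, y)"
    proof (rule ccontr)
      assume ne: "indicator ?Q (x, y) *\<^sub>R (case (x, y) of (x, y) \<Rightarrow> b x y) \<noteq> \<beta> (x, y)"
      have "(x, y) \<in> {p \<in> space lborel. indicator ?Q p *\<^sub>R (case p of (x, y) \<Rightarrow> b x y) \<noteq> \<beta> p}"
        by (intro CollectI conjI) (simp, rule ne)
      with N(1) that show False by blast
    qed
    then show ?thesis by (auto simp: indicator_def)
  qed
  have 1: "AE x in lborel. AE y in lborel. (x, y) \<notin> N"
    using lborel_pair.AE_pair[OF N'] by simp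
  then have 2: "AE y in lborel. AE x in lborel. (x, y) \<notin> N"
    using lborel_pair.AE_commute[OF Ns] by simp
  have [measurable]: "\<beta> \<in> borel_measurable borel" using \<beta>(1) by simp
  have "(\<lambda>p. \<beta> (fst p, snd p)) \<in> borel_measurable (lebesgue \<Otimes>\<^sub>M lebesgue)" by measurable
  then show ?thesis
  proof (intro that[of "\<lambda>x y. \<beta> (x, y)"])
    show "AE x in lebesgue. AE y in lebesgue. 0 < x \<longrightarrow> 0 < y \<longrightarrow> b x y = \<beta> (x, y)"
      by (intro AE_completion, rule eventually_mono[OF 1], intro AE_completion, erule eventually_mono) (rule b)
    show "AE y in lebesgue. AE x in lebesgue. 0 < x \<longrightarrow> 0 < y \<longrightarrow> b x y = \<beta> (x, y)"
      by (intro AE_completion, rule eventually_mono[OF 2], intro AE_completion, erule eventually_mono) (rule b)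
  qed (simp add: split_beta')
qed

lemma Linf_loc_bounded:
  assumes "Linf_loc a"
  obtains B where "0 \<le> B" "AE x in lebesgue. 0 < x \<longrightarrow> x \<le> r \<longrightarrow> a x \<le> B"
proof -
  have "compact {0..r} \<and> {0..r} \<subseteq> {0..}" by auto
  then obtain C where "AE x in lebesgue_on {0..r}. \<bar>a x\<bar> \<le> C"
    using assms unfolding Linf_loc_def by blast
  then have "AE x in lebesgue. x \<in> {0..r} \<longrightarrow> \<bar>a x\<bar> \<le> C"
    by (subst (asm) AE_restrict_space_iff) auto
  then have "AE x in lebesgue. 0 < x \<longrightarrow> x \<le> r \<longrightarrow> a x \<le> \<bar>C\<bar>"
    by eventually_elim auto
  then show ?thesis using that[of "\<bar>C\<bar>"] by simp
qed

theorem theorem4p2: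
  fixes a \<omega> :: "real \<Rightarrow> real" and b :: "real \<Rightarrow> real \<Rightarrow> real" and \<kappa>\<^sub>1 \<kappa>\<^sub>2 \<eta>\<^sub>0 :: real
  assumes "Linf_loc a"
    and "AE x in lebesgue_on {0<..}. 0 \<le> a x"
    and "(\<lambda>(x, y). b x y) \<in> borel_measurable (lebesgue_on ({0<..} \<times> {0<..}))"
    and "\<And>x y. 0 < x \<Longrightarrow> 0 < y \<Longrightarrow> 0 \<le> b x y"
    and "AE (x, y) in lebesgue_on ({0<..} \<times> {0<..}). y < x \<longrightarrow> b x y = 0"
    and "\<omega> \<in> borel_measurable (lebesgue_on {0..})"
    and "\<And>x. 0 \<le> x \<Longrightarrow> 0 \<le> \<omega> x"
    and "0 < \<kappa>\<^sub>1" and "0 < \<kappa>\<^sub>2" and "\<kappa>\<^sub>2 < 1" and "0 < \<eta>\<^sub>0"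
    and "\<And>y. 0 < y \<Longrightarrow> y \<le> \<eta>\<^sub>0 \<Longrightarrow>
           (\<integral>\<^sup>+x\<in>{0<..<y}. ennreal (b x y * \<omega> x) \<partial>lebesgue) \<le> ennreal (\<kappa>\<^sub>1 * \<omega> y)"
    and "\<And>y. \<eta>\<^sub>0 \<le> y \<Longrightarrow>
           (\<integral>\<^sup>+x\<in>{0<..<y}. ennreal (b x y * \<omega> x) \<partial>lebesgue) \<le> ennreal (\<kappa>\<^sub>2 * \<omega> y)"
  shows "A_dom \<omega> a \<subseteq> B_dom \<omega> a b \<and>
    (\<exists>S. C0_semigroup (weighted \<omega>) S \<and>
         is_generator (weighted \<omega>) S (A_dom \<omega> a) (\<lambda>f x. A_op a f x + B_op a b f x) \<and>
         analytic_semigroup (weighted \<omega>) S \<and>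
         positive_semigroup (weighted \<omega>) S \<and>
         (\<kappa>\<^sub>1 \<le> 1 \<longrightarrow> substochastic_semigroup (weighted \<omega>) S))"
proof -
  note a = assms(1,2) and b_nonneg = assms(4) and \<kappa>_pos = assms(8,9,10,11)
  interpret weight \<omega> by unfold_locales (use assms(6,7) in auto)
  obtain b' where b' [measurable]: "(\<lambda>(x, y). b' x y) \<in> borel_measurable (lebesgue \<Otimes>\<^sub>M lebesgue)"
    and bx: "AE x in lebesgue. AE y in lebesgue. 0 < x \<longrightarrow> 0 < y \<longrightarrow> b x y = b' x y"
    and b_y: "AE y in lebesgue. AE x in lebesgue. 0 < x \<longrightarrow> 0 < y \<longrightarrow> b x y = b' x y"
    using kernel_Borel_representative[OF assms(3)] by blast
  obtain B where B: "0 \<le> B" "AE x in lebesgue. 0 < x \<longrightarrow> x \<le> \<eta>\<^sub>0 \<longrightarrow> a x \<le> B"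
    using Linf_loc_bounded[OF a(1)] by blast
  have \<Omega>_pos: "x \<in> \<Omega> \<Longrightarrow> 0 < x" and w_pos: "0 < x \<Longrightarrow> w x = \<omega> x" for x
    by (auto simp: \<Omega>_def w_def split: if_splits)
  define \<kappa> where "\<kappa> y = (if y \<le> \<eta>\<^sub>0 then \<kappa>\<^sub>1 else \<kappa>\<^sub>2)" for y
  \<comment> \<open>With u = w f, the function w B f is the integral of w(x) b(x,y) a(y) / w(y)
    against u, and this kernel is \<open>c\<close>. The maxima with 0 and the cut to \<Omega> secure
    signs and supports at every point while changing the coefficients only where it does not matter.
    At zeros of \<open>w\<close> division by zero makes \<open>c\<close> vanish.\<close>
  define \<alpha> where "\<alpha> x = (if x \<in> \<Omega> then max 0 (a x) else 0)" for x
  define g where "g x y = (if 0 < x \<and> x < y then w x * max 0 (b' x y) else 0)" for x y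
  define c where "c x y = g x y * (\<alpha> y / w y)" for x y

  have "a \<in> borel_measurable (lebesgue_on {0..})" using a(1) by (simp add: Linf_loc_def)
  then have a_on: "a \<in> borel_measurable (lebesgue_on {0<..})"
    by (rule measurable_restrict_mono) auto
  then have a_W [measurable]: "a \<in> borel_measurable W" by (simp add: weighted_def)
  have a_meas [measurable]: "(\<lambda>x. indicator {0<..} x *\<^sub>R a x) \<in> borel_measurable lebesgue"
    using a_W measurable_W_iff by blast
  have "\<alpha> = (\<lambda>x. if x \<in> \<Omega> then max 0 (indicator {0<..} x *\<^sub>R a x) else 0)"
    using \<Omega>_pos by (auto simp: \<alpha>_def fun_eq_iff)
  then have \<alpha>_meas [measurable]: "\<alpha> \<in> borel_measurable lebesgue" by simp
  have \<alpha>_nonneg: "0 \<le> \<alpha> x" for x by (simp add: \<alpha>_def)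
  have \<alpha>_eq: "AE x in lebesgue. x \<in> \<Omega> \<longrightarrow> \<alpha> x = a x"
  proof -
    have "AE x in lebesgue. x \<in> {0<..} \<longrightarrow> 0 \<le> a x"
      using a(2) by (subst (asm) AE_restrict_space_iff) auto
    then show ?thesis by eventually_elim (use \<Omega>_pos in \<open>auto simp: \<alpha>_def\<close>)
  qed
  have \<alpha>_bound: "AE x in lebesgue. x \<le> r \<longrightarrow> \<alpha> x \<le> B'"
    if "0 \<le> B'" "AE x in lebesgue. 0 < x \<longrightarrow> x \<le> r \<longrightarrow> a x \<le> B'" for r B'
    using that(2) by eventually_elim (use \<Omega>_pos that(1) in \<open>auto simp: \<alpha>_def\<close>)

  have b'_m [measurable]: "(\<lambda>p. b' (fst p) (snd p)) \<in> borel_measurable (lebesgue \<Otimes>\<^sub>M lebesgue)"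
    using b' by (simp add: split_beta')
  have g_meas [measurable]: "(\<lambda>p. g (fst p) (snd p)) \<in> borel_measurable (lebesgue \<Otimes>\<^sub>M lebesgue)"
    unfolding g_def by measurable
  have c_meas: "(\<lambda>(x, y). c x y) \<in> borel_measurable (lebesgue \<Otimes>\<^sub>M lebesgue)"
    unfolding c_def split_beta' by measurable
  have g_nonneg: "0 \<le> g x y" for x y by (simp add: g_def w_nonneg)
  have c_nonneg: "0 \<le> c x y" for x y by (simp add: c_def g_nonneg \<alpha>_nonneg w_nonneg)
  have g_section: "(\<lambda>x. g x y) \<in> borel_measurable lebesgue" for y
    using borel_measurable_kernel_section(2)[of g y] g_meas by (simp add: split_beta')

  have g_bound: "AE y in lebesgue. 0 < y \<longrightarrow> (\<integral>\<^sup>+x. ennreal (g x y) \<partial>lebesgue) \<le> ennreal (\<kappa> y * w y)"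
    using b_y
  proof eventually_elim
    case (elim y)
    show ?case
    proof
      assume y: "0 < y"
      have "(\<integral>\<^sup>+x. ennreal (g x y) \<partial>lebesgue) = (\<integral>\<^sup>+x\<in>{0<..<y}. ennreal (b x y * \<omega> x) \<partial>lebesgue)"
      proof (rule nn_integral_cong_AE, use elim in eventually_elim)
        fix x assume "0 < x \<longrightarrow> 0 < y \<longrightarrow> b x y = b' x y"
        then show "ennreal (g x y) = ennreal (b x y * \<omega> x) * indicator {0<..<y} x"
          using y b_nonneg[of x y] by (auto simp: g_def w_pos indicator_def max_def mult.commute)
      qed
      also have "\<dots> \<le> ennreal (\<kappa> y * w y)"
        using assms(12)[of y] assms(13)[of y] y by (auto simp: \<kappa>_def w_pos)
      finally show "(\<integral>\<^sup>+x. ennreal (g x y) \<partial>lebesgue) \<le> ennreal (\<kappa> y * w y)" .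
    qed
  qed

  have kernel_bound: "AE y in lebesgue. (\<integral>\<^sup>+x. ennreal (c x y) \<partial>lebesgue) \<le> ennreal (\<kappa> y * \<alpha> y)"
    using g_bound
  proof eventually_elim
    case (elim y)
    show ?case
    proof (cases "y \<in> \<Omega>")
      case True
      then have y: "0 < y" "0 < w y" using \<Omega>_pos[OF True] by (simp_all add: \<Omega>_def)
      have r: "0 \<le> \<alpha> y / w y" using \<alpha>_nonneg w_nonneg by simp
      have "(\<integral>\<^sup>+x. ennreal (c x y) \<partial>lebesgue) = (\<integral>\<^sup>+x. ennreal (g x y) \<partial>lebesgue) * ennreal (\<alpha> y / w y)"
        unfolding c_def ennreal_mult[OF g_nonneg r]
        by (rule nn_integral_multc) (use g_section[of y] in simp)
      also have "\<dots> \<le> ennreal (\<kappa> y * w y) * ennreal (\<alpha> y / w y)"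
        using elim y by (intro mult_right_mono) auto
      also have "\<dots> = ennreal (\<kappa> y * \<alpha> y)"
        using y r \<kappa>_pos by (subst ennreal_mult[symmetric]) (auto simp: \<kappa>_def)
      finally show ?thesis .
    qed (simp add: c_def \<alpha>_def)
  qed

  \<comment> \<open>Where \<open>w\<close> vanishes, elements of the weighted space are arbitrary; the moment bound forces
    the kernel to vanish there.\<close>
  have g_null: "AE x in lebesgue. AE y in lebesgue. w y = 0 \<longrightarrow> g x y = 0"
  proof -
    have "AE y in lebesgue. AE x in lebesgue. w y = 0 \<longrightarrow> g x y = 0"
      using g_bound
    proof eventually_elim
      case (elim y)
      show ?case
      proof (cases "0 < y \<and> w y = 0")
        case True
        then have "(\<integral>\<^sup>+x. ennreal (g x y) \<partial>lebesgue) = 0" using elim by simp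
        then have "AE x in lebesgue. ennreal (g x y) = 0"
          using g_section[of y] by (subst (asm) nn_integral_0_iff_AE) auto
        then show ?thesis
          by eventually_elim (use g_nonneg in \<open>simp add: ennreal_eq_0_iff antisym\<close>)
      next
        case False
        then show ?thesis by (auto simp: g_def)
      qed
    qed
    moreover have "{p \<in> space (lebesgue \<Otimes>\<^sub>M lebesgue). w (snd p) = 0 \<longrightarrow> g (fst p) (snd p) = 0} \<in> sets (lebesgue \<Otimes>\<^sub>M lebesgue)"
      by measurable
    ultimately show ?thesis by (subst lebesgue_pair.AE_commute)
  qed

  interpret weighted_fragmentation \<omega> \<alpha> c \<kappa>\<^sub>2 "\<kappa>\<^sub>1 * B" a b
  proof
    show "\<exists>B. AE x in lebesgue. x \<le> real n \<longrightarrow> \<alpha> x \<le> B" for n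
    proof -
      obtain B' where "0 \<le> B'" "AE x in lebesgue. 0 < x \<longrightarrow> x \<le> real n \<longrightarrow> a x \<le> B'"
        by (rule Linf_loc_bounded[OF a(1)])
      from \<alpha>_bound[OF this] show ?thesis ..
    qed
    show "AE y in lebesgue. (\<integral>\<^sup>+x. ennreal (c x y) \<partial>lebesgue) \<le> ennreal (\<kappa>\<^sub>2 * \<alpha> y + \<kappa>\<^sub>1 * B)"
      using kernel_bound \<alpha>_bound[OF B]
    proof eventually_elim
      case (elim y)
      \<comment> \<open>Up to \<open>\<eta>\<^sub>0\<close> the whole gain goes into the constant
        \<open>\<kappa>\<^sub>1 * B\<close>, whatever the size of \<open>\<kappa>\<^sub>1\<close>;
        beyond it the factor is \<open>\<kappa>\<^sub>2\<close>.\<close>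
      have "\<kappa> y * \<alpha> y \<le> \<kappa>\<^sub>2 * \<alpha> y + \<kappa>\<^sub>1 * B"
      proof (cases "y \<le> \<eta>\<^sub>0")
        case True
        then have "\<kappa>\<^sub>1 * \<alpha> y \<le> \<kappa>\<^sub>1 * B" "0 \<le> \<kappa>\<^sub>2 * \<alpha> y"
          using elim(2) \<kappa>_pos \<alpha>_nonneg by auto
        then show ?thesis using True by (simp add: \<kappa>_def)
      next
        case False
        then show ?thesis using \<kappa>_pos B(1) by (simp add: \<kappa>_def)
      qed
      with elim(1) show ?case by (meson ennreal_leI order_trans)
    qed
    show "B_op a b f \<in> borel_measurable W" if f: "f \<in> borel_measurable W" for f
    proof -
      define A where "A y = indicator {0<..} y *\<^sub>R a y" for y :: real
      define F where "F y = indicator {0<..} y *\<^sub>R f y" for y :: real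
      have [measurable]: "A \<in> borel_measurable lebesgue" "F \<in> borel_measurable lebesgue"
        using iffD1[OF measurable_W_iff f] a_meas unfolding A_def[abs_def] F_def[abs_def] by blast+
      \<comment> \<open>The integrand of \<open>B_op\<close> with \<open>b\<close> replaced by its
        jointly measurable version and \<open>a\<close>, \<open>f\<close> set to 0 off the positive
        half-line. Its section integrals are measurable in \<open>x\<close> and agree with
        \<open>B_op a b f\<close> for almost every positive \<open>x\<close>, even where they
        diverge, since both sides then take the same default value.\<close>
      define h where "h x y = (if x < y then A y * b' x y * F y else 0)" for x y
      have h_meas: "(\<lambda>p. h (fst p) (snd p)) \<in> borel_measurable (lebesgue \<Otimes>\<^sub>M lebesgue)"
        unfolding h_def by measurable
      have h_section: "h x \<in> borel_measurable lebesgue" for x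
        using borel_measurable_kernel_section(1)[of h x] h_meas by (simp add: split_beta')
      have "(\<lambda>x. LINT y|lebesgue. h x y) \<in> borel_measurable lebesgue"
        by (rule lebesgue.borel_measurable_lebesgue_integral) (use h_meas in \<open>simp add: split_beta'\<close>)
      then have "(\<lambda>x. indicator {0<..} x *\<^sub>R (LINT y|lebesgue. h x y)) \<in> borel_measurable lebesgue"
        by measurable
      moreover have "AE x in lebesgue. indicator {0<..} x *\<^sub>R (LINT y|lebesgue. h x y) = indicator {0<..} x *\<^sub>R B_op a b f x"
        using bx
      proof eventually_elim
        case (elim x)
        show ?case
        proof (cases "0 < x")
          case True
          have eq: "AE y in lebesgue. h x y = indicator {x<..} y *\<^sub>R (a y * b x y * f y)"
            using elim by eventually_elim (use True in \<open>auto simp: h_def A_def F_def indicator_def\<close>)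
          have "B_op a b f x = (LINT y|lebesgue. h x y)"
            unfolding B_op_def set_lebesgue_integral_def
            by (rule integral_cong_AE[OF borel_measurable_AE[OF h_section eq] h_section])
              (use eq in eventually_elim, simp)
          then show ?thesis by simp
        qed simp
      qed
      ultimately have "(\<lambda>x. indicator {0<..} x *\<^sub>R B_op a b f x) \<in> borel_measurable lebesgue"
        by (rule borel_measurable_AE)
      then show ?thesis by (simp only: measurable_W_iff)
    qed
    show "AE x in lebesgue. x \<in> \<Omega> \<longrightarrow>
        (AE y in lebesgue. w x * (indicator {x<..} y * (a y * b x y)) = c x y * w y)"
      using bx g_null
    proof eventually_elim
      case (elim x)
      show ?case
      proof
        assume "x \<in> \<Omega>"
        then have x: "0 < x" by (rule \<Omega>_pos)
        show "AE y in lebesgue. w x * (indicator {x<..} y * (a y * b x y)) = c x y * w y"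
          using elim \<alpha>_eq
        proof eventually_elim
          case (elim y)
          show ?case
          proof (cases "x < y")
            case True
            then have g: "g x y = w x * b x y"
              using elim(1) x b_nonneg[of x y] by (auto simp: g_def max_def)
            show ?thesis
            proof (cases "w y = 0")
              case True
              then have "w x * b x y = 0" using elim(2) g by simp
              with True show ?thesis by auto
            next
              case False
              then have "\<alpha> y = a y" using elim(3) not_\<Omega> by blast
              with False True g show ?thesis by (simp add: c_def mult_ac)
            qed
          qed (simp add: c_def g_def)
        qed
      qed
    qed
    show "c x y = 0" if "y \<le> x" for x y
      using that by (simp add: c_def g_def)
    show "\<alpha> x = 0" if "x \<notin> \<Omega>" for x
      using that by (simp add: \<alpha>_def)
    show "c x y = 0" if "x \<notin> \<Omega> \<or> y \<notin> \<Omega>" for x y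
      using that not_\<Omega>[of x] by (auto simp: c_def g_def \<alpha>_def)
    show "0 \<le> \<kappa>\<^sub>1 * B"
      using B(1) \<kappa>_pos by simp
  qed (fact \<alpha>_meas \<alpha>_nonneg c_meas c_nonneg \<alpha>_eq a_W \<kappa>_pos)+

  have "AE y in lebesgue. (\<integral>\<^sup>+x. ennreal (c x y) \<partial>lebesgue) \<le> ennreal (\<alpha> y)" if "\<kappa>\<^sub>1 \<le> 1"
    using kernel_bound
  proof eventually_elim
    case (elim y)
    have "\<kappa> y * \<alpha> y \<le> 1 * \<alpha> y"
      using that \<kappa>_pos \<alpha>_nonneg by (intro mult_right_mono) (auto simp: \<kappa>_def)
    then show ?case by (intro order_trans[OF elim ennreal_leI]) simp
  qed
  then have "\<kappa>\<^sub>1 \<le> 1 \<longrightarrow> substochastic_semigroup W S"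
    by (intro impI substochastic_semigroup_S)
  moreover have "A_dom \<omega> a \<subseteq> B_dom \<omega> a b"
    by (intro subsetI A_dom_B_dom)
  ultimately show ?thesis
    by (intro conjI exI[of _ S] C0_semigroup_S is_generator_S analytic_semigroup_S positive_semigroup_S)
qed

end
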